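(* Let $n\ge1$ and let $\alpha\in(0,n+2)$, $\lambda$, $\sigma$ be constants with $0<\lambda<\frac{n+2-\alpha}{n}$ and $0\le\sigma\le\frac{n+2}{n}$. Suppose $u$ is a nonnegative function with $u\in C^{2,1}(\mathbb{R}^n\times(0,16))\cap L^\lambda(\mathbb{R}^n\times(0,16))$ satisfying $$0\le u_t-\Delta u\le \Big(\iint_{\mathbb{R}^n\times(0,16)}\Phi(x-y,t-s)^{\alpha/n}u(y,s)^\lambda\,dy\,ds\Big)\,u(x,t)^\sigma\quad\text{in }B_4(0)\times(0,16).$$ Then $\max_{|x|\le1}u(x,t)=O(t^{-n/2})$ as $t\to0^+$.
   Context: $\Phi$ is the heat kernel: $\Phi(x,t)=(4\pi t)^{-n/2}e^{-|x|^2/(4t)}$ for $t>0$ and $\Phi(x,t)=0$ for $t\le0$. $B_r(0)$ is the open ball of radius $r$ centered at the origin of $\mathbb{R}^n$. *)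

theory Defs
  imports "HOL-Analysis.Analysis" "HOL-Library.Landau_Symbols"
begin

definition heat_kernel :: "'a::euclidean_space \<Rightarrow> real \<Rightarrow> real" where
  "heat_kernel x t =
     (if t > 0 then (4 * pi * t) powr (- real DIM('a) / 2) * exp (- (norm x)\<^sup>2 / (4 * t)) else 0)"

text \<open>Nonnegative real power with the convention x^0 = 1 (also for x = 0).\<close>
definition nnpow :: "real \<Rightarrow> real \<Rightarrow> real" where
  "nnpow x a = (if a = 0 then 1 else x powr a)"

definition pdx :: "('a::euclidean_space \<Rightarrow> real) \<Rightarrow> 'a \<Rightarrow> 'a \<Rightarrow> real" where
  "pdx f i x = deriv (\<lambda>h. f (x + h *\<^sub>R i)) 0"

definition dt :: "('a \<Rightarrow> real \<Rightarrow> real) \<Rightarrow> 'a \<Rightarrow> real \<Rightarrow> real" where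
  "dt u x t = deriv (\<lambda>s. u x s) t"

definition lap :: "('a::euclidean_space \<Rightarrow> real \<Rightarrow> real) \<Rightarrow> 'a \<Rightarrow> real \<Rightarrow> real" where
  "lap u x t = (\<Sum>i\<in>Basis. pdx (\<lambda>y. pdx (\<lambda>z. u z t) i y) i x)"

definition C21 :: "('a::euclidean_space \<Rightarrow> real \<Rightarrow> real) \<Rightarrow> ('a \<times> real) set \<Rightarrow> bool" where
  "C21 u \<Omega> \<longleftrightarrow>
     continuous_on \<Omega> (\<lambda>(x,t). u x t) \<and>
     (\<forall>(x,t)\<in>\<Omega>. (\<lambda>s. u x s) differentiable (at t)) \<and>
     continuous_on \<Omega> (\<lambda>(x,t). dt u x t) \<and>
     (\<forall>i\<in>Basis.
        (\<forall>(x,t)\<in>\<Omega>. (\<lambda>h. u (x + h *\<^sub>R i) t) differentiable (at 0)) \<and>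
        continuous_on \<Omega> (\<lambda>(x,t). pdx (\<lambda>z. u z t) i x) \<and>
        (\<forall>j\<in>Basis.
           (\<forall>(x,t)\<in>\<Omega>. (\<lambda>h. pdx (\<lambda>z. u z t) i (x + h *\<^sub>R j)) differentiable (at 0)) \<and>
           continuous_on \<Omega> (\<lambda>(x,t). pdx (\<lambda>y. pdx (\<lambda>z. u z t) i y) j x)))"

end

theory Submission
  imports Defs "HOL-Probability.Distributions"
begin

text \<open>
  Write \<open>f = u_t - \<Delta>u \<ge> 0\<close>. Testing the equation with a nonnegative bump that is a subsolution of the adjoint
  heat equation bounds the local mass of \<open>u\<close> uniformly in time and shows that \<open>f\<close> is integrable up
  to \<open>t = 0\<close>. Testing with a cut-off heat kernel then dominates \<open>u\<close> by heat potentials of these finite measures,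
  so \<open>u\<close> is locally in \<open>L^p\<close> for every \<open>p < (n + 2) / n\<close>. By Young's inequality and
  \<open>\<alpha> / (n + 2) + n \<lambda> / (n + 2) < 1\<close> the nonlocal factor is bounded near the origin, which leaves
  \<open>f \<le> C (1 + u^((n + 2) / n))\<close>. Maximising \<open>u\<close> times the \<open>n\<close>-th power of a parabolic distance, and using
  that the mass of \<open>f\<close> near \<open>t = 0\<close> is small, gives the rate \<open>t^(-n / 2)\<close>.
\<close>

section \<open>Calculus of \<open>C21\<close> functions\<close>

definition heat_op :: "('a::euclidean_space \<Rightarrow> real \<Rightarrow> real) \<Rightarrow> 'a \<Rightarrow> real \<Rightarrow> real" where
  "heat_op u x t = dt u x t - lap u x t"

definition adjoint_heat_op :: "('a::euclidean_space \<Rightarrow> real \<Rightarrow> real) \<Rightarrow> 'a \<Rightarrow> real \<Rightarrow> real" where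
  "adjoint_heat_op \<psi> x t = dt \<psi> x t + lap \<psi> x t"

lemma C21_subset: "C21 f \<Omega> \<Longrightarrow> \<Omega>' \<subseteq> \<Omega> \<Longrightarrow> C21 f \<Omega>'"
  unfolding C21_def by (blast intro: continuous_on_subset)

lemma C21_continuous_on:
  assumes "C21 f \<Omega>"
  shows "continuous_on \<Omega> (\<lambda>p. f (fst p) (snd p))"
    and "continuous_on \<Omega> (\<lambda>p. dt f (fst p) (snd p))"
    and "i \<in> Basis \<Longrightarrow> continuous_on \<Omega> (\<lambda>p. pdx (\<lambda>z. f z (snd p)) i (fst p))"
    and "i \<in> Basis \<Longrightarrow> j \<in> Basis \<Longrightarrow> continuous_on \<Omega> (\<lambda>p. pdx (\<lambda>y. pdx (\<lambda>z. f z (snd p)) i y) j (fst p))"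
    and "continuous_on \<Omega> (\<lambda>p. lap f (fst p) (snd p))"
    and "continuous_on \<Omega> (\<lambda>p. heat_op f (fst p) (snd p))"
    and "continuous_on \<Omega> (\<lambda>p. adjoint_heat_op f (fst p) (snd p))"
proof -
  show "continuous_on \<Omega> (\<lambda>p. f (fst p) (snd p))"
    and dt: "continuous_on \<Omega> (\<lambda>p. dt f (fst p) (snd p))"
    and "i \<in> Basis \<Longrightarrow> continuous_on \<Omega> (\<lambda>p. pdx (\<lambda>z. f z (snd p)) i (fst p))"
    and pdx2: "i \<in> Basis \<Longrightarrow> j \<in> Basis \<Longrightarrow> continuous_on \<Omega> (\<lambda>p. pdx (\<lambda>y. pdx (\<lambda>z. f z (snd p)) i y) j (fst p))" for i j
    using assms by (simp_all add: C21_def case_prod_beta)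
  show lap: "continuous_on \<Omega> (\<lambda>p. lap f (fst p) (snd p))"
    unfolding lap_def by (intro continuous_intros pdx2)
  show "continuous_on \<Omega> (\<lambda>p. heat_op f (fst p) (snd p))"
    and "continuous_on \<Omega> (\<lambda>p. adjoint_heat_op f (fst p) (snd p))"
    unfolding heat_op_def adjoint_heat_op_def by (intro continuous_intros dt lap)+
qed

lemma C21_has_derivatives:
  assumes "C21 f \<Omega>" "(x, t) \<in> \<Omega>"
  shows "((\<lambda>s. f x s) has_real_derivative dt f x t) (at t)"
    and "i \<in> Basis \<Longrightarrow> ((\<lambda>h. f (x + h *\<^sub>R i) t) has_real_derivative pdx (\<lambda>z. f z t) i x) (at 0)"
    and "i \<in> Basis \<Longrightarrow> j \<in> Basis \<Longrightarrow> ((\<lambda>h. pdx (\<lambda>z. f z t) i (x + h *\<^sub>R j)) has_real_derivative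
      pdx (\<lambda>y. pdx (\<lambda>z. f z t) i y) j x) (at 0)"
  using assms unfolding dt_def pdx_def[of "\<lambda>z. f z t" i x] pdx_def[of "\<lambda>y. pdx (\<lambda>z. f z t) i y"]
    DERIV_deriv_iff_real_differentiable
  by (fastforce simp: C21_def)+

lemma C21I:
  fixes f ft :: "'a::euclidean_space \<Rightarrow> real \<Rightarrow> real"
  assumes time: "\<And>x s. s \<in> I \<Longrightarrow> ((\<lambda>s. f x s) has_real_derivative ft x s) (at s)"
    and space: "\<And>i x s. i \<in> Basis \<Longrightarrow> s \<in> I \<Longrightarrow> ((\<lambda>h. f (x + h *\<^sub>R i) s) has_real_derivative f1 i x s) (at 0)"
    and space2: "\<And>i j x s. i \<in> Basis \<Longrightarrow> j \<in> Basis \<Longrightarrow> s \<in> I \<Longrightarrow>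
      ((\<lambda>h. f1 i (x + h *\<^sub>R j) s) has_real_derivative f2 i j x s) (at 0)"
    and cont: "continuous_on (UNIV \<times> I) (\<lambda>p. f (fst p) (snd p))"
      "continuous_on (UNIV \<times> I) (\<lambda>p. ft (fst p) (snd p))"
      "\<And>i. i \<in> Basis \<Longrightarrow> continuous_on (UNIV \<times> I) (\<lambda>p. f1 i (fst p) (snd p))"
      "\<And>i j. i \<in> Basis \<Longrightarrow> j \<in> Basis \<Longrightarrow> continuous_on (UNIV \<times> I) (\<lambda>p. f2 i j (fst p) (snd p))"
  shows "C21 f (UNIV \<times> I)"
    and "s \<in> I \<Longrightarrow> dt f x s = ft x s"
    and "i \<in> Basis \<Longrightarrow> s \<in> I \<Longrightarrow> pdx (\<lambda>z. f z s) i x = f1 i x s"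
    and "s \<in> I \<Longrightarrow> lap f x s = (\<Sum>i\<in>Basis. f2 i i x s)"
proof -
  show dt: "dt f x s = ft x s" if "s \<in> I" for x s
    unfolding dt_def by (rule DERIV_imp_deriv[OF time[OF that]])
  show pdx: "pdx (\<lambda>z. f z s) i x = f1 i x s" if "i \<in> Basis" "s \<in> I" for i x s
    unfolding pdx_def by (rule DERIV_imp_deriv[OF space[OF that]])
  have pdx2: "pdx (\<lambda>y. pdx (\<lambda>z. f z s) i y) j x = f2 i j x s" if "i \<in> Basis" "j \<in> Basis" "s \<in> I" for i j x s
    unfolding pdx[OF that(1,3)] by (unfold pdx_def, rule DERIV_imp_deriv[OF space2[OF that]])
  show "lap f x s = (\<Sum>i\<in>Basis. f2 i i x s)" if "s \<in> I"
    using that by (simp add: lap_def pdx2)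
  have "continuous_on (UNIV \<times> I) (\<lambda>(x, s). dt f x s)"
    using cont(2) by (rule continuous_on_eq) (auto simp: dt)
  moreover have "continuous_on (UNIV \<times> I) (\<lambda>(x, s). pdx (\<lambda>z. f z s) i x)" if "i \<in> Basis" for i
    using cont(3)[OF that] by (rule continuous_on_eq) (auto simp: pdx that)
  moreover have "continuous_on (UNIV \<times> I) (\<lambda>(x, s). pdx (\<lambda>y. pdx (\<lambda>z. f z s) i y) j x)"
    if "i \<in> Basis" "j \<in> Basis" for i j
    using cont(4)[OF that] by (rule continuous_on_eq) (auto simp: pdx2 that)
  ultimately show "C21 f (UNIV \<times> I)"
    using time space space2 cont(1) unfolding C21_def
    by (auto simp: case_prod_beta real_differentiable_def pdx; blast)
qed

lemma C21_mult:
  fixes f g :: "'a::euclidean_space \<Rightarrow> real \<Rightarrow> real"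
  assumes f: "C21 f (UNIV \<times> I)" and g: "C21 g (UNIV \<times> I)"
  shows "C21 (\<lambda>x t. f x t * g x t) (UNIV \<times> I)"
    and "t \<in> I \<Longrightarrow> adjoint_heat_op (\<lambda>x t. f x t * g x t) x t =
      adjoint_heat_op f x t * g x t + f x t * adjoint_heat_op g x t
      + 2 * (\<Sum>i\<in>Basis. pdx (\<lambda>z. f z t) i x * pdx (\<lambda>z. g z t) i x)"
proof -
  let ?f1 = "\<lambda>i x t. pdx (\<lambda>z. f z t) i x" and ?g1 = "\<lambda>i x t. pdx (\<lambda>z. g z t) i x"
  let ?f2 = "\<lambda>i j x t. pdx (\<lambda>y. pdx (\<lambda>z. f z t) i y) j x" and ?g2 = "\<lambda>i j x t. pdx (\<lambda>y. pdx (\<lambda>z. g z t) i y) j x"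
  note df = C21_has_derivatives[OF f] and dg = C21_has_derivatives[OF g]
  have time: "((\<lambda>t. f x t * g x t) has_real_derivative dt f x t * g x t + dt g x t * f x t) (at t)"
    if "t \<in> I" for x t
    using that by (intro DERIV_mult df dg) auto
  have space: "((\<lambda>h. f (x + h *\<^sub>R i) t * g (x + h *\<^sub>R i) t) has_real_derivative
      ?f1 i x t * g x t + ?g1 i x t * f x t) (at 0)"
    if "i \<in> Basis" "t \<in> I" for i x t
    by (rule DERIV_cong, rule DERIV_mult[OF df(2) dg(2)]) (use that in auto)
  have space2: "((\<lambda>h. ?f1 i (x + h *\<^sub>R j) t * g (x + h *\<^sub>R j) t + ?g1 i (x + h *\<^sub>R j) t * f (x + h *\<^sub>R j) t)
      has_real_derivative
      ?f2 i j x t * g x t + ?g1 j x t * ?f1 i x t + (?g2 i j x t * f x t + ?f1 j x t * ?g1 i x t)) (at 0)"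
    if "i \<in> Basis" "j \<in> Basis" "t \<in> I" for i j x t
    by (rule DERIV_cong, rule DERIV_add[OF DERIV_mult[OF df(3) dg(2)] DERIV_mult[OF dg(3) df(2)]])
      (use that in auto)
  have cont: "continuous_on (UNIV \<times> I) (\<lambda>p. f (fst p) (snd p) * g (fst p) (snd p))"
    "continuous_on (UNIV \<times> I) (\<lambda>p. dt f (fst p) (snd p) * g (fst p) (snd p) + dt g (fst p) (snd p) * f (fst p) (snd p))"
    "i \<in> Basis \<Longrightarrow> continuous_on (UNIV \<times> I) (\<lambda>p. ?f1 i (fst p) (snd p) * g (fst p) (snd p) + ?g1 i (fst p) (snd p) * f (fst p) (snd p))"
    "i \<in> Basis \<Longrightarrow> j \<in> Basis \<Longrightarrow> continuous_on (UNIV \<times> I) (\<lambda>p. ?f2 i j (fst p) (snd p) * g (fst p) (snd p)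
      + ?g1 j (fst p) (snd p) * ?f1 i (fst p) (snd p)
      + (?g2 i j (fst p) (snd p) * f (fst p) (snd p) + ?f1 j (fst p) (snd p) * ?g1 i (fst p) (snd p)))" for i j
    by (intro continuous_intros C21_continuous_on[OF f] C21_continuous_on[OF g]; assumption)+
  note product = C21I[where f="\<lambda>x t. f x t * g x t" and I=I
      and ft="\<lambda>x t. dt f x t * g x t + dt g x t * f x t"
      and ?f1.0="\<lambda>i x t. ?f1 i x t * g x t + ?g1 i x t * f x t"
      and ?f2.0="\<lambda>i j x t. ?f2 i j x t * g x t + ?g1 j x t * ?f1 i x t + (?g2 i j x t * f x t + ?f1 j x t * ?g1 i x t)",
      OF time space space2 cont]
  show "C21 (\<lambda>x t. f x t * g x t) (UNIV \<times> I)"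
    by (rule product(1))
  have dt: "t \<in> I \<Longrightarrow> dt (\<lambda>x t. f x t * g x t) x t = dt f x t * g x t + dt g x t * f x t"
    by (rule product(2))
  have lap: "t \<in> I \<Longrightarrow> lap (\<lambda>x t. f x t * g x t) x t = (\<Sum>i\<in>Basis. ?f2 i i x t * g x t + ?g1 i x t * ?f1 i x t
      + (?g2 i i x t * f x t + ?f1 i x t * ?g1 i x t))"
    by (rule product(4))
  show "t \<in> I \<Longrightarrow> adjoint_heat_op (\<lambda>x t. f x t * g x t) x t =
      adjoint_heat_op f x t * g x t + f x t * adjoint_heat_op g x t + 2 * (\<Sum>i\<in>Basis. ?f1 i x t * ?g1 i x t)"
    unfolding adjoint_heat_op_def
    by (simp only: dt lap) (simp add: lap_def sum.distrib sum_distrib_left sum_distrib_right algebra_simps)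
qed

lemma spatial_derivatives_locally_constant:
  fixes f :: "'a::euclidean_space \<Rightarrow> real \<Rightarrow> real"
  assumes U: "open U" "x \<in> U" and const: "\<And>y. y \<in> U \<Longrightarrow> f y t = c"
  shows "pdx (\<lambda>z. f z t) i x = 0" and "lap f x t = 0"
proof -
  have vanish: "pdx g i y = 0" if "\<And>y. y \<in> U \<Longrightarrow> g y = d" "y \<in> U" for g :: "'a \<Rightarrow> real" and d i y
  proof -
    have "open ((\<lambda>h::real. y + h *\<^sub>R i) -` U)"
      by (rule open_vimage[OF U(1)]) (intro continuous_intros)
    then have "\<forall>\<^sub>F h in nhds 0. y + h *\<^sub>R i \<in> U"
      using that(2) by (auto simp: eventually_nhds)
    then have "deriv (\<lambda>h. g (y + h *\<^sub>R i)) 0 = deriv (\<lambda>h. d) 0"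
      by (intro deriv_cong_ev) (auto elim!: eventually_mono simp: that(1))
    then show ?thesis by (simp add: pdx_def)
  qed
  show "pdx (\<lambda>z. f z t) i x = 0" by (rule vanish[OF const U(2)])
  have "pdx (\<lambda>y. pdx (\<lambda>z. f z t) i y) i x = 0" for i
    by (rule vanish[OF vanish[OF const] U(2)])
  then show "lap f x t = 0" by (simp add: lap_def)
qed

lemma norm_add_scaleR_Basis_sq:
  fixes x i :: "'a::euclidean_space"
  assumes "i \<in> Basis"
  shows "(norm (x + h *\<^sub>R i))\<^sup>2 = (norm x)\<^sup>2 + 2 * h * (x \<bullet> i) + h\<^sup>2"
  using assms unfolding power2_norm_eq_inner
  by (simp add: inner_add_left inner_add_right inner_commute power2_eq_square algebra_simps)

lemma sum_Basis_inner_sq: "(\<Sum>i\<in>Basis. (x \<bullet> i)\<^sup>2) = (norm (x::'a::euclidean_space))\<^sup>2"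
  by (subst power2_norm_eq_inner, subst euclidean_inner) (simp add: power2_eq_square)

lemma inner_add_scaleR_DERIV: "((\<lambda>h. (x + h *\<^sub>R j) \<bullet> i) has_real_derivative j \<bullet> i) (at 0)"
  for x i j :: "'a::real_inner"
  by (auto intro!: derivative_eq_intros simp: inner_add_left)

lemma norm_sq_compose_DERIV:
  fixes x i :: "'a::euclidean_space"
  assumes "i \<in> Basis" and "\<And>r. (g has_real_derivative g' r) (at r)"
  shows "((\<lambda>h. g ((norm (x + h *\<^sub>R i))\<^sup>2)) has_real_derivative 2 * (x \<bullet> i) * g' ((norm x)\<^sup>2)) (at 0)"
proof -
  have "((\<lambda>h. (norm x)\<^sup>2 + 2 * h * (x \<bullet> i) + h\<^sup>2) has_real_derivative 2 * (x \<bullet> i)) (at 0)"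
    by (auto intro!: derivative_eq_intros)
  from DERIV_chain2[OF assms(2) this] show ?thesis
    unfolding norm_add_scaleR_Basis_sq[OF assms(1)] by (simp add: mult.commute)
qed

lemma C21_radial:
  fixes g g' g'' :: "real \<Rightarrow> real"
  assumes g: "\<And>r. (g has_real_derivative g' r) (at r)" and g': "\<And>r. (g' has_real_derivative g'' r) (at r)"
    and g'': "continuous_on UNIV g''"
  shows "C21 (\<lambda>(x::'a::euclidean_space) _. g ((norm x)\<^sup>2)) (UNIV \<times> I)"
    and "t \<in> I \<Longrightarrow> dt (\<lambda>(x::'a) _. g ((norm x)\<^sup>2)) x t = 0"
    and "t \<in> I \<Longrightarrow> lap (\<lambda>(x::'a) _. g ((norm x)\<^sup>2)) x t = 2 * real DIM('a) * g' ((norm x)\<^sup>2) + 4 * (norm x)\<^sup>2 * g'' ((norm x)\<^sup>2)"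
proof -
  have space: "((\<lambda>h. g ((norm (x + h *\<^sub>R i))\<^sup>2)) has_real_derivative 2 * (x \<bullet> i) * g' ((norm x)\<^sup>2)) (at 0)"
    if "i \<in> Basis" for i x :: 'a
    by (rule norm_sq_compose_DERIV[OF that g])
  have space2: "((\<lambda>h. 2 * ((x + h *\<^sub>R j) \<bullet> i) * g' ((norm (x + h *\<^sub>R j))\<^sup>2)) has_real_derivative
      2 * (j \<bullet> i) * g' ((norm x)\<^sup>2) + 2 * (x \<bullet> j) * g'' ((norm x)\<^sup>2) * (2 * (x \<bullet> i))) (at 0)"
    if "j \<in> Basis" for i j x :: 'a
    by (rule DERIV_cong, rule DERIV_mult[OF DERIV_cmult[OF inner_add_scaleR_DERIV] norm_sq_compose_DERIV[OF that g']]) simp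
  have contg: "continuous_on A g" "continuous_on A g'" "continuous_on A g''" for A
    using DERIV_isCont[OF g] DERIV_isCont[OF g'] continuous_on_subset[OF g'']
    by (auto intro: continuous_at_imp_continuous_on)
  have cont: "continuous_on (UNIV \<times> I) (\<lambda>p::'a \<times> real. g ((norm (fst p))\<^sup>2))"
    "continuous_on (UNIV \<times> I) (\<lambda>p::'a \<times> real. 2 * (fst p \<bullet> i) * g' ((norm (fst p))\<^sup>2))"
    "continuous_on (UNIV \<times> I) (\<lambda>p::'a \<times> real. 2 * (j \<bullet> i) * g' ((norm (fst p))\<^sup>2)
      + 2 * (fst p \<bullet> j) * g'' ((norm (fst p))\<^sup>2) * (2 * (fst p \<bullet> i)))" for i j
    by (auto intro!: continuous_intros continuous_on_compose2[OF contg(1)]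
        continuous_on_compose2[OF contg(2)] continuous_on_compose2[OF contg(3)])
  note radial = C21I[where f="\<lambda>(x::'a) _. g ((norm x)\<^sup>2)" and I=I and ft="\<lambda>_ _. 0"
      and ?f1.0="\<lambda>i x _. 2 * (x \<bullet> i) * g' ((norm x)\<^sup>2)"
      and ?f2.0="\<lambda>i j x _. 2 * (j \<bullet> i) * g' ((norm x)\<^sup>2) + 2 * (x \<bullet> j) * g'' ((norm x)\<^sup>2) * (2 * (x \<bullet> i))",
      OF DERIV_const space space2 cont(1) continuous_on_const cont(2,3)]
  show "C21 (\<lambda>(x::'a) _. g ((norm x)\<^sup>2)) (UNIV \<times> I)"
    by (rule radial(1))
  show "t \<in> I \<Longrightarrow> dt (\<lambda>(x::'a) _. g ((norm x)\<^sup>2)) x t = 0"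
    by (rule radial(2))
  have "t \<in> I \<Longrightarrow> lap (\<lambda>(x::'a) _. g ((norm x)\<^sup>2)) x t
      = (\<Sum>i\<in>Basis. 2 * (i \<bullet> i) * g' ((norm x)\<^sup>2) + 2 * (x \<bullet> i) * g'' ((norm x)\<^sup>2) * (2 * (x \<bullet> i)))"
    by (rule radial(4))
  also have "\<dots> = (\<Sum>i\<in>Basis. 2 * g' ((norm x)\<^sup>2) + 4 * g'' ((norm x)\<^sup>2) * (x \<bullet> i)\<^sup>2)"
    by (intro sum.cong) (auto simp: power2_eq_square)
  also have "\<dots> = 2 * real DIM('a) * g' ((norm x)\<^sup>2) + 4 * (norm x)\<^sup>2 * g'' ((norm x)\<^sup>2)"
    by (simp add: sum.distrib sum_distrib_left[symmetric] sum_Basis_inner_sq)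
  finally show "t \<in> I \<Longrightarrow> lap (\<lambda>(x::'a) _. g ((norm x)\<^sup>2)) x t
      = 2 * real DIM('a) * g' ((norm x)\<^sup>2) + 4 * (norm x)\<^sup>2 * g'' ((norm x)\<^sup>2)" .
qed

section \<open>Integrals of compactly supported functions\<close>

lemma compact_support_integral:
  fixes f :: "'a::euclidean_space \<Rightarrow> real"
  assumes "continuous_on UNIV f" and "\<And>x. R < norm x \<Longrightarrow> f x = 0" and "cball 0 R \<subseteq> cbox a b"
  shows "integrable lborel f" and "integral\<^sup>L lborel f = integral (cbox a b) f"
proof -
  have eq: "(\<lambda>x. indicator (cbox a b) x *\<^sub>R f x) = f"
  proof
    fix x show "indicator (cbox a b) x *\<^sub>R f x = f x"
      using assms(2)[of x] assms(3) by (cases "R < norm x"; cases "x \<in> cbox a b") (auto simp: subset_iff not_le)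
  qed
  have *: "integrable lborel (\<lambda>x. indicator (cbox a b) x *\<^sub>R f x)"
    by (rule borel_integrable_compact) (use assms in \<open>auto intro: continuous_on_subset\<close>)
  then show "integrable lborel f" by (simp only: eq)
  have "set_integrable lborel (cbox a b) f"
    using * by (simp only: set_integrable_def)
  from set_borel_integral_eq_integral(2)[OF this]
  show "integral\<^sup>L lborel f = integral (cbox a b) f"
    by (simp only: set_lebesgue_integral_def eq)
qed

lemma obtain_cbox_around_cball:
  obtains a b :: "'a::euclidean_space" where "cball 0 R \<subseteq> cbox a b"
  by (rule bounded_subset_cbox_symmetric[OF bounded_cball[of "0::'a" R]]) (rule that)

lemma continuous_on_slices:
  assumes "continuous_on (UNIV \<times> S) (\<lambda>p. q (fst p) (snd p))"
  shows "s \<in> S \<Longrightarrow> continuous_on UNIV (\<lambda>x. q x s)"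
    and "continuous_on (S \<times> B) (\<lambda>(s, x). q x s)"
proof -
  show "continuous_on UNIV (\<lambda>x. q x s)" if "s \<in> S"
    using continuous_on_compose2[OF assms, of UNIV "\<lambda>x. (x, s)"] that
    by (simp add: image_subset_iff continuous_on_Pair continuous_on_id continuous_on_const)
  show "continuous_on (S \<times> B) (\<lambda>(s, x). q x s)"
    using continuous_on_compose2[OF assms, of "S \<times> B" "\<lambda>p. (snd p, fst p)"]
    by (simp add: continuous_on_Pair continuous_on_fst continuous_on_snd continuous_on_id image_subset_iff case_prod_beta)
qed

lemma compact_support_slice_integrable:
  fixes q :: "'a::euclidean_space \<Rightarrow> real \<Rightarrow> real"
  assumes "continuous_on (UNIV \<times> S) (\<lambda>p. q (fst p) (snd p))" "s \<in> S" "\<And>x. R < norm x \<Longrightarrow> q x s = 0"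
  shows "integrable lborel (\<lambda>x. q x s)"
proof -
  obtain a b :: 'a where "cball 0 R \<subseteq> cbox a b" by (rule obtain_cbox_around_cball)
  with continuous_on_slices(1)[OF assms(1,2)] assms(3) show ?thesis by (rule compact_support_integral(1))
qed

lemma compact_support_integral_continuous:
  fixes q :: "'a::euclidean_space \<Rightarrow> real \<Rightarrow> real"
  assumes cont: "continuous_on (UNIV \<times> S) (\<lambda>p. q (fst p) (snd p))"
    and supp: "\<And>x s. s \<in> S \<Longrightarrow> R < norm x \<Longrightarrow> q x s = 0"
  shows "continuous_on S (\<lambda>s. \<integral>x. q x s \<partial>lborel)"
proof -
  obtain a b :: 'a where ab: "cball 0 R \<subseteq> cbox a b" by (rule obtain_cbox_around_cball)
  have "continuous_on S (\<lambda>s. integral (cbox a b) (\<lambda>x. q x s))"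
    by (rule integral_continuous_on_param) (rule continuous_on_slices(2)[OF cont])
  then show ?thesis
    by (rule continuous_on_cong[THEN iffD1, rotated -1])
      (auto intro!: compact_support_integral(2)[symmetric, OF continuous_on_slices(1)[OF cont] _ ab] supp)
qed

lemma compact_support_integral_DERIV:
  fixes q q' :: "'a::euclidean_space \<Rightarrow> real \<Rightarrow> real"
  assumes S: "open S" "convex S" "s0 \<in> S"
    and cont: "continuous_on (UNIV \<times> S) (\<lambda>p. q (fst p) (snd p))"
    and cont': "continuous_on (UNIV \<times> S) (\<lambda>p. q' (fst p) (snd p))"
    and deriv: "\<And>x s. s \<in> S \<Longrightarrow> ((\<lambda>s. q x s) has_real_derivative q' x s) (at s)"
    and supp: "\<And>x s. s \<in> S \<Longrightarrow> R < norm x \<Longrightarrow> q x s = 0"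
  shows "((\<lambda>s. \<integral>x. q x s \<partial>lborel) has_real_derivative (\<integral>x. q' x s0 \<partial>lborel)) (at s0)"
proof -
  obtain a b :: 'a where ab: "cball 0 R \<subseteq> cbox a b" by (rule obtain_cbox_around_cball)
  have supp': "q' x s = 0" if "s \<in> S" "R < norm x" for x s
  proof -
    have "((\<lambda>s. 0) has_real_derivative q' x s) (at s)"
      by (rule has_field_derivative_transform_within_open[OF deriv[OF that(1)] S(1) that(1)])
        (use supp that in auto)
    then show ?thesis using DERIV_unique DERIV_const by blast
  qed
  have "((\<lambda>s. integral (cbox a b) (\<lambda>x. q x s)) has_real_derivative integral (cbox a b) (\<lambda>x. q' x s0)) (at s0 within S)"
  proof (rule leibniz_rule_field_derivative)
    show "(\<lambda>x. q x s) integrable_on cbox a b" if "s \<in> S" for s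
      by (rule integrable_continuous, rule continuous_on_subset[OF continuous_on_slices(1)[OF cont that]]) auto
    show "((\<lambda>s. q x s) has_real_derivative q' x s) (at s within S)" if "s \<in> S" for x s
      by (rule has_field_derivative_at_within[OF deriv[OF that]])
  qed (use S continuous_on_slices(2)[OF cont'] in \<open>simp_all only:\<close>)
  then have "((\<lambda>s. integral (cbox a b) (\<lambda>x. q x s)) has_real_derivative integral (cbox a b) (\<lambda>x. q' x s0)) (at s0)"
    by (simp only: at_within_open[OF S(3,1)])
  moreover have "integral (cbox a b) (\<lambda>x. q' x s0) = (\<integral>x. q' x s0 \<partial>lborel)"
    by (rule compact_support_integral(2)[symmetric, OF continuous_on_slices(1)[OF cont' S(3)] supp'[OF S(3)] ab])
  moreover have "integral (cbox a b) (\<lambda>x. q x s) = (\<integral>x. q x s \<partial>lborel)" if "s \<in> S" for s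
    by (rule compact_support_integral(2)[symmetric, OF continuous_on_slices(1)[OF cont that] supp[OF that] ab])
  ultimately show ?thesis
    using has_field_derivative_transform_within_open[OF _ S(1,3),
        of "\<lambda>s. integral (cbox a b) (\<lambda>x. q x s)" _ "\<lambda>s. \<integral>x. q x s \<partial>lborel"] by simp
qed

lemma DERIV_along_line:
  fixes g :: "'a::real_normed_vector \<Rightarrow> real"
  assumes "\<And>x. ((\<lambda>h. g (x + h *\<^sub>R i)) has_real_derivative g' x) (at 0)"
  shows "((\<lambda>h. g (x + h *\<^sub>R i)) has_real_derivative g' (x + s *\<^sub>R i)) (at s)"
proof -
  have "((\<lambda>h. g (x + s *\<^sub>R i + (h - s) *\<^sub>R i)) has_real_derivative g' (x + s *\<^sub>R i) * (1 - 0)) (at s)"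
    by (rule DERIV_chain2[where f="\<lambda>h. g (x + s *\<^sub>R i + h *\<^sub>R i)"])
      (use assms[of "x + s *\<^sub>R i"] in \<open>simp, intro DERIV_diff DERIV_ident DERIV_const\<close>)
  moreover have "x + s *\<^sub>R i + (h - s) *\<^sub>R i = x + h *\<^sub>R i" for h
    by (simp add: algebra_simps)
  ultimately show ?thesis by simp
qed

lemma lborel_eq_distr_reflect: "lborel = distr lborel borel (\<lambda>x::'a::euclidean_space. c - x)"
  using lborel_affine[of "- 1" c] by (simp add: density_1)

lemma nn_integral_lborel_translate:
  fixes g :: "'a::euclidean_space \<Rightarrow> ennreal"
  assumes [measurable]: "g \<in> borel_measurable borel"
  shows "(\<integral>\<^sup>+x. g (x - c) \<partial>lborel) = (\<integral>\<^sup>+x. g x \<partial>lborel)"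
proof -
  have "(\<integral>\<^sup>+x. g x \<partial>lborel) = (\<integral>\<^sup>+x. g x \<partial>distr lborel borel ((+) (- c)))"
    by (simp add: lborel_distr_plus)
  also have "\<dots> = (\<integral>\<^sup>+x. g (x - c) \<partial>lborel)" by (subst nn_integral_distr) simp_all
  finally show ?thesis ..
qed

lemma nn_integral_lborel_reflect:
  fixes g :: "'a::euclidean_space \<Rightarrow> ennreal"
  assumes [measurable]: "g \<in> borel_measurable borel"
  shows "(\<integral>\<^sup>+x. g (c - x) \<partial>lborel) = (\<integral>\<^sup>+x. g x \<partial>lborel)"
  by (subst (2) lborel_eq_distr_reflect[of c], subst nn_integral_distr) simp_all

text \<open>The integral of a translate does not depend on the translation, so its derivative vanishes.\<close>

lemma compact_support_integral_partial_derivative: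
  fixes g g' :: "'a::euclidean_space \<Rightarrow> real"
  assumes deriv: "\<And>x. ((\<lambda>h. g (x + h *\<^sub>R i)) has_real_derivative g' x) (at 0)"
    and cont: "continuous_on UNIV g" "continuous_on UNIV g'"
    and supp: "\<And>x. R < norm x \<Longrightarrow> g x = 0"
  shows "(\<integral>x. g' x \<partial>lborel) = 0"
proof -
  have "((\<lambda>h. \<integral>x. g (x + h *\<^sub>R i) \<partial>lborel) has_real_derivative (\<integral>x. g' (x + 0 *\<^sub>R i) \<partial>lborel)) (at 0)"
  proof (rule compact_support_integral_DERIV[where S="{-1<..<1}" and R="R + norm i"])
    show "continuous_on (UNIV \<times> {-1<..<1}) (\<lambda>p. g (fst p + snd p *\<^sub>R i))"
      "continuous_on (UNIV \<times> {-1<..<1}) (\<lambda>p. g' (fst p + snd p *\<^sub>R i))"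
      by (intro continuous_on_compose2[OF cont(1)] continuous_on_compose2[OF cont(2)] continuous_intros, auto)+
    show "((\<lambda>h. g (x + h *\<^sub>R i)) has_real_derivative g' (x + s *\<^sub>R i)) (at s)" for x s
      by (rule DERIV_along_line[OF deriv])
    show "g (x + s *\<^sub>R i) = 0" if "s \<in> {-1<..<1}" "R + norm i < norm x" for x s
    proof (rule supp)
      have "norm (s *\<^sub>R i) \<le> norm i" using that by (auto intro!: mult_left_le_one_le)
      moreover have "norm x \<le> norm (x + s *\<^sub>R i) + norm (s *\<^sub>R i)"
        by (metis add_diff_cancel_right' norm_triangle_ineq4)
      ultimately show "R < norm (x + s *\<^sub>R i)" using that by linarith
    qed
  qed auto
  moreover have "(\<integral>x. g (x + c) \<partial>lborel) = (\<integral>x. g x \<partial>lborel)" for c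
  proof -
    have "(\<integral>x. g x \<partial>distr lborel borel ((+) c)) = (\<integral>x. g (c + x) \<partial>lborel)"
      by (rule integral_distr) (simp_all add: borel_measurable_continuous_onI[OF cont(1)])
    then show ?thesis by (simp add: lborel_distr_plus add.commute)
  qed
  ultimately have "((\<lambda>h. \<integral>x. g x \<partial>lborel) has_real_derivative (\<integral>x. g' x \<partial>lborel)) (at (0::real))"
    by simp
  then show ?thesis using DERIV_unique DERIV_const by blast
qed

lemma borel_measurable_restrict_continuous:
  fixes q :: "'b::topological_space \<Rightarrow> real"
  assumes "continuous_on S q" "S \<in> sets borel"
  shows "(\<lambda>p. ennreal (q p) * indicator S p) \<in> borel_measurable borel"
proof -
  have "(\<lambda>p. ennreal (indicator S p *\<^sub>R q p)) \<in> borel_measurable borel"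
    by (rule measurable_compose[OF borel_measurable_continuous_on_indicator[OF assms(2,1)]]) simp
  moreover have "(\<lambda>p. ennreal (indicator S p *\<^sub>R q p)) = (\<lambda>p. ennreal (q p) * indicator S p)"
    by (auto simp: indicator_def)
  ultimately show ?thesis by simp
qed

lemma nn_integral_space_time_Tonelli:
  fixes g :: "'a::euclidean_space \<times> real \<Rightarrow> ennreal"
  assumes [measurable]: "(\<lambda>p. g p * indicator (UNIV \<times> T) p) \<in> borel_measurable borel"
  shows "(\<integral>\<^sup>+p\<in>UNIV \<times> T. g p \<partial>lborel) = (\<integral>\<^sup>+s\<in>T. (\<integral>\<^sup>+x. g (x, s) \<partial>lborel) \<partial>lborel)"
proof -
  have "(\<integral>\<^sup>+p\<in>UNIV \<times> T. g p \<partial>lborel) = (\<integral>\<^sup>+p. g p * indicator (UNIV \<times> T) p \<partial>(lborel \<Otimes>\<^sub>M lborel))"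
    by (simp add: lborel_prod)
  also have "\<dots> = (\<integral>\<^sup>+s. (\<integral>\<^sup>+x. g (x, s) * indicator (UNIV \<times> T) (x, s) \<partial>lborel) \<partial>lborel)"
    by (rule lborel_pair.nn_integral_snd[symmetric]) (simp add: lborel_prod)
  also have "\<dots> = (\<integral>\<^sup>+s\<in>T. (\<integral>\<^sup>+x. g (x, s) \<partial>lborel) \<partial>lborel)"
    by (intro nn_integral_cong) (auto simp: indicator_def)
  finally show ?thesis .
qed

lemma nn_integral_space_time_compact_support:
  fixes q :: "'a::euclidean_space \<Rightarrow> real \<Rightarrow> real"
  assumes cont: "continuous_on (UNIV \<times> {a..b}) (\<lambda>p. q (fst p) (snd p))"
    and supp: "\<And>x s. s \<in> {a..b} \<Longrightarrow> R < norm x \<Longrightarrow> q x s = 0"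
    and nonneg: "\<And>x s. s \<in> {a..b} \<Longrightarrow> 0 \<le> q x s"
  shows "(\<integral>\<^sup>+p\<in>UNIV \<times> {a..b}. ennreal (q (fst p) (snd p)) \<partial>lborel)
    = ennreal (integral {a..b} (\<lambda>s. \<integral>x. q x s \<partial>lborel))"
proof -
  have slice_cont: "continuous_on {a..b} (\<lambda>s. \<integral>x. q x s \<partial>lborel)"
    by (rule compact_support_integral_continuous[OF cont supp])
  have "(\<integral>\<^sup>+p\<in>UNIV \<times> {a..b}. ennreal (q (fst p) (snd p)) \<partial>lborel)
      = (\<integral>\<^sup>+s\<in>{a..b}. (\<integral>\<^sup>+x. ennreal (q x s) \<partial>lborel) \<partial>lborel)"
    by (subst nn_integral_space_time_Tonelli)
      (auto intro!: borel_measurable_restrict_continuous[OF cont] borel_closed closed_Times)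
  also have "\<dots> = (\<integral>\<^sup>+s. ennreal (indicator {a..b} s *\<^sub>R (\<integral>x. q x s \<partial>lborel)) \<partial>lborel)"
  proof (rule nn_integral_cong)
    fix s :: real
    show "(\<integral>\<^sup>+x. ennreal (q x s) \<partial>lborel) * indicator {a..b} s = ennreal (indicator {a..b} s *\<^sub>R (\<integral>x. q x s \<partial>lborel))"
      using nn_integral_eq_integral[OF compact_support_slice_integrable[OF cont _ supp], of s] nonneg[of s]
      by (cases "s \<in> {a..b}") auto
  qed
  also have "\<dots> = ennreal (\<integral>s. indicator {a..b} s *\<^sub>R (\<integral>x. q x s \<partial>lborel) \<partial>lborel)"
    by (rule nn_integral_eq_integral)
      (use borel_integrable_compact[OF compact_Icc slice_cont] nonneg in \<open>auto simp: indicator_def intro!: integral_nonneg_AE\<close>)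
  also have "(\<integral>s. indicator {a..b} s *\<^sub>R (\<integral>x. q x s \<partial>lborel) \<partial>lborel) = integral {a..b} (\<lambda>s. \<integral>x. q x s \<partial>lborel)"
    using set_borel_integral_eq_integral(2)[OF borel_integrable_atLeastAtMost'[OF slice_cont]]
    by (simp add: set_lebesgue_integral_def)
  finally show ?thesis .
qed

section \<open>Duality for the heat operator\<close>

definition slice_pairing :: "('a::euclidean_space \<Rightarrow> real \<Rightarrow> real) \<Rightarrow> ('a \<Rightarrow> real \<Rightarrow> real) \<Rightarrow> real \<Rightarrow> real" where
  "slice_pairing v w s = (\<integral>x. v x s * w x s \<partial>lborel)"

definition nn_slice_pairing :: "('a::euclidean_space \<Rightarrow> real \<Rightarrow> real) \<Rightarrow> ('a \<Rightarrow> real \<Rightarrow> real) \<Rightarrow> real \<Rightarrow> ennreal" where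
  "nn_slice_pairing v w s = (\<integral>\<^sup>+x. ennreal (v x s * w x s) \<partial>lborel)"

definition nn_strip_pairing :: "('a::euclidean_space \<Rightarrow> real \<Rightarrow> real) \<Rightarrow> ('a \<Rightarrow> real \<Rightarrow> real) \<Rightarrow> real \<Rightarrow> real \<Rightarrow> ennreal" where
  "nn_strip_pairing v w s1 s2 = (\<integral>\<^sup>+p\<in>UNIV \<times> {s1..s2}. ennreal (v (fst p) (snd p) * w (fst p) (snd p)) \<partial>lborel)"

locale compact_pairing =
  fixes \<psi> u :: "'a::euclidean_space \<Rightarrow> real \<Rightarrow> real" and I :: "real set" and R :: real
  assumes I: "open I" "convex I"
    and C21_test: "C21 \<psi> (UNIV \<times> I)" and C21_fun: "C21 u (UNIV \<times> I)"
    and support: "\<And>x s. s \<in> I \<Longrightarrow> R < norm x \<Longrightarrow> \<psi> x s = 0"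
begin

lemmas continuous = C21_continuous_on[OF C21_test] C21_continuous_on[OF C21_fun]

lemma support_derivatives:
  assumes "s \<in> I" "R < norm x"
  shows "pdx (\<lambda>z. \<psi> z s) i x = 0" and "lap \<psi> x s = 0" and "adjoint_heat_op \<psi> x s = 0"
proof -
  have out: "open {x::'a. R < norm x}" "x \<in> {x. R < norm x}"
    using assms(2) by (auto intro!: open_Collect_less continuous_intros)
  show "pdx (\<lambda>z. \<psi> z s) i x = 0" and lap: "lap \<psi> x s = 0"
    by (rule spatial_derivatives_locally_constant[OF out, of \<psi> s 0]; use support assms in simp)+
  have "dt \<psi> x s = deriv (\<lambda>_. 0) s"
    unfolding dt_def by (rule deriv_cong_ev) (use I(1) assms support in \<open>auto simp: eventually_nhds\<close>)
  then show "adjoint_heat_op \<psi> x s = 0" by (simp add: adjoint_heat_op_def lap)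
qed

lemma integrable_products:
  assumes "s \<in> I"
  shows "integrable lborel (\<lambda>x. \<psi> x s * u x s)"
    and "integrable lborel (\<lambda>x. adjoint_heat_op \<psi> x s * u x s)"
    and "integrable lborel (\<lambda>x. \<psi> x s * heat_op u x s)"
  by (rule compact_support_slice_integrable[where R=R, OF _ assms], intro continuous_intros continuous,
      use assms in \<open>simp add: support support_derivatives\<close>)+

lemma integral_Laplacian_symmetric:
  assumes s: "s \<in> I"
  shows "integrable lborel (\<lambda>x. \<psi> x s * lap u x s - lap \<psi> x s * u x s)"
    and "(\<integral>x. \<psi> x s * lap u x s - lap \<psi> x s * u x s \<partial>lborel) = 0"
proof -
  let ?d = "\<lambda>f i x. pdx (\<lambda>z. f z s) i x" and ?d2 = "\<lambda>f i x. pdx (\<lambda>y. pdx (\<lambda>z. f z s) i y) i x"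
  have cont: "continuous_on UNIV (\<lambda>x. f x s)" "continuous_on UNIV (\<lambda>x. lap f x s)"
    "i \<in> Basis \<Longrightarrow> continuous_on UNIV (?d f i)" "i \<in> Basis \<Longrightarrow> continuous_on UNIV (?d2 f i)"
    if "C21 f (UNIV \<times> I)" for f i
    using C21_continuous_on[OF that] s
    by (auto intro: continuous_on_slices(1)[where S=I] continuous_on_slices(1)[where S=I and q="\<lambda>x s. pdx (\<lambda>z. f z s) i x"]
        continuous_on_slices(1)[where S=I and q="\<lambda>x s. pdx (\<lambda>y. pdx (\<lambda>z. f z s) i y) i x"])
  note conts = cont[OF C21_test] cont[OF C21_fun]
  obtain a b :: 'a where ab: "cball 0 R \<subseteq> cbox a b" by (rule obtain_cbox_around_cball)
  show "integrable lborel (\<lambda>x. \<psi> x s * lap u x s - lap \<psi> x s * u x s)"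
    by (rule compact_support_integral(1)[OF _ _ ab], intro continuous_intros conts)
      (use s support support_derivatives in simp)
  have supp2: "?d2 \<psi> i x = 0" if "R < norm x" for i x
  proof (rule spatial_derivatives_locally_constant(1)[where U="{x. R < norm x}" and c=0])
    show "open {x::'a. R < norm x}" by (intro open_Collect_less continuous_intros)
  qed (use that s support_derivatives in auto)
  have vanish: "(\<integral>x. \<psi> x s * ?d2 u i x - ?d2 \<psi> i x * u x s \<partial>lborel) = 0" if i: "i \<in> Basis" for i
  proof (rule compact_support_integral_partial_derivative)
    show "((\<lambda>h. \<psi> (x + h *\<^sub>R i) s * ?d u i (x + h *\<^sub>R i) - ?d \<psi> i (x + h *\<^sub>R i) * u (x + h *\<^sub>R i) s)
        has_real_derivative \<psi> x s * ?d2 u i x - ?d2 \<psi> i x * u x s) (at 0)" for x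
      by (rule DERIV_cong, rule DERIV_diff[OF DERIV_mult[OF C21_has_derivatives(2)[OF C21_test] C21_has_derivatives(3)[OF C21_fun]]
          DERIV_mult[OF C21_has_derivatives(3)[OF C21_test] C21_has_derivatives(2)[OF C21_fun]]])
        (use s i in simp_all)
    show "continuous_on UNIV (\<lambda>x. \<psi> x s * ?d u i x - ?d \<psi> i x * u x s)"
      "continuous_on UNIV (\<lambda>x. \<psi> x s * ?d2 u i x - ?d2 \<psi> i x * u x s)"
      by (intro continuous_intros conts i)+
    show "\<psi> x s * ?d u i x - ?d \<psi> i x * u x s = 0" if "R < norm x" for x
      using s that by (simp add: support support_derivatives)
  qed
  have "integrable lborel (\<lambda>x. \<psi> x s * ?d2 u i x - ?d2 \<psi> i x * u x s)" if "i \<in> Basis" for i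
    by (rule compact_support_integral(1)[OF _ _ ab], intro continuous_intros conts that)
      (use s support supp2 in simp)
  then have "(\<integral>x. (\<Sum>i\<in>Basis. \<psi> x s * ?d2 u i x - ?d2 \<psi> i x * u x s) \<partial>lborel) = 0"
    using vanish by simp
  then show "(\<integral>x. \<psi> x s * lap u x s - lap \<psi> x s * u x s \<partial>lborel) = 0"
    by (simp add: lap_def sum_subtractf sum_distrib_left sum_distrib_right)
qed

lemma pairing_DERIV:
  assumes s: "s \<in> I"
  shows "(slice_pairing \<psi> u has_real_derivative
    slice_pairing (adjoint_heat_op \<psi>) u s + slice_pairing \<psi> (heat_op u) s) (at s)"
proof -
  have "((\<lambda>s. \<integral>x. \<psi> x s * u x s \<partial>lborel) has_real_derivative
      (\<integral>x. dt \<psi> x s * u x s + dt u x s * \<psi> x s \<partial>lborel)) (at s)"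
  proof (rule compact_support_integral_DERIV[where S=I and R=R])
    show "((\<lambda>s. \<psi> x s * u x s) has_real_derivative dt \<psi> x s * u x s + dt u x s * \<psi> x s) (at s)" if "s \<in> I" for x s
      by (intro DERIV_mult C21_has_derivatives(1)[OF C21_test] C21_has_derivatives(1)[OF C21_fun]) (use that in auto)
  qed (use s support I in \<open>auto intro!: continuous_intros continuous\<close>)
  moreover have "(\<lambda>x. dt \<psi> x s * u x s + dt u x s * \<psi> x s) = (\<lambda>x. adjoint_heat_op \<psi> x s * u x s + \<psi> x s * heat_op u x s
      + (\<psi> x s * lap u x s - lap \<psi> x s * u x s))"
    by (simp add: fun_eq_iff adjoint_heat_op_def heat_op_def algebra_simps)
  ultimately show ?thesis
    using integral_Laplacian_symmetric[OF s] integrable_products[OF s] by (simp add: slice_pairing_def[abs_def])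
qed

lemma pairing_increment:
  assumes "s1 \<le> s2" "{s1..s2} \<subseteq> I"
  shows "slice_pairing \<psi> u s2 - slice_pairing \<psi> u s1
      = integral {s1..s2} (slice_pairing (adjoint_heat_op \<psi>) u) + integral {s1..s2} (slice_pairing \<psi> (heat_op u))"
    and "slice_pairing (adjoint_heat_op \<psi>) u integrable_on {s1..s2}"
    and "slice_pairing \<psi> (heat_op u) integrable_on {s1..s2}"
proof -
  let ?A = "slice_pairing (adjoint_heat_op \<psi>) u" and ?H = "slice_pairing \<psi> (heat_op u)"
  have "continuous_on I ?A" "continuous_on I ?H"
    unfolding slice_pairing_def
    by (rule compact_support_integral_continuous[where R=R], intro continuous_intros continuous,
        simp add: support support_derivatives)+
  then have integrable: "?A integrable_on {s1..s2}" "?H integrable_on {s1..s2}"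
    by (auto intro!: integrable_continuous_real continuous_on_subset[OF _ assms(2)])
  then show "?A integrable_on {s1..s2}" "?H integrable_on {s1..s2}" by simp_all
  have "((\<lambda>s. ?A s + ?H s) has_integral slice_pairing \<psi> u s2 - slice_pairing \<psi> u s1) {s1..s2}"
  proof (rule fundamental_theorem_of_calculus[OF assms(1)])
    fix s assume "s \<in> {s1..s2}"
    then have "s \<in> I" using assms(2) by blast
    then show "(slice_pairing \<psi> u has_vector_derivative ?A s + ?H s) (at s within {s1..s2})"
      by (rule has_vector_derivative_at_within[OF pairing_DERIV[unfolded has_real_derivative_iff_has_vector_derivative]])
  qed
  moreover have "((\<lambda>s. ?A s + ?H s) has_integral integral {s1..s2} ?A + integral {s1..s2} ?H) {s1..s2}"
    by (rule has_integral_add[OF integrable[unfolded has_integral_integral]])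
  ultimately show "slice_pairing \<psi> u s2 - slice_pairing \<psi> u s1 = integral {s1..s2} ?A + integral {s1..s2} ?H"
    by (rule has_integral_unique)
qed

end

locale nonneg_pairing = compact_pairing +
  assumes test_nonneg: "\<And>x s. s \<in> I \<Longrightarrow> 0 \<le> \<psi> x s"
    and fun_nonneg: "\<And>x s. s \<in> I \<Longrightarrow> 0 \<le> u x s"
    and heat_op_nonneg: "\<And>x s. s \<in> I \<Longrightarrow> norm x \<le> R \<Longrightarrow> 0 \<le> heat_op u x s"
begin

lemma source_nonneg: "s \<in> I \<Longrightarrow> 0 \<le> \<psi> x s * heat_op u x s"
  using support[of s x] test_nonneg[of s x] heat_op_nonneg[of s x] by (cases "norm x \<le> R") auto

lemma pairing_nonneg:
  assumes "s1 \<le> s2" "{s1..s2} \<subseteq> I"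
  shows "0 \<le> slice_pairing \<psi> u s1" and "0 \<le> integral {s1..s2} (slice_pairing \<psi> (heat_op u))"
proof -
  show "0 \<le> slice_pairing \<psi> u s1"
    using assms test_nonneg fun_nonneg by (auto simp: slice_pairing_def intro!: integral_nonneg_AE)
  show "0 \<le> integral {s1..s2} (slice_pairing \<psi> (heat_op u))"
    by (rule integral_nonneg[OF pairing_increment(3)[OF assms]])
      (use assms source_nonneg in \<open>auto simp: slice_pairing_def intro!: integral_nonneg_AE\<close>)
qed

lemma nn_slice_pairing_eq: "s \<in> I \<Longrightarrow> nn_slice_pairing \<psi> u s = ennreal (slice_pairing \<psi> u s)"
  unfolding nn_slice_pairing_def slice_pairing_def
  by (rule nn_integral_eq_integral[OF integrable_products(1)]) (use test_nonneg fun_nonneg in auto)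

lemma nn_strip_pairing_eq:
  assumes "{s1..s2} \<subseteq> I"
  shows "nn_strip_pairing \<psi> (heat_op u) s1 s2 = ennreal (integral {s1..s2} (slice_pairing \<psi> (heat_op u)))"
  unfolding nn_strip_pairing_def slice_pairing_def
proof (rule nn_integral_space_time_compact_support[where R=R])
  show "continuous_on (UNIV \<times> {s1..s2}) (\<lambda>p. \<psi> (fst p) (snd p) * heat_op u (fst p) (snd p))"
    by (rule continuous_on_subset[where s="UNIV \<times> I"]) (use assms in \<open>auto intro!: continuous_intros continuous\<close>)
qed (use assms support source_nonneg in auto)

lemma pairing_mono:
  assumes s: "s1 \<le> s2" "{s1..s2} \<subseteq> I" and adjoint_nonneg: "\<And>x s. s \<in> {s1..s2} \<Longrightarrow> 0 \<le> adjoint_heat_op \<psi> x s"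
  shows "nn_slice_pairing \<psi> u s1 + nn_strip_pairing \<psi> (heat_op u) s1 s2 \<le> nn_slice_pairing \<psi> u s2"
proof -
  have "0 \<le> integral {s1..s2} (slice_pairing (adjoint_heat_op \<psi>) u)"
    by (rule integral_nonneg[OF pairing_increment(2)[OF s]])
      (use s adjoint_nonneg fun_nonneg in \<open>auto simp: slice_pairing_def intro!: integral_nonneg_AE mult_nonneg_nonneg\<close>)
  then have "slice_pairing \<psi> u s1 + integral {s1..s2} (slice_pairing \<psi> (heat_op u)) \<le> slice_pairing \<psi> u s2"
    using pairing_increment(1)[OF s] by linarith
  moreover note pairing_nonneg[OF s]
  ultimately show ?thesis
    using s by (simp add: nn_slice_pairing_eq nn_strip_pairing_eq subset_iff flip: ennreal_plus)
qed

lemma adjoint_pairing_le: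
  assumes s: "s \<in> I" and "0 \<le> E" "0 \<le> A" and adjoint_le: "\<And>x. adjoint_heat_op \<psi> x s \<le> E"
    and mass: "(\<integral>\<^sup>+x\<in>cball 0 R. ennreal (u x s) \<partial>lborel) \<le> ennreal A"
  shows "slice_pairing (adjoint_heat_op \<psi>) u s \<le> E * A"
proof -
  have integrable: "integrable lborel (\<lambda>x. indicator (cball 0 R) x *\<^sub>R u x s)"
    by (rule borel_integrable_compact)
      (auto intro!: continuous_on_subset[OF continuous_on_slices(1)[OF C21_continuous_on(1)[OF C21_fun] s]])
  have "ennreal (\<integral>x. indicator (cball 0 R) x *\<^sub>R u x s \<partial>lborel)
      = (\<integral>\<^sup>+x. ennreal (indicator (cball 0 R) x *\<^sub>R u x s) \<partial>lborel)"
    by (rule nn_integral_eq_integral[symmetric, OF integrable]) (use fun_nonneg[OF s] in simp)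
  also have "\<dots> = (\<integral>\<^sup>+x\<in>cball 0 R. ennreal (u x s) \<partial>lborel)"
    by (intro nn_integral_cong) (auto simp: indicator_def)
  also note mass
  finally have real_mass: "(\<integral>x. indicator (cball 0 R) x *\<^sub>R u x s \<partial>lborel) \<le> A" using assms(3) by simp
  have "adjoint_heat_op \<psi> x s * u x s \<le> E * (indicator (cball 0 R) x *\<^sub>R u x s)" for x
    using adjoint_le fun_nonneg[OF s] support_derivatives(3)[OF s, of x]
    by (cases "norm x \<le> R") (auto intro!: mult_right_mono)
  then have "slice_pairing (adjoint_heat_op \<psi>) u s \<le> (\<integral>x. E * (indicator (cball 0 R) x *\<^sub>R u x s) \<partial>lborel)"
    unfolding slice_pairing_def by (intro integral_mono integrable_products integrable_mult_right integrable s)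
  also have "\<dots> \<le> E * A" using real_mass assms(2) by (simp add: mult_left_mono)
  finally show ?thesis .
qed

lemma pairing_growth:
  assumes s: "s1 \<le> s2" "{s1..s2} \<subseteq> I" and "0 \<le> E" "0 \<le> A"
    and adjoint_le: "\<And>x s. s \<in> {s1..s2} \<Longrightarrow> adjoint_heat_op \<psi> x s \<le> E"
    and mass: "\<And>s. s \<in> {s1..s2} \<Longrightarrow> (\<integral>\<^sup>+x\<in>cball 0 R. ennreal (u x s) \<partial>lborel) \<le> ennreal A"
  shows "nn_slice_pairing \<psi> u s2
    \<le> nn_slice_pairing \<psi> u s1 + nn_strip_pairing \<psi> (heat_op u) s1 s2 + ennreal (E * A * (s2 - s1))"
proof -
  have "integral {s1..s2} (slice_pairing (adjoint_heat_op \<psi>) u) \<le> integral {s1..s2} (\<lambda>_. E * A)"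
    by (intro integral_le pairing_increment(2) integrable_const_ivl adjoint_pairing_le) (use assms in auto)
  then have "slice_pairing \<psi> u s2
      \<le> slice_pairing \<psi> u s1 + integral {s1..s2} (slice_pairing \<psi> (heat_op u)) + E * A * (s2 - s1)"
    using pairing_increment(1)[OF s] s(1) by (simp add: mult_ac)
  moreover note pairing_nonneg[OF s]
  ultimately show ?thesis
    using s assms(3,4) by (simp add: nn_slice_pairing_eq nn_strip_pairing_eq subset_iff ennreal_leI flip: ennreal_plus)
qed

end

section \<open>Cut-off functions\<close>

lemma DERIV_pos_part_power:
  fixes z :: real
  assumes "2 \<le> k"
  shows "((\<lambda>z. max 0 z ^ k) has_real_derivative real k * max 0 z ^ (k - 1)) (at z)"
proof -
  consider "z < 0" | "z = 0" | "0 < z" by linarith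
  then show ?thesis
  proof cases
    case 1
    have "((\<lambda>z. 0) has_real_derivative real k * max 0 z ^ (k - 1)) (at z)" using 1 assms by (simp add: power_0_left)
    then show ?thesis
      by (rule has_field_derivative_transform_within_open[of _ _ _ "{..<0}"]) (use 1 assms in \<open>auto simp: power_0_left\<close>)
  next
    case 2
    obtain m where k: "k = Suc (Suc m)" using assms by (metis add_2_eq_Suc le_Suc_ex)
    have "(\<lambda>h::real. (max 0 (0 + h) ^ k - max 0 0 ^ k) / h) \<midarrow>0\<rightarrow> 0"
    proof (rule Lim_null_comparison)
      show "\<forall>\<^sub>F h::real in at 0. norm ((max 0 (0 + h) ^ k - max 0 0 ^ k) / h) \<le> \<bar>h\<bar> ^ Suc m"
        by (intro always_eventually allI) (auto simp: max_def k mult_nonpos_nonneg)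
      show "(\<lambda>h::real. \<bar>h\<bar> ^ Suc m) \<midarrow>0\<rightarrow> 0" by (auto intro!: tendsto_eq_intros)
    qed
    then show ?thesis unfolding DERIV_def 2 by (simp add: k)
  next
    case 3
    have "((\<lambda>z. z ^ k) has_real_derivative real k * max 0 z ^ (k - 1)) (at z)"
      using 3 by (auto intro!: derivative_eq_intros)
    then show ?thesis
      by (rule has_field_derivative_transform_within_open[of _ _ _ "{0<..}"]) (use 3 in auto)
  qed
qed

lemma C21_exp_time:
  fixes x :: "'a::euclidean_space"
  shows "C21 (\<lambda>(_::'a) s. exp (C * s)) (UNIV \<times> I)"
    and "t \<in> I \<Longrightarrow> pdx (\<lambda>(_::'a). exp (C * t)) i x = 0"
    and "t \<in> I \<Longrightarrow> adjoint_heat_op (\<lambda>_ s. exp (C * s)) x t = C * exp (C * t)"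
proof -
  have time: "((\<lambda>s. exp (C * s)) has_real_derivative C * exp (C * s)) (at s)" for s
    by (auto intro!: derivative_eq_intros)
  have cont: "continuous_on (UNIV \<times> I) (\<lambda>p::'a \<times> real. exp (C * snd p))"
    "continuous_on (UNIV \<times> I) (\<lambda>p::'a \<times> real. C * exp (C * snd p))"
    by (intro continuous_intros)+
  note exp_time = C21I[where f="\<lambda>_ s. exp (C * s)" and I=I and ?f1.0="\<lambda>_ _ _. 0" and ?f2.0="\<lambda>_ _ _ _. 0",
      OF time DERIV_const DERIV_const cont continuous_on_const continuous_on_const]
  show "C21 (\<lambda>(_::'a) s. exp (C * s)) (UNIV \<times> I)" by (rule exp_time(1))
  show "t \<in> I \<Longrightarrow> pdx (\<lambda>(_::'a). exp (C * t)) i x = 0" by (simp add: pdx_def)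
  show "t \<in> I \<Longrightarrow> adjoint_heat_op (\<lambda>_ s. exp (C * s)) x t = C * exp (C * t)"
    unfolding adjoint_heat_op_def by (simp add: exp_time(2,4))
qed

definition radial_profile :: "real \<Rightarrow> real \<Rightarrow> real \<Rightarrow> real" where
  "radial_profile r \<rho> v = (\<rho>\<^sup>2 - v) / (\<rho>\<^sup>2 - r\<^sup>2)"

lemma radial_profile:
  fixes x :: "'a::real_normed_vector"
  assumes "0 \<le> r" "r < \<rho>"
  shows "norm x \<le> r \<Longrightarrow> 1 \<le> radial_profile r \<rho> ((norm x)\<^sup>2)"
    and "\<rho> \<le> norm x \<Longrightarrow> radial_profile r \<rho> ((norm x)\<^sup>2) \<le> 0"
    and "(radial_profile r \<rho> has_real_derivative - (1 / (\<rho>\<^sup>2 - r\<^sup>2))) (at v)"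
proof -
  have d: "0 < \<rho>\<^sup>2 - r\<^sup>2" using assms by (simp add: power_strict_mono)
  show "1 \<le> radial_profile r \<rho> ((norm x)\<^sup>2)" if "norm x \<le> r"
    using d power_mono[OF that, of 2] by (simp add: radial_profile_def)
  show "radial_profile r \<rho> ((norm x)\<^sup>2) \<le> 0" if "\<rho> \<le> norm x"
    using d assms that by (simp add: radial_profile_def divide_nonpos_pos power_mono)
  show "(radial_profile r \<rho> has_real_derivative - (1 / (\<rho>\<^sup>2 - r\<^sup>2))) (at v)"
    unfolding radial_profile_def by (rule DERIV_cong[OF DERIV_cdivide[OF DERIV_diff[OF DERIV_const DERIV_ident]]]) simp
qed

lemma cubic_profile_inequality:
  fixes w d a n :: real
  assumes "0 \<le> w" "0 < d" "0 < a"
  shows "0 \<le> (6 * n + 24)\<^sup>2 / (96 * a) * w ^ 3 + (2 * n * (- 3 / d * w\<^sup>2) + 4 * (a - d * w) * (6 / d\<^sup>2 * w))"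
proof -
  have "(6 * n + 24)\<^sup>2 / (96 * a) * w ^ 3 + (2 * n * (- 3 / d * w\<^sup>2) + 4 * (a - d * w) * (6 / d\<^sup>2 * w))
      = w * (((6 * n + 24) * w - 48 * a / d)\<^sup>2 / (96 * a))"
    using assms by (simp add: field_simps power2_eq_square power3_eq_cube)
  then show ?thesis using assms by simp
qed

text \<open>With \<open>z = radial_profile r \<rho> |x|\<^sup>2\<close>, the Laplacian of \<open>z\<^sup>3\<close> is bounded below by a multiple of \<open>- z\<^sup>3\<close>,
  because the term \<open>|\<nabla>z|\<^sup>2 z\<close> wins for small \<open>z\<close>.\<close>

lemma radial_bump_lap_lower_bound:
  fixes r \<rho> :: real
  assumes r: "0 \<le> r" "r < \<rho>"
  obtains C and \<phi> :: "'a::euclidean_space \<Rightarrow> real" where "0 \<le> C" "C21 (\<lambda>x _. \<phi> x) (UNIV \<times> UNIV)" "\<And>x. 0 \<le> \<phi> x"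
    "\<And>x. \<rho> \<le> norm x \<Longrightarrow> \<phi> x = 0" "\<And>x. norm x \<le> r \<Longrightarrow> 1 \<le> \<phi> x" "\<And>x s. 0 \<le> C * \<phi> x + lap (\<lambda>x _. \<phi> x) x s"
proof -
  let ?n = "real DIM('a)"
  define d where "d = \<rho>\<^sup>2 - r\<^sup>2"
  have d: "0 < d" using r by (simp add: d_def power_strict_mono)
  define z where "z = radial_profile r \<rho>"
  note z_deriv = radial_profile(3)[OF r, folded z_def d_def]
  define g g' g'' where "g v = max 0 (z v) ^ 3" and "g' v = - 3 / d * max 0 (z v) ^ 2" and "g'' v = 6 / d\<^sup>2 * max 0 (z v)" for v
  have g_deriv: "(g has_real_derivative g' v) (at v)" for v
    unfolding g_def g'_def by (rule DERIV_cong, rule DERIV_chain2[OF DERIV_pos_part_power z_deriv]) simp_all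
  have g'_deriv: "(g' has_real_derivative g'' v) (at v)" for v
    unfolding g'_def g''_def
    by (rule DERIV_cong, rule DERIV_cmult[OF DERIV_chain2[OF DERIV_pos_part_power z_deriv]])
      (simp_all add: power2_eq_square)
  have g''_cont: "continuous_on UNIV g''"
    unfolding g''_def z_def radial_profile_def by (intro continuous_intros) (use d in \<open>auto simp: d_def\<close>)
  note bump = C21_radial[OF g_deriv g'_deriv g''_cont, where 'a='a and I=UNIV]
  define C where "C = (6 * ?n + 24)\<^sup>2 / (96 * \<rho>\<^sup>2)"
  have radial_lap_ge: "0 \<le> C * g v + (2 * ?n * g' v + 4 * v * g'' v)" for v
  proof -
    have "v = \<rho>\<^sup>2 - d * z v" using d by (simp add: z_def radial_profile_def d_def)
    then show ?thesis
      using cubic_profile_inequality[of "max 0 (z v)" d "\<rho>\<^sup>2" ?n] d r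
      by (cases "z v \<le> 0") (simp_all add: g_def g'_def g''_def C_def max_def)
  qed
  show thesis
  proof (rule that[of C "\<lambda>x. g ((norm x)\<^sup>2)"])
    show "0 \<le> C" by (simp add: C_def)
    show "C21 (\<lambda>(x::'a) _. g ((norm x)\<^sup>2)) (UNIV \<times> UNIV)" by (rule bump(1))
    show "0 \<le> g ((norm x)\<^sup>2)" for x :: 'a by (simp add: g_def)
    show "g ((norm x)\<^sup>2) = 0" if "\<rho> \<le> norm x" for x :: 'a
      using radial_profile(2)[OF r that] by (simp add: g_def z_def max_absorb1)
    show "1 \<le> g ((norm x)\<^sup>2)" if "norm x \<le> r" for x :: 'a
      using radial_profile(1)[OF r that] by (simp add: g_def z_def one_le_power)
    show "0 \<le> C * g ((norm x)\<^sup>2) + lap (\<lambda>(x::'a) _. g ((norm x)\<^sup>2)) x s" for x s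
      using radial_lap_ge[of "(norm x)\<^sup>2"] by (simp add: bump(3))
  qed
qed

lemma adjoint_subcaloric_bump:
  fixes r \<rho> :: real
  assumes "0 \<le> r" "r < \<rho>"
  obtains \<psi> :: "'a::euclidean_space \<Rightarrow> real \<Rightarrow> real" where "C21 \<psi> (UNIV \<times> UNIV)" "\<And>x s. 0 \<le> \<psi> x s"
    "\<And>x s. \<rho> \<le> norm x \<Longrightarrow> \<psi> x s = 0" "\<And>x s. norm x \<le> r \<Longrightarrow> 0 \<le> s \<Longrightarrow> 1 \<le> \<psi> x s"
    "\<And>x s. 0 \<le> adjoint_heat_op \<psi> x s"
proof -
  obtain C and \<phi> :: "'a \<Rightarrow> real" where C: "0 \<le> C" and \<phi>: "C21 (\<lambda>x _. \<phi> x) (UNIV \<times> UNIV)" "\<And>x. 0 \<le> \<phi> x"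
      "\<And>x. \<rho> \<le> norm x \<Longrightarrow> \<phi> x = 0" "\<And>x. norm x \<le> r \<Longrightarrow> 1 \<le> \<phi> x"
    and lap_ge: "\<And>x s. 0 \<le> C * \<phi> x + lap (\<lambda>x _. \<phi> x) x s"
    by (rule radial_bump_lap_lower_bound[OF assms]) blast
  have \<phi>_dt: "dt (\<lambda>x _. \<phi> x) x s = 0" for x s
    by (simp add: dt_def)
  show thesis
  proof (rule that[of "\<lambda>x s. exp (C * s) * \<phi> x"])
    show "C21 (\<lambda>x s. exp (C * s) * \<phi> x) (UNIV \<times> UNIV)" by (intro C21_mult(1) C21_exp_time \<phi>(1))
    show "0 \<le> exp (C * s) * \<phi> x" for x s using \<phi>(2) by simp
    show "exp (C * s) * \<phi> x = 0" if "\<rho> \<le> norm x" for x s using \<phi>(3)[OF that] by simp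
    show "1 \<le> exp (C * s) * \<phi> x" if "norm x \<le> r" "0 \<le> s" for x s
      using mult_mono[of 1 "exp (C * s)" 1 "\<phi> x"] \<phi>(4)[OF that(1)] C that(2) by simp
    show "0 \<le> adjoint_heat_op (\<lambda>x s. exp (C * s) * \<phi> x) x s" for x s
    proof -
      have "adjoint_heat_op (\<lambda>x s. exp (C * s) * \<phi> x) x s = exp (C * s) * (C * \<phi> x + lap (\<lambda>x _. \<phi> x) x s)"
        by (subst C21_mult(2)[OF C21_exp_time(1) \<phi>(1)])
          (simp, simp add: C21_exp_time(2,3)[where I=UNIV] adjoint_heat_op_def[of "\<lambda>x _. \<phi> x"] \<phi>_dt, simp add: algebra_simps)
      then show ?thesis using lap_ge by simp
    qed
  qed
qed

lemma continuous_compact_support_bounded: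
  fixes f :: "'a::euclidean_space \<Rightarrow> real"
  assumes "continuous_on UNIV f" "\<And>x. R < norm x \<Longrightarrow> f x = 0"
  obtains B where "0 \<le> B" "\<And>x. \<bar>f x\<bar> \<le> B"
proof -
  have "compact (f ` cball 0 R)"
    by (intro compact_continuous_image continuous_on_subset[OF assms(1)]) auto
  then obtain B where B: "\<And>x. norm x \<le> R \<Longrightarrow> \<bar>f x\<bar> \<le> B"
    using compact_imp_bounded bounded_iff by (metis image_eqI mem_cball_0 real_norm_def)
  then have "\<bar>f x\<bar> \<le> max 0 B" for x
    using B[of x] assms(2)[of x] by (cases "norm x \<le> R") (auto simp: le_max_iff_disj)
  then show thesis by (intro that[of "max 0 B"]) auto
qed

definition cutoff :: "real \<Rightarrow> real \<Rightarrow> ('a::euclidean_space \<Rightarrow> real) \<Rightarrow> bool" where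
  "cutoff r \<rho> \<phi> \<longleftrightarrow> C21 (\<lambda>x _. \<phi> x) (UNIV \<times> UNIV) \<and>
    (\<forall>x. 0 \<le> \<phi> x \<and> \<phi> x \<le> 1 \<and> (norm x \<le> r \<longrightarrow> \<phi> x = 1) \<and> (\<rho> \<le> norm x \<longrightarrow> \<phi> x = 0))"

lemma cutoffD:
  assumes "cutoff r \<rho> \<phi>"
  shows "C21 (\<lambda>x _. \<phi> x) (UNIV \<times> UNIV)" and "0 \<le> \<phi> x" and "\<phi> x \<le> 1"
    and "norm x \<le> r \<Longrightarrow> \<phi> x = 1" and "\<rho> \<le> norm x \<Longrightarrow> \<phi> x = 0"
  using assms by (auto simp: cutoff_def)

lemma cutoff_exists:
  fixes r \<rho> :: real
  assumes r: "0 \<le> r" "r < \<rho>"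
  obtains \<phi> :: "'a::euclidean_space \<Rightarrow> real" where "cutoff r \<rho> \<phi>"
proof -
  define d where "d = \<rho>\<^sup>2 - r\<^sup>2"
  have d: "0 < d" using r by (simp add: d_def power_strict_mono)
  define p q where "p v = max 0 (radial_profile r \<rho> v)" and "q v = max 0 (1 - p v ^ 3)" for v
  define g g' g'' where "g v = 1 - q v ^ 3" and "g' v = - 9 / d * (q v ^ 2 * p v ^ 2)"
    and "g'' v = - 9 / d * (6 / d * q v * p v ^ 4 - 2 / d * p v * q v ^ 2)" for v
  have p_power_deriv: "((\<lambda>v. p v ^ k) has_real_derivative real k * p v ^ (k - 1) * - (1 / d)) (at v)" if "2 \<le> k" for k v
    unfolding p_def d_def by (rule DERIV_chain2[OF DERIV_pos_part_power[OF that] radial_profile(3)[OF r]])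
  have q_power_deriv: "((\<lambda>v. q v ^ k) has_real_derivative real k * q v ^ (k - 1) * (0 - real 3 * p v ^ (3 - 1) * - (1 / d))) (at v)"
    if "2 \<le> k" for k v
    unfolding q_def by (intro DERIV_chain2[OF DERIV_pos_part_power[OF that]] DERIV_diff DERIV_const p_power_deriv) simp
  have g_deriv: "(g has_real_derivative g' v) (at v)" for v
    unfolding g_def g'_def by (rule DERIV_cong, rule DERIV_diff[OF DERIV_const q_power_deriv]) simp_all
  have g'_deriv: "(g' has_real_derivative g'' v) (at v)" for v
    unfolding g'_def g''_def
    by (rule DERIV_cong, rule DERIV_cmult[OF DERIV_mult[OF q_power_deriv p_power_deriv]]) (simp_all add: power2_eq_square power4_eq_xxxx)
  have g''_cont: "continuous_on UNIV g''"
    unfolding g''_def q_def p_def radial_profile_def by (intro continuous_intros) (use d in \<open>auto simp: d_def\<close>)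
  have q: "0 \<le> q v" "q v \<le> 1" for v by (auto simp: q_def p_def)
  show thesis
  proof (rule that[of "\<lambda>x. g ((norm x)\<^sup>2)"], unfold cutoff_def, intro conjI allI impI)
    show "C21 (\<lambda>(x::'a) _. g ((norm x)\<^sup>2)) (UNIV \<times> UNIV)" by (rule C21_radial(1)[OF g_deriv g'_deriv g''_cont])
    show "0 \<le> g ((norm x)\<^sup>2)" "g ((norm x)\<^sup>2) \<le> 1" for x :: 'a
      using q by (simp_all add: g_def power_le_one)
    show "g ((norm x)\<^sup>2) = 1" if "norm x \<le> r" for x :: 'a
      using one_le_power[of "p ((norm x)\<^sup>2)" 3] radial_profile(1)[OF r that] by (simp add: g_def q_def p_def max_absorb1)
    show "g ((norm x)\<^sup>2) = 0" if "\<rho> \<le> norm x" for x :: 'a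
      using radial_profile(2)[OF r that] by (simp add: g_def q_def p_def max_absorb1)
  qed
qed

section \<open>The heat kernel\<close>

lemma heat_kernel_nonneg [simp]: "0 \<le> heat_kernel x s"
  by (simp add: heat_kernel_def)

lemma heat_kernel_nonpos_time [simp]: "s \<le> 0 \<Longrightarrow> heat_kernel x s = 0"
  by (simp add: heat_kernel_def)

lemma borel_measurable_heat_kernel [measurable]:
  "(\<lambda>p. heat_kernel (fst p) (snd p)) \<in> borel_measurable (borel :: ('a::euclidean_space \<times> real) measure)"
  unfolding heat_kernel_def borel_prod[symmetric] by measurable

lemma heat_kernel_le_time:
  fixes x :: "'a::euclidean_space"
  assumes "0 < s"
  shows "heat_kernel x s \<le> (4 * pi * s) powr (- real DIM('a) / 2)"
proof -
  have "exp (- (norm x)\<^sup>2 / (4 * s)) \<le> 1" using assms by simp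
  then show ?thesis using assms by (simp add: heat_kernel_def mult_left_le)
qed

lemma exp_minus_le_powr:
  fixes m z :: real
  assumes "0 < m" "0 < z"
  shows "exp (- z) \<le> (m / z) powr m"
proof -
  have "z / m \<le> exp (z / m)" using exp_ge_add_one_self[of "z / m"] by linarith
  then have "(z / m) powr m \<le> exp (z / m) powr m" using assms by (intro powr_mono2) auto
  then have "(z / m) powr m \<le> exp z" using assms by (simp add: exp_powr_real)
  moreover have "(m / z) powr m = inverse ((z / m) powr m)"
    using assms by (simp add: powr_divide)
  ultimately show ?thesis using assms by (simp add: exp_minus le_imp_inverse_le)
qed

lemma heat_kernel_away_from_axis:
  assumes "0 \<le> q"
  obtains C where "0 < C" and "\<And>\<rho> (x::'a::euclidean_space) s. 0 < \<rho> \<Longrightarrow> 0 < s \<Longrightarrow> \<rho> \<le> norm x \<Longrightarrow>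
    heat_kernel x s \<le> C * \<rho> powr (- real DIM('a) - 2 * q) * s powr q"
proof
  let ?n = "real DIM('a)"
  define m where "m = ?n / 2 + q"
  have m: "0 < m" using assms by (simp add: m_def add_pos_nonneg)
  let ?C = "(4 * pi) powr (- ?n / 2) * (4 * m) powr m"
  show "0 < ?C" using m by simp
  fix \<rho> s :: real and x :: 'a assume *: "0 < \<rho>" "0 < s" "\<rho> \<le> norm x"
  have "exp (- (norm x)\<^sup>2 / (4 * s)) \<le> exp (- (\<rho>\<^sup>2 / (4 * s)))"
    using * by (simp add: divide_right_mono power_mono)
  also have "\<dots> \<le> (m / (\<rho>\<^sup>2 / (4 * s))) powr m"
    by (rule exp_minus_le_powr) (use * m in auto)
  also have "m / (\<rho>\<^sup>2 / (4 * s)) = 4 * m * s * \<rho> powr (-2)"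
    using * by (simp add: powr_minus powr_numeral field_simps)
  also have "\<dots> powr m = (4 * m) powr m * s powr m * \<rho> powr (- ?n - 2 * q)"
  proof -
    have "(4 * m * s * \<rho> powr (-2)) powr m = (4 * m) powr m * s powr m * \<rho> powr (-2 * m)"
      using * m by (simp add: powr_mult powr_powr del: powr_neg_numeral)
    also have "-2 * m = - ?n - 2 * q" by (simp add: m_def)
    finally show ?thesis .
  qed
  finally have "heat_kernel x s \<le> (4 * pi * s) powr (- ?n / 2) * ((4 * m) powr m * s powr m * \<rho> powr (- ?n - 2 * q))"
    using * by (simp add: heat_kernel_def mult_left_mono)
  also have "\<dots> = ?C * \<rho> powr (- ?n - 2 * q) * (s powr (- ?n / 2) * s powr m)"
    using * by (simp add: powr_mult mult_ac)
  also have "s powr (- ?n / 2) * s powr m = s powr q"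
    by (simp add: m_def powr_add[symmetric])
  finally show "heat_kernel x s \<le> ?C * \<rho> powr (- ?n - 2 * q) * s powr q" .
qed

lemma heat_kernel_off_diagonal:
  obtains C where "0 < C" and "\<And>\<rho> (x::'a::euclidean_space) s. 0 < \<rho> \<Longrightarrow> \<rho> \<le> norm x \<or> \<rho>\<^sup>2 \<le> s \<Longrightarrow>
    heat_kernel x s \<le> C * \<rho> powr (- real DIM('a))"
proof -
  let ?n = "real DIM('a)"
  obtain D where D: "0 < D" "\<And>\<rho> (x::'a) s. 0 < \<rho> \<Longrightarrow> 0 < s \<Longrightarrow> \<rho> \<le> norm x \<Longrightarrow> heat_kernel x s \<le> D * \<rho> powr (- ?n)"
    using heat_kernel_away_from_axis[of 0, where 'a='a] by auto
  have "heat_kernel x s \<le> max 1 D * \<rho> powr (- ?n)"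
    if "0 < \<rho>" and far: "\<rho> \<le> norm x \<or> \<rho>\<^sup>2 \<le> s" for \<rho> s and x :: 'a
  proof (cases "0 < s")
    case True
    from far show ?thesis
    proof
      assume "\<rho> \<le> norm x"
      then have "heat_kernel x s \<le> D * \<rho> powr (- ?n)" by (rule D(2)[OF that(1) True])
      also have "\<dots> \<le> max 1 D * \<rho> powr (- ?n)" by (intro mult_right_mono) auto
      finally show ?thesis .
    next
      assume "\<rho>\<^sup>2 \<le> s"
      then have "\<rho>\<^sup>2 \<le> 4 * pi * s" using True pi_gt3 mult_right_mono[of 1 "4 * pi" s] by linarith
      then have "(4 * pi * s) powr (- ?n / 2) \<le> (\<rho>\<^sup>2) powr (- ?n / 2)"
        using that(1) by (intro powr_mono2') auto
      also have "\<dots> = \<rho> powr (- ?n)"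
        using that(1) powr_powr[of \<rho> 2 "- ?n / 2"] by (simp add: powr_numeral)
      also have "\<dots> \<le> max 1 D * \<rho> powr (- ?n)" using mult_right_mono[of 1 "max 1 D"] by simp
      finally show ?thesis using heat_kernel_le_time[OF True, of x] by linarith
    qed
  qed simp
  then show thesis by (intro that[of "max 1 D"]) auto
qed


lemma heat_kernel_DERIV_time:
  fixes x :: "'a::euclidean_space"
  assumes "s < t"
  shows "((\<lambda>s. heat_kernel x (t - s)) has_real_derivative
    heat_kernel x (t - s) * (real DIM('a) / (2 * (t - s)) - (norm x)\<^sup>2 / (4 * (t - s)\<^sup>2))) (at s)"
proof -
  let ?n = "real DIM('a)"
  let ?g = "\<lambda>s. (4 * pi * (t - s)) powr (- ?n / 2) * exp (- (norm x)\<^sup>2 / (4 * (t - s)))"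
  have power: "((\<lambda>s. (4 * pi * (t - s)) powr (- ?n / 2)) has_real_derivative
      (4 * pi * (t - s)) powr (- ?n / 2) * (?n / (2 * (t - s)))) (at s)"
    by (rule DERIV_cong, rule DERIV_fun_powr[where g="\<lambda>s. 4 * pi * (t - s)" and m="- 4 * pi"])
      (use assms in \<open>auto intro!: derivative_eq_intros simp: powr_diff, simp add: field_simps\<close>)
  have "((\<lambda>s. - (norm x)\<^sup>2 / (4 * (t - s))) has_real_derivative - (norm x)\<^sup>2 / (4 * (t - s)\<^sup>2)) (at s)"
    using assms by (auto intro!: derivative_eq_intros simp: power2_eq_square simp del: right_diff_distrib_numeral)
  from DERIV_mult[OF power DERIV_fun_exp[OF this]]
  have "(?g has_real_derivative ?g s * (?n / (2 * (t - s)) - (norm x)\<^sup>2 / (4 * (t - s)\<^sup>2))) (at s)"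
    by (rule DERIV_cong) (simp add: algebra_simps)
  then have "((\<lambda>s. heat_kernel x (t - s)) has_real_derivative
      ?g s * (?n / (2 * (t - s)) - (norm x)\<^sup>2 / (4 * (t - s)\<^sup>2))) (at s)"
    by (rule has_field_derivative_transform_within_open[of _ _ _ "{..<t}"])
      (use assms in \<open>auto simp: heat_kernel_def\<close>)
  then show ?thesis using assms by (simp add: heat_kernel_def)
qed

lemma heat_kernel_DERIV_space:
  fixes x y i :: "'a::euclidean_space"
  assumes "0 < \<tau>" "i \<in> Basis"
  shows "((\<lambda>h. heat_kernel (x - (y + h *\<^sub>R i)) \<tau>) has_real_derivative
    heat_kernel (x - y) \<tau> * (((x - y) \<bullet> i) / (2 * \<tau>))) (at 0)"
proof -
  have *: "(norm (x - (y + h *\<^sub>R i)))\<^sup>2 = (norm (x - y))\<^sup>2 - 2 * h * ((x - y) \<bullet> i) + h\<^sup>2" for h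
    using norm_add_scaleR_Basis_sq[OF assms(2), of "x - y" "- h"] by (simp add: algebra_simps)
  have "((\<lambda>h. - ((norm (x - y))\<^sup>2 - 2 * h * ((x - y) \<bullet> i) + h\<^sup>2) / (4 * \<tau>)) has_real_derivative
      ((x - y) \<bullet> i) / (2 * \<tau>)) (at 0)"
    using assms by (auto intro!: derivative_eq_intros simp: power2_eq_square)
  from DERIV_cmult[OF DERIV_fun_exp[OF this], of "(4 * pi * \<tau>) powr (- real DIM('a) / 2)"]
  show ?thesis
    unfolding heat_kernel_def * using assms by (simp add: mult.assoc)
qed

lemma heat_kernel_DERIV2_space:
  fixes x y i j :: "'a::euclidean_space"
  assumes "0 < \<tau>" "j \<in> Basis"
  shows "((\<lambda>h. heat_kernel (x - (y + h *\<^sub>R j)) \<tau> * (((x - (y + h *\<^sub>R j)) \<bullet> i) / (2 * \<tau>))) has_real_derivative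
    heat_kernel (x - y) \<tau> * (((x - y) \<bullet> i) * ((x - y) \<bullet> j) / (4 * \<tau>\<^sup>2) - (j \<bullet> i) / (2 * \<tau>))) (at 0)"
proof -
  have "((\<lambda>h. (x - (y + h *\<^sub>R j)) \<bullet> i) has_real_derivative - (j \<bullet> i)) (at 0)"
    by (auto intro!: derivative_eq_intros simp: inner_diff_left inner_add_left)
  from DERIV_mult[OF heat_kernel_DERIV_space[OF assms] DERIV_cdivide[OF this]] show ?thesis
    by (rule DERIV_cong) (use assms in \<open>simp add: field_simps power2_eq_square\<close>)
qed

lemma continuous_on_heat_kernel_reversed:
  "continuous_on (UNIV \<times> {..<t}) (\<lambda>p. heat_kernel (x - fst p :: 'a::euclidean_space) (t - snd p))"
proof -
  have "continuous_on (UNIV \<times> {..<t}) (\<lambda>p. (4 * pi * (t - snd p)) powr (- real DIM('a) / 2)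
      * exp (- (norm (x - fst p :: 'a))\<^sup>2 / (4 * (t - snd p))))"
    by (intro continuous_intros) auto
  then show ?thesis
    by (rule continuous_on_eq) (auto simp: heat_kernel_def)
qed

lemma C21_heat_kernel:
  fixes x y :: "'a::euclidean_space"
  shows "C21 (\<lambda>y s. heat_kernel (x - y) (t - s)) (UNIV \<times> {..<t})"
    and "s < t \<Longrightarrow> i \<in> Basis \<Longrightarrow> pdx (\<lambda>y. heat_kernel (x - y) (t - s)) i y = heat_kernel (x - y) (t - s) * (((x - y) \<bullet> i) / (2 * (t - s)))"
    and "s < t \<Longrightarrow> adjoint_heat_op (\<lambda>y s. heat_kernel (x - y) (t - s)) y s = 0"
proof -
  let ?n = "real DIM('a)"
  let ?K = "\<lambda>y s. heat_kernel (x - y) (t - s)"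
  have time: "((\<lambda>s. ?K y s) has_real_derivative ?K y s * (?n / (2 * (t - s)) - (norm (x - y))\<^sup>2 / (4 * (t - s)\<^sup>2))) (at s)"
    if "s \<in> {..<t}" for y s
    by (rule heat_kernel_DERIV_time) (use that in simp)
  have space: "((\<lambda>h. ?K (y + h *\<^sub>R i) s) has_real_derivative ?K y s * (((x - y) \<bullet> i) / (2 * (t - s)))) (at 0)"
    if "i \<in> Basis" "s \<in> {..<t}" for i y s
    by (rule heat_kernel_DERIV_space) (use that in auto)
  have space2: "((\<lambda>h. ?K (y + h *\<^sub>R j) s * (((x - (y + h *\<^sub>R j)) \<bullet> i) / (2 * (t - s)))) has_real_derivative
      ?K y s * (((x - y) \<bullet> i) * ((x - y) \<bullet> j) / (4 * (t - s)\<^sup>2) - (j \<bullet> i) / (2 * (t - s)))) (at 0)"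
    if "i \<in> Basis" "j \<in> Basis" "s \<in> {..<t}" for i j y s
    by (rule heat_kernel_DERIV2_space) (use that in auto)
  note contK = continuous_on_heat_kernel_reversed[of t x]
  have cont: "continuous_on (UNIV \<times> {..<t}) (\<lambda>p. ?K (fst p) (snd p) * (?n / (2 * (t - snd p)) - (norm (x - fst p))\<^sup>2 / (4 * (t - snd p)\<^sup>2)))"
    "continuous_on (UNIV \<times> {..<t}) (\<lambda>p. ?K (fst p) (snd p) * (((x - fst p) \<bullet> i) / (2 * (t - snd p))))"
    "continuous_on (UNIV \<times> {..<t}) (\<lambda>p. ?K (fst p) (snd p) * (((x - fst p) \<bullet> i) * ((x - fst p) \<bullet> j) / (4 * (t - snd p)\<^sup>2) - (j \<bullet> i) / (2 * (t - snd p))))"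
    for i j
    by (intro continuous_intros contK; auto)+
  note kernel = C21I[where f="?K" and I="{..<t}", OF time space space2 contK cont]
  show "C21 ?K (UNIV \<times> {..<t})" by (rule kernel(1))
  show "s < t \<Longrightarrow> i \<in> Basis \<Longrightarrow> pdx (\<lambda>y. ?K y s) i y = ?K y s * (((x - y) \<bullet> i) / (2 * (t - s)))"
    using kernel(3) by simp
  show "adjoint_heat_op ?K y s = 0" if "s < t"
  proof -
    have "lap ?K y s = (\<Sum>i\<in>Basis. ?K y s * (((x - y) \<bullet> i) * ((x - y) \<bullet> i) / (4 * (t - s)\<^sup>2) - (i \<bullet> i) / (2 * (t - s))))"
      using kernel(4) that by simp
    also have "\<dots> = (\<Sum>i\<in>Basis. ?K y s * (((x - y) \<bullet> i)\<^sup>2 / (4 * (t - s)\<^sup>2) - 1 / (2 * (t - s))))"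
      by (intro sum.cong) (auto simp: power2_eq_square)
    also have "\<dots> = ?K y s * ((norm (x - y))\<^sup>2 / (4 * (t - s)\<^sup>2) - ?n / (2 * (t - s)))"
      by (simp add: sum_distrib_left[symmetric] sum_subtractf sum_divide_distrib[symmetric] sum_Basis_inner_sq)
    finally have "lap ?K y s = ?K y s * ((norm (x - y))\<^sup>2 / (4 * (t - s)\<^sup>2) - ?n / (2 * (t - s)))" .
    then show ?thesis using kernel(2)[of s y] that by (simp add: adjoint_heat_op_def algebra_simps)
  qed
qed

definition cutoff_kernel :: "('a::euclidean_space \<Rightarrow> real) \<Rightarrow> 'a \<Rightarrow> real \<Rightarrow> 'a \<Rightarrow> real \<Rightarrow> real" where
  "cutoff_kernel \<phi> x t y s = heat_kernel (x - y) (t - s) * \<phi> y"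

lemma C21_cutoff_kernel:
  assumes "C21 (\<lambda>y _. \<phi> y) (UNIV \<times> UNIV)"
  shows "C21 (cutoff_kernel \<phi> x t) (UNIV \<times> {..<t})"
  unfolding cutoff_kernel_def[abs_def] by (intro C21_mult(1) C21_heat_kernel(1) C21_subset[OF assms]) auto

lemma adjoint_heat_op_cutoff_kernel:
  fixes x y :: "'a::euclidean_space"
  assumes \<phi>: "C21 (\<lambda>y _. \<phi> y) (UNIV \<times> UNIV)" and s: "s < t"
  shows "adjoint_heat_op (cutoff_kernel \<phi> x t) y s
    = heat_kernel (x - y) (t - s) * lap (\<lambda>y _. \<phi> y) y s
      + heat_kernel (x - y) (t - s) / (t - s) * (\<Sum>i\<in>Basis. ((x - y) \<bullet> i) * pdx \<phi> i y)"
proof -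
  have "adjoint_heat_op (cutoff_kernel \<phi> x t) y s
      = heat_kernel (x - y) (t - s) * lap (\<lambda>y _. \<phi> y) y s
        + 2 * (\<Sum>i\<in>Basis. heat_kernel (x - y) (t - s) * (((x - y) \<bullet> i) / (2 * (t - s))) * pdx \<phi> i y)"
    unfolding cutoff_kernel_def[abs_def]
    by (subst C21_mult(2)[OF C21_heat_kernel(1) C21_subset[OF \<phi>]])
      (use s in \<open>simp_all add: C21_heat_kernel(2,3) adjoint_heat_op_def[of "\<lambda>x _. \<phi> x"] dt_def\<close>)
  moreover have "2 * (k * (a / (2 * \<tau>)) * b) = k / \<tau> * (a * b)" for k a b \<tau> :: real
    by simp
  ultimately show ?thesis by (simp only: sum_distrib_left)
qed

lemma adjoint_heat_op_cutoff_kernel_le: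
  fixes x y :: "'a::euclidean_space"
  assumes \<phi>: "C21 (\<lambda>y _. \<phi> y) (UNIV \<times> UNIV)" and s: "s < t"
    and B: "(\<Sum>i\<in>Basis. \<bar>pdx \<phi> i y\<bar>) \<le> B" "\<bar>lap (\<lambda>y _. \<phi> y) y s\<bar> \<le> B"
    and H: "heat_kernel (x - y) (t - s) \<le> H" "heat_kernel (x - y) (t - s) / (t - s) \<le> H"
    and L: "norm (x - y) \<le> L"
  shows "adjoint_heat_op (cutoff_kernel \<phi> x t) y s \<le> H * B + H * (L * B)"
proof -
  let ?K = "heat_kernel (x - y) (t - s)"
  have bounds_nonneg: "0 \<le> B" "0 \<le> L" using B(2) L norm_ge_zero[of "x - y"] by linarith+
  have "?K * lap (\<lambda>y _. \<phi> y) y s \<le> H * B"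
    using H(1) abs_le_D1[OF B(2)] bounds_nonneg by (intro order_trans[OF mult_left_mono mult_right_mono]) auto
  moreover have "(\<Sum>i\<in>Basis. ((x - y) \<bullet> i) * pdx \<phi> i y) \<le> L * B"
  proof -
    have "(\<Sum>i\<in>Basis. ((x - y) \<bullet> i) * pdx \<phi> i y) \<le> (\<Sum>i\<in>Basis. L * \<bar>pdx \<phi> i y\<bar>)"
    proof (rule sum_mono)
      fix i :: 'a assume "i \<in> Basis"
      then have "\<bar>(x - y) \<bullet> i\<bar> \<le> L" using Basis_le_norm[of i "x - y"] L by linarith
      then have "\<bar>((x - y) \<bullet> i) * pdx \<phi> i y\<bar> \<le> L * \<bar>pdx \<phi> i y\<bar>"
        unfolding abs_mult by (intro mult_right_mono) auto
      then show "((x - y) \<bullet> i) * pdx \<phi> i y \<le> L * \<bar>pdx \<phi> i y\<bar>" by linarith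
    qed
    also have "\<dots> \<le> L * B" using B(1) bounds_nonneg by (simp add: sum_distrib_left[symmetric] mult_left_mono)
    finally show ?thesis .
  qed
  then have "?K / (t - s) * (\<Sum>i\<in>Basis. ((x - y) \<bullet> i) * pdx \<phi> i y) \<le> H * (L * B)"
    using H(2) s bounds_nonneg by (intro order_trans[OF mult_left_mono mult_right_mono]) auto
  ultimately show ?thesis unfolding adjoint_heat_op_cutoff_kernel[OF \<phi> s] by (rule add_mono)
qed

lemma cutoff_derivatives:
  fixes \<phi> :: "'a::euclidean_space \<Rightarrow> real"
  assumes "cutoff r \<rho> \<phi>"
  shows "norm x < r \<or> \<rho> < norm x \<Longrightarrow> pdx \<phi> i x = 0 \<and> lap (\<lambda>x _. \<phi> x) x t = 0"
    and "\<exists>B\<ge>0. \<forall>x. (\<Sum>i\<in>Basis. \<bar>pdx \<phi> i x\<bar>) \<le> B \<and> (\<forall>t. \<bar>lap (\<lambda>x _. \<phi> x) x t\<bar> \<le> B)"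
proof -
  note \<phi> = cutoffD[OF assms]
  show flat: "pdx \<phi> i x = 0 \<and> lap (\<lambda>x _. \<phi> x) x t = 0" if "norm x < r \<or> \<rho> < norm x" for x i t
    using that spatial_derivatives_locally_constant[of "ball 0 r" x "\<lambda>x _. \<phi> x" t 1]
      spatial_derivatives_locally_constant[of "- cball 0 \<rho>" x "\<lambda>x _. \<phi> x" t 0] \<phi>(4,5) by (auto simp: open_Compl)
  have "continuous_on UNIV (\<lambda>x. \<Sum>i\<in>Basis. \<bar>pdx \<phi> i x\<bar>)"
    using continuous_on_slices(1)[OF C21_continuous_on(3)[OF \<phi>(1)], of _ 0] by (intro continuous_intros) simp
  then obtain B where "0 \<le> B" "\<And>x. \<bar>\<Sum>i\<in>Basis. \<bar>pdx \<phi> i x\<bar>\<bar> \<le> B"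
    by (rule continuous_compact_support_bounded[where R=\<rho>]) (simp add: flat, blast)
  moreover have "continuous_on UNIV (\<lambda>x. lap (\<lambda>x _. \<phi> x) x 0)"
    by (rule continuous_on_slices(1)[OF C21_continuous_on(5)[OF \<phi>(1)] UNIV_I])
  then obtain B' where "\<And>x. \<bar>lap (\<lambda>x _. \<phi> x) x 0\<bar> \<le> B'"
    by (rule continuous_compact_support_bounded[where R=\<rho>]) (simp add: flat, blast)
  ultimately have "\<bar>lap (\<lambda>x _. \<phi> x) x t\<bar> \<le> max B B'" "(\<Sum>i\<in>Basis. \<bar>pdx \<phi> i x\<bar>) \<le> max B B'" "0 \<le> max B B'" for x t
    by (auto simp: lap_def le_max_iff_disj intro: order_trans[OF abs_ge_self])
  then show "\<exists>B\<ge>0. \<forall>x. (\<Sum>i\<in>Basis. \<bar>pdx \<phi> i x\<bar>) \<le> B \<and> (\<forall>t. \<bar>lap (\<lambda>x _. \<phi> x) x t\<bar> \<le> B)"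
    by (intro exI[of _ "max B B'"]) simp
qed

lemma heat_kernel_bounded_off_ball:
  assumes "0 < d"
  obtains H where "0 \<le> H" "\<And>(x::'a::euclidean_space) s. d \<le> norm x \<Longrightarrow> heat_kernel x s \<le> H"
    "\<And>(x::'a::euclidean_space) s. d \<le> norm x \<Longrightarrow> heat_kernel x s / s \<le> H"
proof -
  let ?n = "real DIM('a)"
  obtain C where C: "0 < C" "\<And>\<rho> (x::'a) s. 0 < \<rho> \<Longrightarrow> \<rho> \<le> norm x \<or> \<rho>\<^sup>2 \<le> s \<Longrightarrow> heat_kernel x s \<le> C * \<rho> powr (- ?n)"
    by (rule heat_kernel_off_diagonal) blast
  obtain D where D: "0 < D" "\<And>\<rho> (x::'a) s. 0 < \<rho> \<Longrightarrow> 0 < s \<Longrightarrow> \<rho> \<le> norm x \<Longrightarrow>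
      heat_kernel x s \<le> D * \<rho> powr (- ?n - 2 * 1) * s powr 1"
    by (rule heat_kernel_away_from_axis[of 1]) auto
  let ?H = "max (C * d powr (- ?n)) (D * d powr (- ?n - 2))"
  show thesis
  proof (rule that[of ?H])
    show "0 \<le> ?H" using C(1) by (simp add: le_max_iff_disj)
    fix x :: 'a and s assume x: "d \<le> norm x"
    show "heat_kernel x s \<le> ?H" using C(2)[OF assms, of x s] x by (simp add: le_max_iff_disj)
    show "heat_kernel x s / s \<le> ?H"
      using D(2)[OF assms, of s x] x D(1) by (cases "0 < s") (simp_all add: le_max_iff_disj pos_divide_le_eq)
  qed
qed

text \<open>The cut-off is constant near the ball containing \<open>x\<close>, so its derivatives only meet the kernel off the diagonal.\<close>

lemma heat_kernel_cutoff_exists: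
  fixes r \<rho> :: real
  assumes "0 \<le> r" "r < \<rho>"
  obtains \<phi> :: "'a::euclidean_space \<Rightarrow> real" and E where "0 \<le> E" "cutoff r \<rho> \<phi>"
    "\<And>x y s t. norm x \<le> r \<Longrightarrow> s < t \<Longrightarrow> adjoint_heat_op (cutoff_kernel \<phi> x t) y s \<le> E"
proof -
  define r' where "r' = (r + \<rho>) / 2"
  have r': "r < r'" "r' < \<rho>" using assms by (auto simp: r'_def)
  obtain \<phi> :: "'a \<Rightarrow> real" where \<phi>: "cutoff r' \<rho> \<phi>"
    by (rule cutoff_exists[of r' \<rho>]) (use assms r' in auto)
  obtain B where B: "0 \<le> B" "\<And>y. (\<Sum>i\<in>Basis. \<bar>pdx \<phi> i y\<bar>) \<le> B" "\<And>y s. \<bar>lap (\<lambda>x _. \<phi> x) y s\<bar> \<le> B"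
    using cutoff_derivatives(2)[OF \<phi>] by auto
  obtain H where H: "0 \<le> H" "\<And>(x::'a) s. r' - r \<le> norm x \<Longrightarrow> heat_kernel x s \<le> H"
    "\<And>(x::'a) s. r' - r \<le> norm x \<Longrightarrow> heat_kernel x s / s \<le> H"
    by (rule heat_kernel_bounded_off_ball[of "r' - r"]) (use r' in auto)
  have "adjoint_heat_op (cutoff_kernel \<phi> x t) y s \<le> H * B + H * ((r + \<rho>) * B)"
    if x: "norm x \<le> r" and s: "s < t" for x y s t
  proof (cases "norm y < r' \<or> \<rho> < norm y")
    case True
    then show ?thesis
      unfolding adjoint_heat_op_cutoff_kernel[OF cutoffD(1)[OF \<phi>] s]
      using cutoff_derivatives(1)[OF \<phi> True] assms B(1) H(1) by simp
  next
    case False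
    have xy: "r' - r \<le> norm (x - y)" "norm (x - y) \<le> r + \<rho>"
      using x False norm_triangle_ineq2[of y x] norm_triangle_ineq4[of x y] by (auto simp: norm_minus_commute)
    show ?thesis
      by (rule adjoint_heat_op_cutoff_kernel_le[OF cutoffD(1)[OF \<phi>] s B(2,3) H(2,3)[OF xy(1)] xy(2)])
  qed
  moreover have "cutoff r \<rho> \<phi>" using \<phi> r' by (auto simp: cutoff_def)
  moreover have "0 \<le> H * B + H * ((r + \<rho>) * B)" using assms B(1) H(1) by simp
  ultimately show thesis by (intro that) auto
qed

lemma nn_integral_gaussian_real:
  fixes c :: real
  assumes "0 < c"
  shows "(\<integral>\<^sup>+x. ennreal (exp (- c * x\<^sup>2)) \<partial>lborel) = ennreal (sqrt (pi / c))"
proof -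
  define d where "d = sqrt (1 / (2 * c))"
  have d: "0 < d" "d\<^sup>2 = 1 / (2 * c)" using assms by (auto simp: d_def)
  have "normal_density 0 d x = sqrt (c / pi) * exp (- c * x\<^sup>2)" for x
    unfolding normal_density_def d(2) using assms by (simp add: field_simps real_sqrt_divide)
  then have "exp (- c * x\<^sup>2) = sqrt (pi / c) * normal_density 0 d x" for x
    using assms by (simp add: real_sqrt_divide)
  then have "(\<integral>\<^sup>+x. ennreal (exp (- c * x\<^sup>2)) \<partial>lborel) = (\<integral>\<^sup>+x. ennreal (sqrt (pi / c) * normal_density 0 d x) \<partial>lborel)"
    by simp
  also have "\<dots> = ennreal (\<integral>x. sqrt (pi / c) * normal_density 0 d x \<partial>lborel)"
    by (rule nn_integral_eq_integral) (use d assms in auto)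
  also have "\<dots> = ennreal (sqrt (pi / c))" using d by simp
  finally show ?thesis .
qed

lemma nn_integral_gaussian:
  assumes "0 < c"
  shows "(\<integral>\<^sup>+x. ennreal (exp (- c * (norm (x::'a::euclidean_space))\<^sup>2)) \<partial>lborel) = ennreal ((pi / c) powr (real DIM('a) / 2))"
proof -
  have "exp (- c * (norm x)\<^sup>2) = (\<Prod>b\<in>Basis. exp (- c * (x \<bullet> b)\<^sup>2))" for x :: 'a
    by (simp add: exp_sum[symmetric] sum_distrib_left[symmetric] sum_Basis_inner_sq sum_negf)
  then have "(\<integral>\<^sup>+x. ennreal (exp (- c * (norm (x::'a))\<^sup>2)) \<partial>lborel)
      = (\<integral>\<^sup>+x. (\<Prod>b\<in>Basis. ennreal (exp (- c * ((x::'a) \<bullet> b)\<^sup>2))) \<partial>lborel)"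
    by (simp add: prod_ennreal)
  also have "\<dots> = (\<Prod>b\<in>(Basis::'a set). (\<integral>\<^sup>+x. ennreal (exp (- c * x\<^sup>2)) \<partial>lborel))"
    by (rule nn_integral_lborel_prod) auto
  also have "\<dots> = ennreal (sqrt (pi / c) ^ DIM('a))"
    using assms by (simp add: nn_integral_gaussian_real[OF assms, simplified] ennreal_power)
  also have "sqrt (pi / c) ^ DIM('a) = (pi / c) powr (real DIM('a) / 2)"
    using assms by (simp add: powr_half_sqrt[symmetric] powr_realpow[symmetric] powr_powr)
  finally show ?thesis .
qed

lemma nn_integral_heat_kernel_powr:
  assumes "0 < s" "0 < \<beta>"
  shows "(\<integral>\<^sup>+x. ennreal (heat_kernel (x::'a::euclidean_space) s powr \<beta>) \<partial>lborel)
    = ennreal (\<beta> powr (- real DIM('a) / 2) * (4 * pi * s) powr (real DIM('a) * (1 - \<beta>) / 2))"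
proof -
  let ?n = "real DIM('a)"
  let ?A = "(4 * pi * s) powr (- ?n * \<beta> / 2)"
  define c where "c = \<beta> / (4 * s)"
  have c: "0 < c" using assms by (simp add: c_def)
  have "heat_kernel x s powr \<beta> = ?A * exp (- c * (norm x)\<^sup>2)" for x :: 'a
    using assms by (simp add: heat_kernel_def powr_mult powr_powr exp_powr_real c_def mult.commute)
  then have "(\<integral>\<^sup>+x. ennreal (heat_kernel (x::'a) s powr \<beta>) \<partial>lborel) = ennreal ?A * ennreal ((pi / c) powr (?n / 2))"
    by (simp add: ennreal_mult' nn_integral_cmult nn_integral_gaussian[OF c, simplified])
  also have "(pi / c) powr (?n / 2) = (4 * pi * s) powr (?n / 2) * \<beta> powr (- ?n / 2)"
  proof -
    have "pi / c = 4 * pi * s * (1 / \<beta>)" by (simp add: c_def mult_ac)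
    then show ?thesis
      using assms by (simp only: powr_mult) (simp add: powr_minus_divide powr_divide)
  qed
  also have "ennreal ?A * ennreal \<dots> = ennreal (\<beta> powr (- ?n / 2) * (?A * (4 * pi * s) powr (?n / 2)))"
    by (simp add: mult_ac flip: ennreal_mult')
  also have "?A * (4 * pi * s) powr (?n / 2) = (4 * pi * s) powr (?n * (1 - \<beta>) / 2)"
  proof -
    have "?n * (1 - \<beta>) / 2 = - ?n * \<beta> / 2 + ?n / 2" by (simp add: field_simps)
    then show ?thesis by (simp only: powr_add)
  qed
  finally show ?thesis .
qed

definition truncated_kernel :: "real \<Rightarrow> real \<Rightarrow> 'a::euclidean_space \<times> real \<Rightarrow> ennreal" where
  "truncated_kernel \<beta> T z = ennreal (heat_kernel (fst z) (snd z) powr \<beta>) * indicator (UNIV \<times> {0<..<T}) z"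

lemma truncated_kernel_eq:
  "truncated_kernel \<beta> T (y, s) = (if 0 < s \<and> s < T then ennreal (heat_kernel y s powr \<beta>) else 0)"
  by (simp add: truncated_kernel_def indicator_def)

lemma borel_measurable_truncated_kernel [measurable]:
  "truncated_kernel \<beta> T \<in> borel_measurable (borel :: ('a::euclidean_space \<times> real) measure)"
proof -
  have "UNIV \<times> {0<..<T} \<in> sets (borel :: ('a \<times> real) measure)" by (intro borel_open open_Times) auto
  then show ?thesis unfolding truncated_kernel_def by measurable
qed

lemma nn_integral_truncated_kernel:
  assumes "0 < \<beta>"
  shows "(\<integral>\<^sup>+z. truncated_kernel \<beta> T (z :: 'a::euclidean_space \<times> real) \<partial>lborel)
    = (\<integral>\<^sup>+s\<in>{0<..<T}. ennreal (\<beta> powr (- real DIM('a) / 2) * (4 * pi * s) powr (real DIM('a) * (1 - \<beta>) / 2)) \<partial>lborel)"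
proof -
  have "(\<lambda>z. ennreal (heat_kernel (fst z :: 'a) (snd z) powr \<beta>) * indicator (UNIV \<times> {0<..<T}) z) \<in> borel_measurable borel"
    using borel_measurable_truncated_kernel[of \<beta> T] by (simp add: truncated_kernel_def[abs_def])
  then show ?thesis
    unfolding truncated_kernel_def
    by (subst nn_integral_space_time_Tonelli)
      (auto intro!: nn_integral_cong simp: nn_integral_heat_kernel_powr assms indicator_def)
qed

lemma nn_integral_truncated_kernel_1:
  assumes "0 \<le> T"
  shows "(\<integral>\<^sup>+z. truncated_kernel 1 T (z :: 'a::euclidean_space \<times> real) \<partial>lborel) = ennreal T"
proof -
  have "(\<integral>\<^sup>+z. truncated_kernel 1 T (z :: 'a \<times> real) \<partial>lborel) = (\<integral>\<^sup>+s. indicator {0<..<T} s \<partial>lborel)"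
    unfolding nn_integral_truncated_kernel[OF zero_less_one]
    by (intro nn_integral_cong) (auto split: split_indicator)
  then show ?thesis using assms by simp
qed

text \<open>The threshold is \<open>n * (1 - \<beta>) / 2 > -1\<close>, which makes the remaining power of the time integrable at 0.\<close>

lemma nn_integral_truncated_kernel_finite:
  assumes "0 < \<beta>" "\<beta> < (real DIM('a) + 2) / real DIM('a)"
  shows "(\<integral>\<^sup>+z. truncated_kernel \<beta> T (z :: 'a::euclidean_space \<times> real) \<partial>lborel) < \<infinity>"
proof -
  let ?n = "real DIM('a)"
  define e where "e = ?n * (1 - \<beta>) / 2"
  have e: "-1 < e" using assms by (simp add: e_def field_simps)
  define B where "B = \<beta> powr (- ?n / 2) * (4 * pi) powr e"
  define T' where "T' = max 0 T"
  have "(\<integral>\<^sup>+z. truncated_kernel \<beta> T (z :: 'a \<times> real) \<partial>lborel)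
      \<le> (\<integral>\<^sup>+s. ennreal (B * (s powr e * indicator {0..T'} s)) \<partial>lborel)"
    unfolding nn_integral_truncated_kernel[OF assms(1)]
    by (intro nn_integral_mono) (auto simp: indicator_def B_def e_def powr_mult T'_def)
  also have "\<dots> = ennreal B * (\<integral>\<^sup>+s. ennreal (s powr e * indicator {0..T'} s) \<partial>lborel)"
    by (subst nn_integral_cmult[symmetric]) (auto simp: B_def ennreal_mult')
  also have "(\<integral>\<^sup>+s. ennreal (s powr e * indicator {0..T'} s) \<partial>lborel) = ennreal (T' powr (e + 1) / (e + 1))"
  proof (rule nn_integral_has_integral_lborel)
    have "((\<lambda>s. if s \<in> {0..T'} then s powr e else 0) has_integral T' powr (e + 1) / (e + 1)) UNIV"
      using has_integral_powr_from_0[OF e, of T'] by (subst has_integral_restrict_UNIV) (auto simp: T'_def)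
    then show "((\<lambda>s. s powr e * indicator {0..T'} s) has_integral T' powr (e + 1) / (e + 1)) UNIV"
      by (rule has_integral_eq[rotated]) auto
  qed auto
  also have "ennreal B * \<dots> < \<infinity>" by (simp add: ennreal_mult_less_top)
  finally show ?thesis .
qed

lemma heat_kernel_average_lower_bound:
  obtains c where "0 < c" and "\<And>(x::'a::euclidean_space) e m w. 0 < e \<Longrightarrow> 0 \<le> m \<Longrightarrow>
    (\<And>y. y \<in> ball x (sqrt e) \<Longrightarrow> m \<le> w y) \<Longrightarrow>
    ennreal (c * m) \<le> (\<integral>\<^sup>+y. ennreal (heat_kernel (x - y) e * w y) \<partial>lborel)"
proof
  let ?n = "real DIM('a)"
  let ?c = "(4 * pi) powr (- ?n / 2) * exp (- 1 / 4) * unit_ball_vol ?n"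
  show "0 < ?c" by simp
  fix x :: 'a and e m :: real and w
  assume e: "0 < e" and m: "0 \<le> m" and w: "\<And>y. y \<in> ball x (sqrt e) \<Longrightarrow> m \<le> w y"
  let ?k = "(4 * pi * e) powr (- ?n / 2) * exp (- 1 / 4)"
  have "e powr (- ?n / 2) * sqrt e ^ DIM('a) = 1"
    using e by (simp add: powr_half_sqrt[symmetric] powr_realpow[symmetric] powr_powr powr_add[symmetric])
  then have "?c * m = (4 * pi) powr (- ?n / 2) * (e powr (- ?n / 2) * sqrt e ^ DIM('a)) * exp (- 1 / 4) * unit_ball_vol ?n * m"
    by (simp only: mult_1_right)
  also have "\<dots> = ?k * m * (unit_ball_vol ?n * sqrt e ^ DIM('a))"
    using e by (simp add: powr_mult mult_ac)
  finally have "ennreal (?c * m) = ennreal (?k * m * (unit_ball_vol ?n * sqrt e ^ DIM('a)))"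
    by (simp only:)
  also have "\<dots> = ennreal (?k * m) * emeasure lborel (ball x (sqrt e))"
    using e m by (simp add: emeasure_ball ennreal_mult)
  also have "\<dots> = (\<integral>\<^sup>+y\<in>ball x (sqrt e). ennreal (?k * m) \<partial>lborel)"
    by (simp add: nn_integral_cmult_indicator)
  also have "\<dots> \<le> (\<integral>\<^sup>+y. ennreal (heat_kernel (x - y) e * w y) \<partial>lborel)"
  proof (intro nn_integral_mono)
    fix y
    show "ennreal (?k * m) * indicator (ball x (sqrt e)) y \<le> ennreal (heat_kernel (x - y) e * w y)"
    proof (cases "y \<in> ball x (sqrt e)")
      case True
      then have "(norm (x - y))\<^sup>2 \<le> (sqrt e)\<^sup>2" by (intro power_mono) (auto simp: dist_norm)
      then have "- 1 / 4 \<le> - (norm (x - y))\<^sup>2 / (4 * e)" using e by (simp add: field_simps)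
      then have "?k \<le> heat_kernel (x - y) e" using e by (simp add: heat_kernel_def)
      then have "?k * m \<le> heat_kernel (x - y) e * w y" using w[OF True] m by (intro mult_mono) auto
      then show ?thesis using True by (simp add: ennreal_leI)
    qed simp
  qed
  finally show "ennreal (?c * m) \<le> (\<integral>\<^sup>+y. ennreal (heat_kernel (x - y) e * w y) \<partial>lborel)" .
qed

lemma heat_average_ge_nearby_time:
  obtains c where "0 < c" and "\<And>w (x::'a::euclidean_space) t \<tau>. isCont (\<lambda>p. w (fst p) (snd p)) (x, t) \<Longrightarrow> 0 \<le> w x t \<Longrightarrow> \<tau> < t \<Longrightarrow>
    \<exists>s\<in>{\<tau><..<t}. ennreal (c * w x t) \<le> (\<integral>\<^sup>+y. ennreal (heat_kernel (x - y) (t - s) * w y s) \<partial>lborel)"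
proof -
  obtain c where c: "0 < c" "\<And>(x::'a) e m w. 0 < e \<Longrightarrow> 0 \<le> m \<Longrightarrow> (\<And>y. y \<in> ball x (sqrt e) \<Longrightarrow> m \<le> w y) \<Longrightarrow>
    ennreal (c * m) \<le> (\<integral>\<^sup>+y. ennreal (heat_kernel (x - y) e * w y) \<partial>lborel)"
    by (rule heat_kernel_average_lower_bound) blast
  have "\<exists>s\<in>{\<tau><..<t}. ennreal (c / 2 * w x t) \<le> (\<integral>\<^sup>+y. ennreal (heat_kernel (x - y) (t - s) * w y s) \<partial>lborel)"
    if cont: "isCont (\<lambda>p. w (fst p) (snd p)) (x, t)" and w: "0 \<le> w x t" and \<tau>: "\<tau> < t" for w and x :: 'a and t \<tau>
  proof (cases "w x t = 0")
    case True
    then show ?thesis using dense[OF \<tau>] by auto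
  next
    case False
    then have pos: "0 < w x t" using w by simp
    then have "\<forall>\<^sub>F p in at (x, t). dist (w (fst p) (snd p)) (w x t) < w x t / 2"
      using tendstoD[OF cont[unfolded isCont_def], of "w x t / 2"] by simp
    then obtain d where d: "0 < d" "\<And>p. p \<noteq> (x, t) \<Longrightarrow> dist p (x, t) < d \<Longrightarrow> dist (w (fst p) (snd p)) (w x t) < w x t / 2"
      unfolding eventually_at by blast
    define r where "r = min 1 (min (d / 2) ((t - \<tau>) / 2))"
    have r: "0 < r" "r \<le> 1" "r \<le> d / 2" "r < t - \<tau>"
      using d \<tau> by (auto simp: r_def min_less_iff_disj)
    define e where "e = r\<^sup>2"
    have e: "0 < e" "e \<le> r" "sqrt e = r" using r by (auto simp: e_def power2_eq_square mult_left_le)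
    have "ennreal (c * (w x t / 2)) \<le> (\<integral>\<^sup>+y. ennreal (heat_kernel (x - y) e * w y (t - e)) \<partial>lborel)"
    proof (rule c(2)[OF e(1)])
      fix y assume "y \<in> ball x (sqrt e)"
      then have y: "dist y x < r" using e by (simp add: dist_commute)
      have "dist (y, t - e) (x, t) \<le> dist y x + dist (t - e) t"
        unfolding dist_prod_def using sqrt_sum_squares_le_sum[of "dist y x" e] e by (simp add: dist_real_def)
      also have "\<dots> < d" using y e r by (auto simp: dist_real_def)
      finally have "dist (w y (t - e)) (w x t) < w x t / 2"
        using d(2)[of "(y, t - e)"] e by simp
      then show "w x t / 2 \<le> w y (t - e)" by (auto simp: dist_real_def abs_if split: if_splits)
    qed (use pos in simp)
    then show ?thesis using e r by (intro bexI[of _ "t - e"]) auto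
  qed
  then show thesis using c(1) by (intro that[of "c / 2"]) auto
qed

section \<open>Measure-theoretic tools\<close>

lemma emeasure_le_if_superlevel_le:
  fixes f :: "'a \<Rightarrow> real"
  assumes [measurable]: "f \<in> borel_measurable M" and pos: "AE x in M. 0 < f x"
    and superlevel_le: "0 < \<tau>0" "\<And>\<tau>. 0 < \<tau> \<Longrightarrow> \<tau> < \<tau>0 \<Longrightarrow> emeasure M {x \<in> space M. \<tau> < f x} \<le> B"
  shows "emeasure M (space M) \<le> B"
proof -
  have superlevel_bound: "emeasure M {x \<in> space M. \<tau> < f x} \<le> B" if \<tau>: "0 < \<tau>" for \<tau>
  proof -
    obtain \<tau>' where \<tau>': "0 < \<tau>'" "\<tau>' < min \<tau>0 \<tau>" using dense[of 0 "min \<tau>0 \<tau>"] \<tau> superlevel_le(1) by auto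
    then have "emeasure M {x \<in> space M. \<tau> < f x} \<le> emeasure M {x \<in> space M. \<tau>' < f x}"
      by (intro emeasure_mono) auto
    also have "\<dots> \<le> B" using \<tau>' by (intro superlevel_le(2)) auto
    finally show ?thesis .
  qed
  let ?A = "\<lambda>k. {x \<in> space M. 1 / Suc k < f x}"
  have "emeasure M (space M) = emeasure M {x \<in> space M. 0 < f x}"
    by (rule emeasure_eq_AE) (use pos in auto)
  also have "{x \<in> space M. 0 < f x} = (\<Union>k. ?A k)"
    using reals_Archimedean by (auto simp: inverse_eq_divide intro: less_trans[rotated])
  also have "emeasure M \<dots> = (SUP k. emeasure M (?A k))"
  proof (rule SUP_emeasure_incseq[symmetric])
    show "incseq ?A"
    proof (intro incseq_SucI Collect_mono impI conjI)
      fix k x assume "x \<in> space M \<and> 1 / Suc k < f x"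
      moreover have "1 / Suc (Suc k) \<le> 1 / Suc k" by (intro divide_left_mono) auto
      ultimately show "1 / Suc (Suc k) < f x" by linarith
    qed simp
  qed auto
  also have "\<dots> \<le> B" by (intro SUP_least superlevel_bound) simp
  finally show ?thesis .
qed

lemma emeasure_sublevel_small:
  fixes f :: "'a \<Rightarrow> real"
  assumes [measurable]: "f \<in> borel_measurable M" and pos: "AE x in M. 0 < f x"
    and fin: "emeasure M (space M) < \<infinity>" and "0 < \<epsilon>"
  obtains \<tau> where "0 < \<tau>" "emeasure M {x \<in> space M. f x < \<tau>} < \<epsilon>"
proof -
  let ?A = "\<lambda>k. {x \<in> space M. f x < 1 / Suc k}"
  have "(\<lambda>k. emeasure M (?A k)) \<longlonglongrightarrow> emeasure M (\<Inter>k. ?A k)"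
  proof (rule Lim_emeasure_decseq)
    show "decseq ?A"
    proof (intro decseq_SucI Collect_mono impI conjI)
      fix k x assume "x \<in> space M \<and> f x < 1 / Suc (Suc k)"
      moreover have "1 / Suc (Suc k) \<le> 1 / Suc k" by (intro divide_left_mono) auto
      ultimately show "f x < 1 / Suc k" by linarith
    qed simp
    show "emeasure M (?A k) \<noteq> \<infinity>" for k
      using fin emeasure_space[of M "?A k"] by (auto simp: less_top[symmetric] top_unique)
  qed auto
  moreover have "(\<Inter>k. ?A k) \<subseteq> {x \<in> space M. \<not> 0 < f x}"
  proof (intro subsetI CollectI conjI notI)
    fix x assume x: "x \<in> (\<Inter>k. ?A k)"
    then show "x \<in> space M" by auto
    assume "0 < f x"
    then obtain k where "inverse (real (Suc k)) < f x" using reals_Archimedean by blast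
    moreover have "f x < 1 / Suc k" using x by blast
    ultimately show False by (simp only: inverse_eq_divide)
  qed
  then have "emeasure M (\<Inter>k. ?A k) = 0"
    by (rule emeasure_eq_0[rotated 2]) (use pos in \<open>auto intro!: emeasure_eq_0_AE\<close>)
  ultimately have "\<forall>\<^sub>F k in sequentially. emeasure M (?A k) < \<epsilon>"
    using assms(4) by (intro order_tendstoD(2)) auto
  then obtain k where "emeasure M (?A k) < \<epsilon>" by (auto simp: eventually_sequentially)
  then show thesis by (intro that[of "1 / Suc k"]) auto
qed

lemma nn_integral_convolution:
  fixes k :: "'b::euclidean_space \<Rightarrow> ennreal"
  assumes [measurable]: "k \<in> borel_measurable borel" and [measurable_cong]: "sets M = sets borel"
    and M: "sigma_finite_measure M"
  shows "(\<lambda>z. \<integral>\<^sup>+w. k (z - w) \<partial>M) \<in> borel_measurable borel"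
    and "(\<integral>\<^sup>+z. (\<integral>\<^sup>+w. k (z - w) \<partial>M) \<partial>lborel) = (\<integral>\<^sup>+z. k z \<partial>lborel) * emeasure M (space M)"
proof -
  show "(\<lambda>z. \<integral>\<^sup>+w. k (z - w) \<partial>M) \<in> borel_measurable borel"
    by (rule sigma_finite_measure.borel_measurable_nn_integral[OF M]) measurable
  interpret pair_sigma_finite lborel M
    using M by (simp add: pair_sigma_finite_def lborel.sigma_finite_measure_axioms)
  have "(\<integral>\<^sup>+z. (\<integral>\<^sup>+w. k (z - w) \<partial>M) \<partial>lborel) = (\<integral>\<^sup>+w. (\<integral>\<^sup>+z. k (z - w) \<partial>lborel) \<partial>M)"
    by (rule Fubini'[symmetric]) measurable
  also have "\<dots> = (\<integral>\<^sup>+w. (\<integral>\<^sup>+z. k z \<partial>lborel) \<partial>M)"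
    by (simp add: nn_integral_lborel_translate)
  finally show "(\<integral>\<^sup>+z. (\<integral>\<^sup>+w. k (z - w) \<partial>M) \<partial>lborel) = (\<integral>\<^sup>+z. k z \<partial>lborel) * emeasure M (space M)"
    by simp
qed

lemma le_tangent_powr:
  fixes z m p :: real
  assumes "0 \<le> z" "0 < m" "1 \<le> p"
  shows "z \<le> (1 - 1 / p) * m + 1 / p * (m powr (1 - p) * z powr p)"
proof (cases "z = 0")
  case False
  then have "m powr (1 - 1 / p) * (m powr (1 - p) * z powr p) powr (1 / p)
      \<le> (1 - 1 / p) * m + 1 / p * (m powr (1 - p) * z powr p)"
    using assms by (intro Youngs_inequality_0) auto
  also have "m powr (1 - 1 / p) * (m powr (1 - p) * z powr p) powr (1 / p) = m powr (1 - 1 / p + (1 - p) / p) * z"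
    using assms False by (simp add: powr_mult powr_powr powr_add)
  also have "1 - 1 / p + (1 - p) / p = 0" using assms by (simp add: field_simps)
  finally show ?thesis using assms by simp
qed (use assms in simp)

lemma nn_integral_Holder_finite_measure:
  fixes f :: "'b \<Rightarrow> real"
  assumes [measurable]: "f \<in> borel_measurable M" and f: "\<And>x. 0 \<le> f x" and p: "1 \<le> p"
    and A: "0 < A" "emeasure M (space M) \<le> ennreal A"
    and j: "0 < j" "(\<integral>\<^sup>+x. ennreal (f x powr p) \<partial>M) \<le> ennreal j"
  shows "(\<integral>\<^sup>+x. ennreal (f x) \<partial>M) \<le> ennreal (A powr (1 - 1 / p) * j powr (1 / p))"
proof -
  define m where "m = (j / A) powr (1 / p)"
  have m: "0 < m" using A j by (simp add: m_def)
  let ?a = "(1 - 1 / p) * m" and ?b = "1 / p * m powr (1 - p)"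
  have ab: "0 \<le> ?a" "0 \<le> ?b" using m p by auto
  have "(\<integral>\<^sup>+x. ennreal (f x) \<partial>M) \<le> (\<integral>\<^sup>+x. ennreal ?a + ennreal ?b * ennreal (f x powr p) \<partial>M)"
  proof (rule nn_integral_mono)
    fix x
    have "f x \<le> ?a + ?b * f x powr p" using le_tangent_powr[OF f m p] by (simp add: mult.assoc)
    then have "ennreal (f x) \<le> ennreal (?a + ?b * f x powr p)" by (rule ennreal_leI)
    also have "\<dots> = ennreal ?a + ennreal ?b * ennreal (f x powr p)"
      using ab by (simp only: ennreal_plus ennreal_mult powr_ge_zero mult_nonneg_nonneg)
    finally show "ennreal (f x) \<le> ennreal ?a + ennreal ?b * ennreal (f x powr p)" .
  qed
  also have "\<dots> = ennreal ?a * emeasure M (space M) + ennreal ?b * (\<integral>\<^sup>+x. ennreal (f x powr p) \<partial>M)"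
    by (simp add: nn_integral_add nn_integral_cmult)
  also have "\<dots> \<le> ennreal ?a * ennreal A + ennreal ?b * ennreal j"
    by (intro add_mono mult_left_mono A j) auto
  also have "\<dots> = ennreal (?a * A + ?b * j)"
    using ab A(1) j(1) by (simp only: ennreal_plus ennreal_mult mult_nonneg_nonneg less_imp_le)
  also have "?a * A + ?b * j = (1 - 1 / p) * (m * A) + 1 / p * (m powr (1 - p) * j)"
    by (simp only: mult.assoc)
  also have "m * A = A powr (1 - 1 / p) * j powr (1 / p)"
    using A j by (simp add: m_def powr_divide powr_diff)
  also have "m powr (1 - p) * j = A powr (1 - 1 / p) * j powr (1 / p)"
  proof -
    have "(1 - p) / p = 1 / p - 1" using p by (simp add: field_simps)
    then have "m powr (1 - p) = (j / A) powr (1 / p - 1)" by (simp add: m_def powr_powr)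
    then show ?thesis using A j by (simp add: powr_divide powr_diff)
  qed
  also have "(1 - 1 / p) * (A powr (1 - 1 / p) * j powr (1 / p)) + 1 / p * (A powr (1 - 1 / p) * j powr (1 / p))
      = A powr (1 - 1 / p) * j powr (1 / p)"
    by (simp add: algebra_simps)
  finally show ?thesis .
qed

lemma powr_le_if_le_two_integrals:
  fixes f :: "'b \<Rightarrow> real" and g :: "'c \<Rightarrow> real"
  assumes f: "f \<in> borel_measurable M" "\<And>x. 0 \<le> f x" and g: "g \<in> borel_measurable N" "\<And>x. 0 \<le> g x"
    and A: "0 < A" "emeasure M (space M) \<le> ennreal A" "emeasure N (space N) \<le> ennreal A"
    and "0 < C" "1 \<le> p" "0 \<le> v"
    and v: "ennreal v \<le> ennreal C * (1 + (\<integral>\<^sup>+x. ennreal (f x) \<partial>M) + (\<integral>\<^sup>+x. ennreal (g x) \<partial>N))"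
  shows "ennreal (v powr p) \<le> ennreal ((C * (1 + 2 * A powr (1 - 1 / p))) powr p)
    * (1 + ((\<integral>\<^sup>+x. ennreal (f x powr p) \<partial>M) + (\<integral>\<^sup>+x. ennreal (g x powr p) \<partial>N)))"
    (is "_ \<le> _ * (1 + ?J)")
proof (cases ?J)
  case (real j)
  define A' where "A' = A powr (1 - 1 / p)"
  have A': "0 < 1 + 2 * A'" by (simp add: A'_def add_pos_nonneg)
  define r where "r = (1 + j) powr (1 / p)"
  have r: "1 \<le> r" using real assms(9) by (simp add: r_def ge_one_powr_ge_zero)
  have "(\<integral>\<^sup>+x. ennreal (f x powr p) \<partial>M) \<le> ?J" "(\<integral>\<^sup>+x. ennreal (g x powr p) \<partial>N) \<le> ?J" by auto
  then have "(\<integral>\<^sup>+x. ennreal (f x powr p) \<partial>M) \<le> ennreal (1 + j)" "(\<integral>\<^sup>+x. ennreal (g x powr p) \<partial>N) \<le> ennreal (1 + j)"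
    using real by (auto intro: order_trans ennreal_leI)
  then have "(\<integral>\<^sup>+x. ennreal (f x) \<partial>M) \<le> ennreal (A' * r)" "(\<integral>\<^sup>+x. ennreal (g x) \<partial>N) \<le> ennreal (A' * r)"
    unfolding A'_def r_def using real
    by (auto intro!: nn_integral_Holder_finite_measure f g assms)
  then have "ennreal v \<le> ennreal C * (ennreal r + ennreal (A' * r) + ennreal (A' * r))"
    using r by (intro order_trans[OF v] mult_left_mono add_mono) auto
  also have "\<dots> = ennreal (C * (1 + 2 * A') * r)"
    using r assms(8) by (simp add: A'_def distrib_left distrib_right flip: ennreal_mult ennreal_plus)
  finally have "v \<le> C * (1 + 2 * A') * r"
    using r assms(8) by (subst (asm) ennreal_le_iff) (auto simp: A'_def)
  then have "v powr p \<le> (C * (1 + 2 * A') * r) powr p" using assms by (intro powr_mono2) auto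
  also have "\<dots> = (C * (1 + 2 * A')) powr p * (1 + j)"
    using assms(8,9) real A' by (simp add: powr_mult r_def powr_powr)
  finally have "ennreal (v powr p) \<le> ennreal ((C * (1 + 2 * A')) powr p * (1 + j))" by (rule ennreal_leI)
  also have "\<dots> = ennreal ((C * (1 + 2 * A')) powr p) * (1 + ?J)"
    using real by (simp add: ennreal_mult')
  finally show ?thesis by (simp add: A'_def)
next
  case top
  have "0 < 1 + 2 * A powr (1 - 1 / p)" by (simp add: add_pos_nonneg)
  then have "0 < (C * (1 + 2 * A powr (1 - 1 / p))) powr p" using assms(8) by simp
  then show ?thesis unfolding top by (simp add: ennreal_mult_top)
qed

lemma ennreal_le_multI_if_mult_le_add:
  fixes X Y :: ennreal
  assumes "0 < c" "0 \<le> v" "0 \<le> d" and mult_le: "ennreal (c * v) \<le> X + Y + ennreal d"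
  shows "ennreal v \<le> ennreal ((1 + d) / c) * (1 + X + Y)"
proof -
  have "ennreal v = ennreal (1 / c) * ennreal (c * v)"
    using assms by (simp flip: ennreal_mult)
  also have "\<dots> \<le> ennreal (1 / c) * (ennreal (1 + d) * (1 + X + Y))"
  proof (rule mult_left_mono)
    have "X + Y \<le> ennreal (1 + d) * (X + Y)"
      using mult_right_mono[of 1 "ennreal (1 + d)" "X + Y"] assms(3) by simp
    moreover have "ennreal d \<le> ennreal (1 + d)" by (intro ennreal_leI) auto
    ultimately have "X + Y + ennreal d \<le> ennreal (1 + d) * (X + Y) + ennreal (1 + d)" by (rule add_mono)
    also have "\<dots> = ennreal (1 + d) * (1 + X + Y)" by (simp only: distrib_left mult_1_right add_ac)
    finally show "ennreal (c * v) \<le> ennreal (1 + d) * (1 + X + Y)" by (rule order_trans[OF mult_le])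
  qed simp
  also have "\<dots> = ennreal (1 / c) * ennreal (1 + d) * (1 + X + Y)" by (simp only: mult.assoc)
  also have "ennreal (1 / c) * ennreal (1 + d) = ennreal ((1 + d) / c)"
    using assms by (subst ennreal_mult[symmetric]) auto
  finally show ?thesis .
qed

section \<open>Heat potentials\<close>

definition heat_potential :: "('a::euclidean_space \<times> real) measure \<Rightarrow> 'a \<Rightarrow> real \<Rightarrow> ennreal" where
  "heat_potential M x t = (\<integral>\<^sup>+p. ennreal (heat_kernel (x - fst p) (t - snd p)) \<partial>M)"

lemma borel_measurable_heat_kernel_reversed [measurable]:
  "(\<lambda>p. heat_kernel (x - fst p) (t - snd p)) \<in> borel_measurable (borel :: ('a::euclidean_space \<times> real) measure)"
  unfolding heat_kernel_def borel_prod[symmetric] by measurable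

lemma nn_integral_heat_kernel_powr_eq_truncated:
  assumes "AE q in M. 0 < snd q" "t < T"
  shows "(\<integral>\<^sup>+q. ennreal (heat_kernel (x - fst q) (t - snd q) powr \<beta>) \<partial>M) = (\<integral>\<^sup>+q. truncated_kernel \<beta> T ((x, t) - q) \<partial>M)"
  by (rule nn_integral_cong_AE)
    (use assms in \<open>auto elim!: eventually_mono simp: truncated_kernel_def indicator_def mem_Times_iff\<close>)

lemma heat_potential_density:
  assumes "h \<in> borel_measurable borel"
  shows "heat_potential (density lborel h) x t = (\<integral>\<^sup>+p. h p * ennreal (heat_kernel (x - fst p) (t - snd p)) \<partial>lborel)"
  using assms unfolding heat_potential_def by (intro nn_integral_density) auto

lemma heat_potential_density_cong:
  assumes "h \<in> borel_measurable borel" "h' \<in> borel_measurable borel" "\<And>y s. s < t \<Longrightarrow> h (y, s) = h' (y, s)"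
  shows "heat_potential (density lborel h) x t = heat_potential (density lborel h') x t"
proof -
  have "h p * ennreal (heat_kernel (x - fst p) (t - snd p)) = h' p * ennreal (heat_kernel (x - fst p) (t - snd p))" for p
    using assms(3)[of "snd p" "fst p"] by (cases "snd p < t") auto
  then show ?thesis by (simp only: heat_potential_density assms(1,2))
qed

lemma heat_potential_near_far:
  obtains C where "0 < C" and "\<And>h (x::'a::euclidean_space) t \<delta> B \<epsilon>. h \<in> borel_measurable borel \<Longrightarrow> 0 < \<delta> \<Longrightarrow> 0 \<le> B \<Longrightarrow> 0 \<le> \<epsilon> \<Longrightarrow>
    (\<And>y s. norm (x - y) < \<delta> \<Longrightarrow> s < t \<Longrightarrow> t - s < \<delta>\<^sup>2 \<Longrightarrow> h (y, s) \<le> ennreal B) \<Longrightarrow>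
    (\<integral>\<^sup>+p. h p \<partial>lborel) \<le> ennreal \<epsilon> \<Longrightarrow>
    heat_potential (density lborel h) x t \<le> ennreal (B * \<delta>\<^sup>2 + C * \<delta> powr (- real DIM('a)) * \<epsilon>)"
proof -
  let ?n = "real DIM('a)"
  obtain C where C: "0 < C" "\<And>\<rho> (x::'a) s. 0 < \<rho> \<Longrightarrow> \<rho> \<le> norm x \<or> \<rho>\<^sup>2 \<le> s \<Longrightarrow> heat_kernel x s \<le> C * \<rho> powr (- ?n)"
    by (rule heat_kernel_off_diagonal) blast
  have "heat_potential (density lborel h) x t \<le> ennreal (B * \<delta>\<^sup>2 + C * \<delta> powr (- ?n) * \<epsilon>)"
    if [measurable]: "h \<in> borel_measurable borel" and \<delta>: "0 < \<delta>" and bounds_nonneg: "0 \<le> B" "0 \<le> \<epsilon>"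
      and near: "\<And>y s. norm (x - y) < \<delta> \<Longrightarrow> s < t \<Longrightarrow> t - s < \<delta>\<^sup>2 \<Longrightarrow> h (y, s) \<le> ennreal B"
      and mass: "(\<integral>\<^sup>+p. h p \<partial>lborel) \<le> ennreal \<epsilon>"
    for h and x :: 'a and t \<delta> B \<epsilon>
  proof -
    let ?k = "truncated_kernel 1 (\<delta>\<^sup>2) :: 'a \<times> real \<Rightarrow> ennreal"
    have "h p * ennreal (heat_kernel (x - fst p) (t - snd p)) \<le> ennreal B * ?k ((x, t) - p) + ennreal (C * \<delta> powr (- ?n)) * h p" for p
    proof (cases "norm (x - fst p) < \<delta> \<and> 0 < t - snd p \<and> t - snd p < \<delta>\<^sup>2")
      case True
      then have "h p * ennreal (heat_kernel (x - fst p) (t - snd p)) \<le> ennreal B * ?k ((x, t) - p)"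
        using near[of "fst p" "snd p"] by (simp add: truncated_kernel_def mult_right_mono indicator_def mem_Times_iff)
      then show ?thesis by (rule order_trans) simp
    next
      case False
      then have "heat_kernel (x - fst p) (t - snd p) \<le> C * \<delta> powr (- ?n)"
        using C(2)[OF \<delta>, of "x - fst p" "t - snd p"] C(1) by (cases "0 < t - snd p") auto
      then have "h p * ennreal (heat_kernel (x - fst p) (t - snd p)) \<le> ennreal (C * \<delta> powr (- ?n)) * h p"
        by (subst mult.commute) (intro mult_right_mono ennreal_leI, auto)
      then show ?thesis by (rule order_trans) simp
    qed
    then have "heat_potential (density lborel h) x t
        \<le> (\<integral>\<^sup>+p. ennreal B * ?k ((x, t) - p) + ennreal (C * \<delta> powr (- ?n)) * h p \<partial>lborel)"
      by (simp add: heat_potential_density nn_integral_mono)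
    also have "\<dots> = ennreal B * (\<integral>\<^sup>+p. ?k p \<partial>lborel) + ennreal (C * \<delta> powr (- ?n)) * (\<integral>\<^sup>+p. h p \<partial>lborel)"
      by (simp add: nn_integral_add nn_integral_cmult nn_integral_lborel_reflect)
    also have "\<dots> \<le> ennreal B * ennreal (\<delta>\<^sup>2) + ennreal (C * \<delta> powr (- ?n)) * ennreal \<epsilon>"
      by (intro add_mono mult_left_mono mass eq_refl[OF nn_integral_truncated_kernel_1]) auto
    also have "\<dots> = ennreal (B * \<delta>\<^sup>2 + C * \<delta> powr (- ?n) * \<epsilon>)"
      using bounds_nonneg C(1) by (simp add: ennreal_mult')
    finally show ?thesis .
  qed
  then show thesis using C(1) that by blast
qed

lemma truncated_kernel_convolution_finite_measure:
  fixes M :: "('a::euclidean_space \<times> real) measure"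
  assumes M: "sets M = sets borel" "emeasure M UNIV \<le> ennreal A"
  shows "(\<lambda>z. \<integral>\<^sup>+q. truncated_kernel p T' (z - q) \<partial>M) \<in> borel_measurable borel"
    and "(\<integral>\<^sup>+z. (\<integral>\<^sup>+q. truncated_kernel p T' (z - q) \<partial>M) \<partial>lborel)
      \<le> (\<integral>\<^sup>+z. truncated_kernel p T' (z :: 'a \<times> real) \<partial>lborel) * ennreal A"
proof -
  have space: "space M = UNIV" using sets_eq_imp_space_eq[OF M(1)] by simp
  have "finite_measure M"
    using M(2) by (intro finite_measureI) (auto simp: space top_unique)
  then have sigma: "sigma_finite_measure M" by (simp add: finite_measure_def)
  note convolution = nn_integral_convolution[OF borel_measurable_truncated_kernel M(1) sigma]
  show "(\<lambda>z. \<integral>\<^sup>+q. truncated_kernel p T' (z - q) \<partial>M) \<in> borel_measurable borel"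
    by (rule convolution(1))
  show "(\<integral>\<^sup>+z. (\<integral>\<^sup>+q. truncated_kernel p T' (z - q) \<partial>M) \<partial>lborel)
      \<le> (\<integral>\<^sup>+z. truncated_kernel p T' (z :: 'a \<times> real) \<partial>lborel) * ennreal A"
    unfolding convolution(2) space using M(2) by (rule mult_left_mono) simp
qed

section \<open>Nonnegative supersolutions\<close>

lemma borel_cylinder: "cball (a::'a::euclidean_space) r \<times> {0<..<\<tau>::real} \<in> sets borel"
  by (simp add: borel_prod[symmetric])

locale heat_supersolution =
  fixes u :: "'a::euclidean_space \<Rightarrow> real \<Rightarrow> real" and R T :: real
  assumes nonneg: "\<And>x t. 0 < t \<Longrightarrow> t < T \<Longrightarrow> 0 \<le> u x t"
    and reg: "C21 u (UNIV \<times> {0<..<T})"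
    and heat_op_nonneg: "\<And>x t. x \<in> ball 0 R \<Longrightarrow> 0 < t \<Longrightarrow> t < T \<Longrightarrow> 0 \<le> heat_op u x t"
begin

definition trace_density :: "real \<Rightarrow> real \<Rightarrow> 'a \<Rightarrow> ennreal" where
  "trace_density r s y = ennreal (u y s) * indicator (cball 0 r) y"

definition trace_measure :: "real \<Rightarrow> real \<Rightarrow> ('a \<times> real) measure" where
  "trace_measure r s = distr (density lborel (trace_density r s)) borel (\<lambda>y. (y, s))"

definition source_density :: "real \<Rightarrow> real \<Rightarrow> 'a \<times> real \<Rightarrow> ennreal" where
  "source_density r \<tau> p = ennreal (heat_op u (fst p) (snd p)) * indicator (cball 0 r \<times> {0<..<\<tau>}) p"

definition source_measure :: "real \<Rightarrow> real \<Rightarrow> ('a \<times> real) measure" where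
  "source_measure r \<tau> = density lborel (source_density r \<tau>)"

lemma borel_measurable_source_density:
  assumes "\<tau> \<le> T"
  shows "source_density r \<tau> \<in> borel_measurable borel"
  unfolding source_density_def
  by (rule borel_measurable_restrict_continuous[OF continuous_on_subset[OF C21_continuous_on(6)[OF reg]] borel_cylinder])
    (use assms in auto)

lemma borel_measurable_trace_density:
  assumes "0 < s" "s < T"
  shows "trace_density r s \<in> borel_measurable borel"
  unfolding trace_density_def
  by (rule borel_measurable_restrict_continuous, rule continuous_on_subset[OF continuous_on_slices(1)[OF C21_continuous_on(1)[OF reg]]])
    (use assms in auto)

lemma borel_measurable_powr_on_cylinder:
  assumes "\<tau> \<le> T"
  shows "(\<lambda>p. ennreal (u (fst p) (snd p) powr q) * indicator (cball 0 r \<times> {0<..<\<tau>}) p) \<in> borel_measurable borel"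
proof -
  let ?S = "cball (0::'a) r \<times> {0<..<\<tau>}"
  have "(\<lambda>p. indicator ?S p *\<^sub>R u (fst p) (snd p)) \<in> borel_measurable borel"
    by (rule borel_measurable_continuous_on_indicator[OF borel_cylinder continuous_on_subset[OF C21_continuous_on(1)[OF reg]]])
      (use assms in auto)
  then have "(\<lambda>p. ennreal ((indicator ?S p *\<^sub>R u (fst p) (snd p)) powr q)) \<in> borel_measurable borel"
    by measurable
  moreover have "(\<lambda>p. ennreal ((indicator ?S p *\<^sub>R u (fst p) (snd p)) powr q))
     = (\<lambda>p. ennreal (u (fst p) (snd p) powr q) * indicator ?S p)"
    by (auto simp: indicator_def)
  ultimately show ?thesis by (simp only:)
qed

lemma sets_trace_measure [simp]: "sets (trace_measure r s) = sets borel"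
  and space_trace_measure [simp]: "space (trace_measure r s) = UNIV"
  by (simp_all add: trace_measure_def)

lemma sets_source_measure [simp]: "sets (source_measure r \<tau>) = sets borel"
  and space_source_measure [simp]: "space (source_measure r \<tau>) = UNIV"
  by (simp_all add: source_measure_def)

lemma nn_integral_trace_measure:
  assumes "0 < s" "s < T" and [measurable]: "f \<in> borel_measurable borel"
  shows "(\<integral>\<^sup>+p. f p \<partial>trace_measure r s) = (\<integral>\<^sup>+y. trace_density r s y * f (y, s) \<partial>lborel)"
proof -
  note [measurable] = borel_measurable_trace_density[OF assms(1,2)]
  have [measurable]: "(\<lambda>y. (y, s)) \<in> borel \<rightarrow>\<^sub>M (borel :: ('a \<times> real) measure)"
    by (intro borel_measurable_continuous_onI continuous_intros)
  show ?thesis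
    unfolding trace_measure_def by (simp add: nn_integral_distr nn_integral_density)
qed

lemma emeasure_trace_measure:
  assumes "0 < s" "s < T"
  shows "emeasure (trace_measure r s) UNIV = (\<integral>\<^sup>+y\<in>cball 0 r. ennreal (u y s) \<partial>lborel)"
  using nn_integral_trace_measure[OF assms, of "\<lambda>_. 1" r] by (simp add: trace_density_def)

lemma AE_trace_measure_time:
  assumes "0 < s" "s < T"
  shows "AE p in trace_measure r s. snd p = s"
proof -
  have "(\<lambda>y. (y, s)) \<in> borel \<rightarrow>\<^sub>M (borel :: ('a \<times> real) measure)"
    by (intro borel_measurable_continuous_onI continuous_intros)
  moreover have "{p::'a \<times> real. snd p = s} \<in> sets borel"
    by (intro borel_closed closed_Collect_eq continuous_intros)
  ultimately show ?thesis
    unfolding trace_measure_def by (subst AE_distr_iff) auto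
qed

lemma AE_source_measure_time:
  assumes "\<tau> \<le> T"
  shows "AE p in source_measure r \<tau>. snd p \<in> {0<..<\<tau>}"
  unfolding source_measure_def
  using borel_measurable_source_density[OF assms] by (subst AE_density) (auto simp: source_density_def indicator_def)

definition masses_le :: "real \<Rightarrow> real \<Rightarrow> real \<Rightarrow> bool" where
  "masses_le r \<tau> A \<longleftrightarrow> (\<forall>s. 0 < s \<longrightarrow> s \<le> \<tau> \<longrightarrow> emeasure (trace_measure r s) UNIV \<le> ennreal A)
    \<and> emeasure (source_measure r \<tau>) UNIV \<le> ennreal A"

lemma masses_leD:
  assumes "masses_le r \<tau> A"
  shows "0 < s \<Longrightarrow> s \<le> \<tau> \<Longrightarrow> emeasure (trace_measure r s) UNIV \<le> ennreal A"
    and "emeasure (source_measure r \<tau>) UNIV \<le> ennreal A"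
  using assms by (auto simp: masses_le_def)

lemma trace_mass_le_pairing:
  assumes s: "0 < s" "s < T" and \<psi>: "\<And>x. 0 \<le> \<psi> x s" "\<And>x. norm x \<le> r \<Longrightarrow> 1 \<le> \<psi> x s"
  shows "emeasure (trace_measure r s) UNIV \<le> nn_slice_pairing \<psi> u s"
  unfolding emeasure_trace_measure[OF s] nn_slice_pairing_def
proof (rule nn_integral_mono)
  fix y
  show "ennreal (u y s) * indicator (cball 0 r) y \<le> ennreal (\<psi> y s * u y s)"
    using mult_right_mono[OF \<psi>(2)[of y], of "u y s"] nonneg[OF s, of y] by (auto simp: indicator_def intro!: ennreal_leI)
qed

lemma late_source_mass_le_pairing:
  assumes r: "r < R" and s: "0 < s" "\<tau> < T" and \<psi>: "\<And>x s. norm x \<le> r \<Longrightarrow> 0 \<le> s \<Longrightarrow> 1 \<le> \<psi> x s"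
  shows "emeasure (source_measure r \<tau>) {p. s < snd p}
    \<le> nn_strip_pairing \<psi> (heat_op u) s \<tau>"
proof -
  have "{p::'a \<times> real. s < snd p} \<in> sets borel"
    by (intro borel_open open_Collect_less continuous_intros)
  then have "emeasure (source_measure r \<tau>) {p. s < snd p} = (\<integral>\<^sup>+p\<in>{p. s < snd p}. source_density r \<tau> p \<partial>lborel)"
    unfolding source_measure_def using borel_measurable_source_density[of \<tau> r] s by (subst emeasure_density) auto
  also have "\<dots> \<le> nn_strip_pairing \<psi> (heat_op u) s \<tau>"
    unfolding nn_strip_pairing_def
  proof (rule nn_integral_mono)
    fix p :: "'a \<times> real"
    show "source_density r \<tau> p * indicator {p. s < snd p} p
        \<le> ennreal (\<psi> (fst p) (snd p) * heat_op u (fst p) (snd p)) * indicator (UNIV \<times> {s..\<tau>}) p"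
      using mult_right_mono[OF \<psi>[of "fst p" "snd p"], of "heat_op u (fst p) (snd p)"]
        heat_op_nonneg[of "fst p" "snd p"] r s
      by (cases p) (auto simp: source_density_def indicator_def intro!: ennreal_leI)
  qed
  finally show ?thesis .
qed

lemma bump_pairing_bounded:
  assumes r: "0 \<le> r" "r < R" and \<tau>: "0 < \<tau>" "\<tau> < T"
  obtains \<psi> A where "0 < A" "\<And>x s. 0 \<le> \<psi> x s" "\<And>x s. norm x \<le> r \<Longrightarrow> 0 \<le> s \<Longrightarrow> 1 \<le> \<psi> x s"
    "\<And>s. 0 < s \<Longrightarrow> s \<le> \<tau> \<Longrightarrow> nn_slice_pairing \<psi> u s + nn_strip_pairing \<psi> (heat_op u) s \<tau> \<le> ennreal A"
proof -
  obtain \<rho> where \<rho>: "r < \<rho>" "\<rho> < R" using dense[OF r(2)] by blast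
  obtain \<psi> :: "'a \<Rightarrow> real \<Rightarrow> real" where \<psi>: "C21 \<psi> (UNIV \<times> UNIV)" "\<And>x s. 0 \<le> \<psi> x s"
    "\<And>x s. \<rho> \<le> norm x \<Longrightarrow> \<psi> x s = 0" "\<And>x s. norm x \<le> r \<Longrightarrow> 0 \<le> s \<Longrightarrow> 1 \<le> \<psi> x s"
    "\<And>x s. 0 \<le> adjoint_heat_op \<psi> x s"
    by (rule adjoint_subcaloric_bump[OF r(1) \<rho>(1)]) blast
  interpret nonneg_pairing \<psi> u "{0<..<T}" \<rho>
    by unfold_locales (use \<psi> \<rho> nonneg reg heat_op_nonneg in \<open>auto intro: C21_subset\<close>)
  define A where "A = slice_pairing \<psi> u \<tau> + 1"
  have "nn_slice_pairing \<psi> u s + nn_strip_pairing \<psi> (heat_op u) s \<tau> \<le> ennreal A"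
    if s: "0 < s" "s \<le> \<tau>" for s
  proof -
    have "{s..\<tau>} \<subseteq> {0<..<T}" using s \<tau> by auto
    from pairing_mono[OF s(2) this \<psi>(5)] show ?thesis
      using nn_slice_pairing_eq[of \<tau>] \<tau> by (simp add: A_def order_trans[OF _ ennreal_leI])
  qed
  moreover have "0 < A" using pairing_nonneg(1)[of \<tau> \<tau>] \<tau> by (simp add: A_def)
  ultimately show thesis using \<psi>(2,4) that by blast
qed

lemma mass_bounds:
  assumes r: "0 \<le> r" "r < R" and \<tau>: "0 < \<tau>" "\<tau> < T"
  obtains A where "0 < A" "masses_le r \<tau> A"
proof -
  obtain \<psi> A where A: "0 < A" and \<psi>: "\<And>x s. 0 \<le> \<psi> x s" "\<And>x s. norm x \<le> r \<Longrightarrow> 0 \<le> s \<Longrightarrow> 1 \<le> \<psi> x s"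
    and total: "\<And>s. 0 < s \<Longrightarrow> s \<le> \<tau> \<Longrightarrow> nn_slice_pairing \<psi> u s + nn_strip_pairing \<psi> (heat_op u) s \<tau> \<le> ennreal A"
    by (rule bump_pairing_bounded[OF assms]) blast
  show thesis
  proof (rule that[OF A], unfold masses_le_def, intro conjI allI impI)
    show "emeasure (trace_measure r s) UNIV \<le> ennreal A" if s: "0 < s" "s \<le> \<tau>" for s
    proof -
      have "emeasure (trace_measure r s) UNIV \<le> nn_slice_pairing \<psi> u s"
        by (rule trace_mass_le_pairing) (use s \<tau> \<psi> in auto)
      also have "\<dots> \<le> ennreal A" by (rule order_trans[OF _ total[OF s]]) simp
      finally show ?thesis .
    qed
    have "emeasure (source_measure r \<tau>) (space (source_measure r \<tau>)) \<le> ennreal A"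
    proof (rule emeasure_le_if_superlevel_le[where f=snd, OF _ _ \<tau>(1)])
      show "snd \<in> borel_measurable (source_measure r \<tau>)"
        by (subst measurable_cong_sets[OF sets_source_measure refl]) (simp add: borel_prod[symmetric])
      show "AE p in source_measure r \<tau>. 0 < snd p"
        using AE_source_measure_time[of \<tau> r] \<tau> by auto
      fix s assume s: "0 < s" "s < \<tau>"
      have "emeasure (source_measure r \<tau>) {p. s < snd p}
          \<le> nn_strip_pairing \<psi> (heat_op u) s \<tau>"
        by (rule late_source_mass_le_pairing) (use r s \<tau> \<psi> in auto)
      also have "\<dots> \<le> ennreal A" using s by (intro order_trans[OF _ total[of s]]) auto
      finally show "emeasure (source_measure r \<tau>) {p \<in> space (source_measure r \<tau>). s < snd p} \<le> ennreal A" by simp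
    qed
    then show "emeasure (source_measure r \<tau>) UNIV \<le> ennreal A" by simp
  qed
qed

lemma cutoff_trace_le_heat_potential:
  assumes \<tau>: "0 < \<tau>" "\<tau> < T" and \<phi>: "cutoff r \<rho> \<phi>"
  shows "nn_slice_pairing (cutoff_kernel \<phi> x t) u \<tau> \<le> heat_potential (trace_measure \<rho> \<tau>) x t"
proof -
  have "ennreal (heat_kernel (x - y) (t - \<tau>) * \<phi> y * u y \<tau>) \<le> trace_density \<rho> \<tau> y * ennreal (heat_kernel (x - y) (t - \<tau>))" for y
  proof (cases "norm y \<le> \<rho>")
    case True
    have "heat_kernel (x - y) (t - \<tau>) * \<phi> y * u y \<tau> \<le> heat_kernel (x - y) (t - \<tau>) * 1 * u y \<tau>"
      using cutoffD(2,3)[OF \<phi>, of y] nonneg[OF \<tau>, of y] by (intro mult_right_mono mult_left_mono) auto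
    then show ?thesis using True nonneg[OF \<tau>, of y]
      by (simp add: trace_density_def ennreal_leI mult.commute flip: ennreal_mult)
  qed (use cutoffD(5)[OF \<phi>] in auto)
  then show ?thesis
    unfolding heat_potential_def nn_slice_pairing_def cutoff_kernel_def using \<tau>
    by (subst nn_integral_trace_measure) (auto intro!: nn_integral_mono)
qed

lemma cutoff_source_le_heat_potential:
  assumes "\<rho> < R" and \<tau>: "0 < \<tau>" "s < T'" "T' < T" and \<phi>: "cutoff r \<rho> \<phi>"
  shows "nn_strip_pairing (cutoff_kernel \<phi> x t) (heat_op u) \<tau> s
    \<le> heat_potential (source_measure \<rho> T') x t"
  unfolding source_measure_def heat_potential_density[OF borel_measurable_source_density[OF less_imp_le[OF \<tau>(3)]]]
    nn_strip_pairing_def cutoff_kernel_def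
proof (rule nn_integral_mono)
  fix p :: "'a \<times> real"
  let ?K = "heat_kernel (x - fst p) (t - snd p)"
  show "ennreal (?K * \<phi> (fst p) * heat_op u (fst p) (snd p)) * indicator (UNIV \<times> {\<tau>..s}) p
      \<le> source_density \<rho> T' p * ennreal ?K"
  proof (cases "p \<in> cball 0 \<rho> \<times> {\<tau>..s}")
    case True
    then have p: "norm (fst p) \<le> \<rho>" "\<tau> \<le> snd p" "snd p \<le> s" by (auto simp: mem_Times_iff)
    then have source: "0 \<le> heat_op u (fst p) (snd p)" using assms(1) \<tau> by (intro heat_op_nonneg) auto
    have "?K * \<phi> (fst p) * heat_op u (fst p) (snd p) \<le> ?K * 1 * heat_op u (fst p) (snd p)"
      using cutoffD(2,3)[OF \<phi>, of "fst p"] source by (intro mult_right_mono mult_left_mono) auto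
    then show ?thesis using p source \<tau>
      by (simp add: source_density_def indicator_def mem_Times_iff ennreal_leI mult.commute flip: ennreal_mult)
  qed (use cutoffD(5)[OF \<phi>, of "fst p"] in \<open>auto simp: indicator_def mem_Times_iff\<close>)
qed

lemma cutoff_pairing_le_heat_potentials:
  assumes \<rho>: "\<rho> < R" and \<tau>: "0 < \<tau>" "\<tau> \<le> s" "s < t" "t \<le> T'" "T' < T"
    and \<phi>: "cutoff r \<rho> \<phi>"
    and E: "0 \<le> E" "\<And>y s. s < t \<Longrightarrow> adjoint_heat_op (cutoff_kernel \<phi> x t) y s \<le> E"
    and A: "0 \<le> A" "masses_le \<rho> T' A"
  shows "nn_slice_pairing (cutoff_kernel \<phi> x t) u s
    \<le> heat_potential (trace_measure \<rho> \<tau>) x t + heat_potential (source_measure \<rho> T') x t + ennreal (E * A * T')"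
proof -
  interpret nonneg_pairing "cutoff_kernel \<phi> x t" u "{0<..<t}" \<rho>
  proof unfold_locales
    show "C21 (cutoff_kernel \<phi> x t) (UNIV \<times> {0<..<t})"
      by (rule C21_subset[OF C21_cutoff_kernel[OF cutoffD(1)[OF \<phi>]]]) auto
  qed (use cutoffD[OF \<phi>] \<rho> \<tau> nonneg reg heat_op_nonneg in \<open>auto simp: cutoff_kernel_def intro: C21_subset\<close>)
  have mass: "(\<integral>\<^sup>+y\<in>cball 0 \<rho>. ennreal (u y s) \<partial>lborel) \<le> ennreal A" if "0 < s" "s \<le> T'" for s
    using masses_leD(1)[OF A(2) that] emeasure_trace_measure[of s \<rho>] that \<tau> by simp
  have "nn_slice_pairing (cutoff_kernel \<phi> x t) u s \<le> nn_slice_pairing (cutoff_kernel \<phi> x t) u \<tau>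
      + nn_strip_pairing (cutoff_kernel \<phi> x t) (heat_op u) \<tau> s + ennreal (E * A * (s - \<tau>))"
    by (rule pairing_growth) (use \<tau> A(1) mass E in auto)
  also have "\<dots> \<le> heat_potential (trace_measure \<rho> \<tau>) x t + heat_potential (source_measure \<rho> T') x t + ennreal (E * A * T')"
    by (intro add_mono ennreal_leI mult_left_mono cutoff_trace_le_heat_potential[OF _ _ \<phi>]
        cutoff_source_le_heat_potential[OF _ _ _ _ \<phi>])
      (use \<rho> \<tau> A(1) E in auto)
  finally show ?thesis .
qed

lemma representation_bound:
  assumes r: "0 \<le> r" "r < \<rho>" "\<rho> < R" and T': "0 < T'" "T' < T"
  obtains C where "0 < C" "\<And>x \<tau> t. norm x \<le> r \<Longrightarrow> 0 < \<tau> \<Longrightarrow> \<tau> < t \<Longrightarrow> t \<le> T' \<Longrightarrow>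
    ennreal (u x t) \<le> ennreal C * (1 + heat_potential (trace_measure \<rho> \<tau>) x t + heat_potential (source_measure \<rho> T') x t)"
proof -
  obtain A where A: "0 < A" "masses_le \<rho> T' A"
    by (rule mass_bounds[of \<rho> T']) (use r T' in auto)
  obtain \<phi> :: "'a \<Rightarrow> real" and E where E: "0 \<le> E" and \<phi>: "cutoff r \<rho> \<phi>"
    and adjoint_le: "\<And>x y s t. norm x \<le> r \<Longrightarrow> s < t \<Longrightarrow> adjoint_heat_op (cutoff_kernel \<phi> x t) y s \<le> E"
    by (rule heat_kernel_cutoff_exists[OF r(1,2)]) blast
  obtain c where c: "0 < c" and average: "\<And>w (x::'a) t \<tau>. isCont (\<lambda>p. w (fst p) (snd p)) (x, t) \<Longrightarrow> 0 \<le> w x t \<Longrightarrow> \<tau> < t \<Longrightarrow>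
    \<exists>s\<in>{\<tau><..<t}. ennreal (c * w x t) \<le> (\<integral>\<^sup>+y. ennreal (heat_kernel (x - y) (t - s) * w y s) \<partial>lborel)"
    by (rule heat_average_ge_nearby_time) blast
  have cont: "continuous_on (UNIV \<times> {0<..<T}) (\<lambda>p. \<phi> (fst p) * u (fst p) (snd p))"
    using C21_continuous_on(1)[OF C21_subset[OF cutoffD(1)[OF \<phi>]]] C21_continuous_on(1)[OF reg] by (intro continuous_on_mult) auto
  have "ennreal (u x t) \<le> ennreal ((1 + E * A * T') / c) * (1 + heat_potential (trace_measure \<rho> \<tau>) x t + heat_potential (source_measure \<rho> T') x t)"
    if x: "norm x \<le> r" and \<tau>: "0 < \<tau>" "\<tau> < t" and t: "t \<le> T'" for x \<tau> t
  proof (rule ennreal_le_multI_if_mult_le_add)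
    have "isCont (\<lambda>p. \<phi> (fst p) * u (fst p) (snd p)) (x, t)"
      by (rule continuous_on_interior[OF cont]) (use \<tau> t T' in \<open>simp add: interior_Times interior_open\<close>)
    then obtain s where s: "\<tau> < s" "s < t"
      "ennreal (c * u x t) \<le> nn_slice_pairing (cutoff_kernel \<phi> x t) u s"
      using average[where w="\<lambda>y s. \<phi> y * u y s" and x=x and t=t and \<tau>=\<tau>] cutoffD(4)[OF \<phi> x] nonneg[of t x] \<tau> t T'
      by (auto simp: nn_slice_pairing_def cutoff_kernel_def mult.assoc)
    note s(3)
    also have "nn_slice_pairing (cutoff_kernel \<phi> x t) u s
        \<le> heat_potential (trace_measure \<rho> \<tau>) x t + heat_potential (source_measure \<rho> T') x t + ennreal (E * A * T')"
      by (rule cutoff_pairing_le_heat_potentials[OF r(3) \<tau>(1) _ s(2) t T'(2) \<phi> E adjoint_le[OF x] _ A(2)]) (use s(1) A(1) in auto)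
    finally show "ennreal (c * u x t) \<le> heat_potential (trace_measure \<rho> \<tau>) x t + heat_potential (source_measure \<rho> T') x t
        + ennreal (E * A * T')" .
  qed (use c nonneg \<tau> t T' A E in auto)
  moreover have "0 < (1 + E * A * T') / c" using c A E T' by (simp add: add_pos_nonneg)
  ultimately show thesis using that by blast
qed

end

section \<open>Local integrability\<close>

lemma powr_le_one_add_powr:
  fixes v :: real
  assumes "0 \<le> v" "0 \<le> p" "p \<le> q"
  shows "v powr p \<le> 1 + v powr q"
proof (cases "v \<le> 1")
  case True
  then have "v powr p \<le> 1" using assms by (intro powr_le1) auto
  then show ?thesis by (simp add: add_increasing2)
next
  case False
  then have "v powr p \<le> v powr q" using assms by (intro powr_mono) auto
  then show ?thesis by simp
qed

context heat_supersolution
begin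

lemma powr_le_truncated_kernel_convolutions:
  assumes r: "0 \<le> r" "r < \<rho>" "\<rho> < R" and T': "0 < T'" "T' < T" and p: "1 \<le> p"
  obtains D where "0 \<le> D" "\<And>x \<tau> t. norm x \<le> r \<Longrightarrow> 0 < \<tau> \<Longrightarrow> \<tau> < t \<Longrightarrow> t < T' \<Longrightarrow>
    ennreal (u x t powr p) \<le> ennreal D * (1 + ((\<integral>\<^sup>+q. truncated_kernel p T' ((x, t) - q) \<partial>trace_measure \<rho> \<tau>)
      + (\<integral>\<^sup>+q. truncated_kernel p T' ((x, t) - q) \<partial>source_measure \<rho> T')))"
proof -
  obtain A where A: "0 < A" "masses_le \<rho> T' A"
    by (rule mass_bounds[of \<rho> T']) (use r T' in auto)
  obtain C where C: "0 < C" "\<And>x \<tau> t. norm x \<le> r \<Longrightarrow> 0 < \<tau> \<Longrightarrow> \<tau> < t \<Longrightarrow> t \<le> T' \<Longrightarrow>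
    ennreal (u x t) \<le> ennreal C * (1 + heat_potential (trace_measure \<rho> \<tau>) x t + heat_potential (source_measure \<rho> T') x t)"
    by (rule representation_bound[OF r T']) blast
  have measurable: "(\<lambda>q. heat_kernel (x - fst q) (t - snd q)) \<in> borel_measurable (trace_measure \<rho> \<tau>)"
    "(\<lambda>q. heat_kernel (x - fst q) (t - snd q)) \<in> borel_measurable (source_measure \<rho> T')" for x t \<tau>
    by (simp_all cong: measurable_cong_sets)
  show thesis
  proof (rule that)
    let ?D = "(C * (1 + 2 * A powr (1 - 1 / p))) powr p"
    fix x :: 'a and \<tau> t assume x: "norm x \<le> r" and t: "0 < \<tau>" "\<tau> < t" "t < T'"
    have "ennreal (u x t powr p) \<le> ennreal ?D * (1 + ((\<integral>\<^sup>+q. ennreal (heat_kernel (x - fst q) (t - snd q) powr p) \<partial>trace_measure \<rho> \<tau>)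
        + (\<integral>\<^sup>+q. ennreal (heat_kernel (x - fst q) (t - snd q) powr p) \<partial>source_measure \<rho> T')))"
      using C(2)[OF x t(1,2)] t T' nonneg[of t x]
      by (intro powr_le_if_le_two_integrals measurable A(1) C(1) p) (auto simp: masses_leD[OF A(2)] heat_potential_def)
    moreover have "AE q in trace_measure \<rho> \<tau>. 0 < snd q" "AE q in source_measure \<rho> T'. 0 < snd q"
      using AE_trace_measure_time[of \<tau> \<rho>] AE_source_measure_time[of T' \<rho>] t T' by auto
    ultimately show "ennreal (u x t powr p) \<le> ennreal ?D * (1 + ((\<integral>\<^sup>+q. truncated_kernel p T' ((x, t) - q) \<partial>trace_measure \<rho> \<tau>)
        + (\<integral>\<^sup>+q. truncated_kernel p T' ((x, t) - q) \<partial>source_measure \<rho> T')))"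
      using t(3) by (simp add: nn_integral_heat_kernel_powr_eq_truncated)
  qed simp
qed

lemma late_Lp_bounded:
  assumes r: "0 \<le> r" "r < R" and T': "0 < T'" "T' < T" and p: "1 \<le> p" "p < (real DIM('a) + 2) / real DIM('a)"
  obtains B where "B < \<infinity>" "\<And>\<tau>. 0 < \<tau> \<Longrightarrow> \<tau> < T' \<Longrightarrow>
    (\<integral>\<^sup>+z\<in>cball 0 r \<times> {\<tau><..<T'}. ennreal (u (fst z) (snd z) powr p) \<partial>lborel) \<le> B"
proof -
  let ?S = "cball (0::'a) r \<times> {0<..<T'}" and ?k = "truncated_kernel p T' :: 'a \<times> real \<Rightarrow> ennreal"
  define J where "J M z = (\<integral>\<^sup>+q. ?k (z - q) \<partial>M)" for M z
  obtain \<rho> where \<rho>: "r < \<rho>" "\<rho> < R" using dense[OF r(2)] by blast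
  obtain A where A: "0 < A" "masses_le \<rho> T' A"
    by (rule mass_bounds[of \<rho> T']) (use r \<rho> T' in auto)
  obtain D where D: "0 \<le> D" "\<And>x \<tau> t. norm x \<le> r \<Longrightarrow> 0 < \<tau> \<Longrightarrow> \<tau> < t \<Longrightarrow> t < T' \<Longrightarrow>
    ennreal (u x t powr p) \<le> ennreal D * (1 + (J (trace_measure \<rho> \<tau>) (x, t) + J (source_measure \<rho> T') (x, t)))"
    unfolding J_def by (rule powr_le_truncated_kernel_convolutions[OF r(1) \<rho> T' p(1)]) blast
  define G where "G = (\<integral>\<^sup>+z. ?k z \<partial>lborel) * ennreal A"
  have G: "G < \<infinity>"
    unfolding G_def using nn_integral_truncated_kernel_finite[of p T', where 'a='a] p by (simp add: ennreal_mult_less_top)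
  have S: "emeasure lborel ?S < \<infinity>" by (intro emeasure_bounded_finite bounded_Times) auto
  show thesis
  proof (rule that)
    show "ennreal D * (emeasure lborel ?S + (G + G)) < \<infinity>" using G S by (simp add: ennreal_mult_less_top)
    fix \<tau> assume \<tau>: "0 < \<tau>" "\<tau> < T'"
    note [measurable] = borel_cylinder[of "0::'a" r T']
      truncated_kernel_convolution_finite_measure(1)[of "trace_measure \<rho> \<tau>" A p T', folded J_def]
      truncated_kernel_convolution_finite_measure(1)[of "source_measure \<rho> T'" A p T', folded J_def]
    have "(\<integral>\<^sup>+z\<in>cball 0 r \<times> {\<tau><..<T'}. ennreal (u (fst z) (snd z) powr p) \<partial>lborel)
        \<le> (\<integral>\<^sup>+z. ennreal D * (indicator ?S z + (J (trace_measure \<rho> \<tau>) z + J (source_measure \<rho> T') z)) \<partial>lborel)"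
    proof (rule nn_integral_mono)
      fix z :: "'a \<times> real"
      show "ennreal (u (fst z) (snd z) powr p) * indicator (cball 0 r \<times> {\<tau><..<T'}) z
          \<le> ennreal D * (indicator ?S z + (J (trace_measure \<rho> \<tau>) z + J (source_measure \<rho> T') z))"
        using D(2)[of "fst z" \<tau> "snd z"] \<tau> by (cases z) (auto simp: indicator_def)
    qed
    also have "\<dots> = ennreal D * (emeasure lborel ?S + ((\<integral>\<^sup>+z. J (trace_measure \<rho> \<tau>) z \<partial>lborel) + (\<integral>\<^sup>+z. J (source_measure \<rho> T') z \<partial>lborel)))"
      using masses_leD[OF A(2)] \<tau> by (simp add: nn_integral_cmult nn_integral_add)
    also have "\<dots> \<le> ennreal D * (emeasure lborel ?S + (G + G))"
      unfolding G_def J_def using masses_leD[OF A(2)] \<tau>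
      by (intro mult_left_mono add_mono truncated_kernel_convolution_finite_measure(2)) auto
    finally show "(\<integral>\<^sup>+z\<in>cball 0 r \<times> {\<tau><..<T'}. ennreal (u (fst z) (snd z) powr p) \<partial>lborel)
        \<le> ennreal D * (emeasure lborel ?S + (G + G))" .
  qed
qed

lemma local_Lp_finite_ge_1:
  assumes r: "0 \<le> r" "r < R" and T': "0 < T'" "T' < T" and p: "1 \<le> p" "p < (real DIM('a) + 2) / real DIM('a)"
  shows "(\<integral>\<^sup>+z\<in>cball 0 r \<times> {0<..<T'}. ennreal (u (fst z) (snd z) powr p) \<partial>lborel) < \<infinity>"
proof -
  obtain B where B: "B < \<infinity>" "\<And>\<tau>. 0 < \<tau> \<Longrightarrow> \<tau> < T' \<Longrightarrow>
    (\<integral>\<^sup>+z\<in>cball 0 r \<times> {\<tau><..<T'}. ennreal (u (fst z) (snd z) powr p) \<partial>lborel) \<le> B"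
    by (rule late_Lp_bounded[OF assms]) blast
  let ?h = "\<lambda>z. ennreal (u (fst z) (snd z) powr p) * indicator (cball 0 r \<times> {0<..<T'}) z"
  let ?W = "density lborel ?h"
  note [measurable] = borel_measurable_powr_on_cylinder[of T' p r, OF less_imp_le[OF T'(2)]]
  have "emeasure ?W (space ?W) \<le> B"
  proof (rule emeasure_le_if_superlevel_le[where f=snd, OF _ _ T'(1)])
    show "snd \<in> borel_measurable ?W" by (simp add: borel_prod[symmetric])
    show "AE z in ?W. 0 < snd z" by (subst AE_density, measurable, auto simp: indicator_def)
    fix \<tau> assume \<tau>: "0 < \<tau>" "\<tau> < T'"
    have "{z::'a \<times> real. \<tau> < snd z} \<in> sets borel" by (intro borel_open open_Collect_less continuous_intros)
    then have "emeasure ?W {z \<in> space ?W. \<tau> < snd z} = (\<integral>\<^sup>+z. ?h z * indicator {z. \<tau> < snd z} z \<partial>lborel)"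
      by (simp add: emeasure_density)
    also have "\<dots> = (\<integral>\<^sup>+z\<in>cball 0 r \<times> {\<tau><..<T'}. ennreal (u (fst z) (snd z) powr p) \<partial>lborel)"
      using \<tau> by (intro nn_integral_cong) (auto simp: indicator_def)
    also have "\<dots> \<le> B" by (rule B(2)[OF \<tau>])
    finally show "emeasure ?W {z \<in> space ?W. \<tau> < snd z} \<le> B" .
  qed
  then show ?thesis using B(1) by (simp add: emeasure_density)
qed

lemma local_Lp_finite:
  assumes r: "0 \<le> r" "r < R" and T': "0 < T'" "T' < T" and p: "0 \<le> p" "p < (real DIM('a) + 2) / real DIM('a)"
  shows "(\<integral>\<^sup>+z\<in>cball 0 r \<times> {0<..<T'}. ennreal (u (fst z) (snd z) powr p) \<partial>lborel) < \<infinity>"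
proof -
  let ?S = "cball (0::'a) r \<times> {0<..<T'}"
  note [measurable] = borel_cylinder[of "0::'a" r T'] borel_measurable_powr_on_cylinder[of T' "max 1 p" r, OF less_imp_le[OF T'(2)]]
  have "(\<integral>\<^sup>+z\<in>?S. ennreal (u (fst z) (snd z) powr p) \<partial>lborel)
      \<le> (\<integral>\<^sup>+z. indicator ?S z + ennreal (u (fst z) (snd z) powr max 1 p) * indicator ?S z \<partial>lborel)"
  proof (rule nn_integral_mono)
    fix z :: "'a \<times> real"
    show "ennreal (u (fst z) (snd z) powr p) * indicator ?S z
        \<le> indicator ?S z + ennreal (u (fst z) (snd z) powr max 1 p) * indicator ?S z"
      using ennreal_leI[OF powr_le_one_add_powr[of "u (fst z) (snd z)" p "max 1 p"]] nonneg[of "snd z" "fst z"] p T'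
      by (auto simp: indicator_def)
  qed
  also have "\<dots> = emeasure lborel ?S + (\<integral>\<^sup>+z\<in>?S. ennreal (u (fst z) (snd z) powr max 1 p) \<partial>lborel)"
    by (simp add: nn_integral_add)
  also have "\<dots> < \<infinity>"
  proof -
    have "emeasure lborel ?S < \<infinity>" by (intro emeasure_bounded_finite bounded_Times) auto
    then show ?thesis using local_Lp_finite_ge_1[OF r T', of "max 1 p"] p by (simp add: max_def)
  qed
  finally show ?thesis .
qed

end

section \<open>The nonlocal factor\<close>

lemma nonlocal_exponents:
  fixes n \<alpha> lam :: real
  assumes "0 < n" "0 < \<alpha>" "0 < lam" "lam < (n + 2 - \<alpha>) / n"
  obtains q where "0 < q" "q < 1" "\<alpha> / n / q < (n + 2) / n" "lam / (1 - q) < (n + 2) / n"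
proof -
  have "\<alpha> + n * lam < n + 2" using assms by (simp add: field_simps)
  then have "\<alpha> / (n + 2) + n * lam / (n + 2) < 1" using assms by (simp flip: add_divide_distrib)
  then have "\<alpha> / (n + 2) < 1 - n * lam / (n + 2)" by linarith
  then obtain q where q: "\<alpha> / (n + 2) < q" "q < 1 - n * lam / (n + 2)" using dense by blast
  have "0 < q" using q(1) assms by (intro less_trans[OF _ q(1)]) simp
  moreover have "q < 1" using q(2) assms by (intro less_trans[OF q(2)]) simp
  ultimately show thesis using q assms by (intro that[of q]) (simp_all add: field_simps)
qed

lemma set_integrable_imp_nn_integral_finite:
  fixes f :: "'b \<Rightarrow> real"
  assumes "set_integrable M A f" "\<And>x. 0 \<le> f x"
  shows "(\<lambda>x. ennreal (f x) * indicator A x) \<in> borel_measurable M"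
    and "(\<integral>\<^sup>+x\<in>A. ennreal (f x) \<partial>M) < \<infinity>"
proof -
  have *: "(\<lambda>x. ennreal (f x) * indicator A x) = (\<lambda>x. ennreal (norm (indicator A x *\<^sub>R f x)))"
    using assms(2) by (auto simp: indicator_def fun_eq_iff)
  have integrable: "integrable M (\<lambda>x. indicator A x *\<^sub>R f x)" using assms(1) by (simp add: set_integrable_def)
  note [measurable] = borel_measurable_integrable[OF integrable]
  show "(\<lambda>x. ennreal (f x) * indicator A x) \<in> borel_measurable M" unfolding * by measurable
  show "(\<integral>\<^sup>+x\<in>A. ennreal (f x) \<partial>M) < \<infinity>"
    unfolding * using integrable by (simp only: integrable_iff_bounded)
qed

lemma powr_mult_powr_le_add:
  fixes X Y q :: real
  assumes "0 \<le> X" "0 \<le> Y" "0 \<le> q" "q \<le> 1"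
  shows "X powr q * Y powr (1 - q) \<le> X + Y"
proof (cases "X = 0 \<or> Y = 0")
  case False
  then have "X powr q * Y powr (1 - q) \<le> q * X + (1 - q) * Y"
    using assms by (intro Youngs_inequality_0) auto
  also have "\<dots> \<le> 1 * X + 1 * Y" using assms by (intro add_mono mult_right_mono) auto
  finally show ?thesis by simp
qed (use assms in auto)

context heat_supersolution
begin

definition nonlocal_factor :: "real \<Rightarrow> real \<Rightarrow> 'a \<Rightarrow> real \<Rightarrow> ennreal" where
  "nonlocal_factor a lam x t = (\<integral>\<^sup>+p\<in>UNIV \<times> {0<..<T}.
    ennreal (heat_kernel (x - fst p) (t - snd p) powr a * u (fst p) (snd p) powr lam) \<partial>lborel)"

lemma nonlocal_integrand_le:
  assumes x: "norm x \<le> r" and t: "t < T'" and a: "0 \<le> a" and q: "0 < q" "q < 1"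
    and H: "0 \<le> H" "\<And>(y::'a) s. \<rho> - r \<le> norm y \<Longrightarrow> heat_kernel y s \<le> H"
  shows "ennreal (heat_kernel (x - y) (t - s) powr a * u y s powr lam) * indicator (UNIV \<times> {0<..<T}) (y, s)
    \<le> truncated_kernel (a / q) T' ((x, t) - (y, s))
      + (ennreal (u y s powr (lam / (1 - q))) * indicator (cball 0 \<rho> \<times> {0<..<T'}) (y, s)
        + ennreal (H powr a) * (ennreal (u y s powr lam) * indicator (UNIV \<times> {0<..<T}) (y, s)))"
    (is "_ \<le> ?near + (?Lp + ?far)")
proof -
  let ?K = "heat_kernel (x - y) (t - s)"
  consider "s \<notin> {0<..<T}" | "t \<le> s" | "0 < s" "s < T" "s < t" "norm y \<le> \<rho>" | "0 < s" "s < T" "s < t" "\<rho> < norm y"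
    by fastforce
  then show ?thesis
  proof cases
    case 3
    have "?K powr a * u y s powr lam = (?K powr (a / q)) powr q * (u y s powr (lam / (1 - q))) powr (1 - q)"
      using q by (simp add: powr_powr)
    also have "\<dots> \<le> ?K powr (a / q) + u y s powr (lam / (1 - q))"
      by (rule powr_mult_powr_le_add) (use q in auto)
    finally have "ennreal (?K powr a * u y s powr lam) \<le> ennreal (?K powr (a / q) + u y s powr (lam / (1 - q)))"
      by (rule ennreal_leI)
    also have "\<dots> = ?near + ?Lp" using 3 t by (simp add: truncated_kernel_eq ennreal_plus)
    also have "\<dots> \<le> ?near + (?Lp + ?far)" by (simp add: add_left_mono)
    finally show ?thesis using 3 by simp
  next
    case 4
    have "\<rho> - r \<le> norm (x - y)" using x 4 norm_triangle_ineq2[of y x] by (simp add: norm_minus_commute)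
    then have "?K powr a \<le> H powr a" using H a by (intro powr_mono2) auto
    then have "ennreal (?K powr a * u y s powr lam) \<le> ennreal (H powr a * u y s powr lam)"
      by (intro ennreal_leI mult_right_mono) auto
    also have "\<dots> = ?far" using 4 by (simp add: ennreal_mult')
    also have "\<dots> \<le> ?near + (?Lp + ?far)" by (simp add: add_increasing)
    finally show ?thesis using 4 by simp
  qed auto
qed

lemma nonlocal_factor_bounded:
  assumes alpha: "0 < \<alpha>" and lam: "0 < lam" "lam < (real DIM('a) + 2 - \<alpha>) / real DIM('a)"
    and Llam: "set_integrable lborel (UNIV \<times> {0<..<T}) (\<lambda>p. u (fst p) (snd p) powr lam)"
    and r: "0 \<le> r" "r < R" and T': "0 < T'" "T' < T"
  obtains C where "0 \<le> C" "\<And>x t. norm x \<le> r \<Longrightarrow> t < T' \<Longrightarrow> nonlocal_factor (\<alpha> / real DIM('a)) lam x t \<le> ennreal C"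
proof -
  let ?n = "real DIM('a)"
  obtain q where q: "0 < q" "q < 1" "\<alpha> / ?n / q < (?n + 2) / ?n" "lam / (1 - q) < (?n + 2) / ?n"
    by (rule nonlocal_exponents[OF _ alpha lam]) auto
  obtain \<rho> where \<rho>: "r < \<rho>" "\<rho> < R" using dense[OF r(2)] by blast
  obtain H where H: "0 \<le> H" "\<And>(x::'a) s. \<rho> - r \<le> norm x \<Longrightarrow> heat_kernel x s \<le> H"
    by (rule heat_kernel_bounded_off_ball[of "\<rho> - r"]) (use \<rho> in auto)
  define H' where "H' = ennreal (H powr (\<alpha> / ?n))"
  let ?k = "truncated_kernel (\<alpha> / ?n / q) T' :: 'a \<times> real \<Rightarrow> ennreal"
  define f g :: "'a \<times> real \<Rightarrow> ennreal" where
    "f z = ennreal (u (fst z) (snd z) powr (lam / (1 - q))) * indicator (cball 0 \<rho> \<times> {0<..<T'}) z"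
    and "g z = ennreal (u (fst z) (snd z) powr lam) * indicator (UNIV \<times> {0<..<T}) z" for z
  have [measurable]: "f \<in> borel_measurable borel"
    unfolding f_def by (rule borel_measurable_powr_on_cylinder) (use T' in simp)
  have [measurable]: "g \<in> borel_measurable borel" and g_fin: "(\<integral>\<^sup>+z. g z \<partial>lborel) < \<infinity>"
    using set_integrable_imp_nn_integral_finite[OF Llam] by (simp_all add: g_def[abs_def])
  define G where "G = (\<integral>\<^sup>+z. ?k z \<partial>lborel) + ((\<integral>\<^sup>+z. f z \<partial>lborel) + H' * (\<integral>\<^sup>+z. g z \<partial>lborel))"
  have "nonlocal_factor (\<alpha> / ?n) lam x t \<le> G" if x: "norm x \<le> r" and t: "t < T'" for x t
  proof -
    have "nonlocal_factor (\<alpha> / ?n) lam x t \<le> (\<integral>\<^sup>+z. ?k ((x, t) - z) + (f z + H' * g z) \<partial>lborel)"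
      unfolding nonlocal_factor_def
    proof (rule nn_integral_mono)
      fix z :: "'a \<times> real"
      show "ennreal (heat_kernel (x - fst z) (t - snd z) powr (\<alpha> / ?n) * u (fst z) (snd z) powr lam) * indicator (UNIV \<times> {0<..<T}) z
          \<le> ?k ((x, t) - z) + (f z + H' * g z)"
        using nonlocal_integrand_le[OF x t _ q(1,2) H, where a="\<alpha> / ?n" and y="fst z" and s="snd z" and lam=lam] alpha
        by (simp add: f_def g_def H'_def)
    qed
    also have "\<dots> = G"
      by (simp add: G_def nn_integral_add nn_integral_cmult nn_integral_lborel_reflect)
    finally show ?thesis .
  qed
  moreover have "G < \<infinity>"
  proof -
    have "(\<integral>\<^sup>+z. ?k z \<partial>lborel) < \<infinity>" by (rule nn_integral_truncated_kernel_finite) (use alpha q in auto)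
    moreover have "(\<integral>\<^sup>+z. f z \<partial>lborel) < \<infinity>"
      unfolding f_def by (rule local_Lp_finite) (use r \<rho> T' lam q in auto)
    ultimately show ?thesis using g_fin by (simp add: G_def H'_def ennreal_mult_less_top)
  qed
  ultimately show thesis by (intro that[of "enn2real G"]) simp_all
qed

end

section \<open>Growth with a critical source\<close>

definition parabolic_depth :: "'a::metric_space \<Rightarrow> real \<Rightarrow> real \<Rightarrow> 'a \<Rightarrow> real \<Rightarrow> real" where
  "parabolic_depth x0 t1 \<sigma> x t = min (\<sigma> - dist x0 x) (sqrt (t - t1))"

lemma parabolic_depth_nearby:
  assumes d: "0 \<le> d" "d \<le> parabolic_depth x0 t1 \<sigma> x t" and y: "dist x y \<le> d / 2" and s: "t - (d / 2)\<^sup>2 \<le> s"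
  shows "d / 2 \<le> parabolic_depth x0 t1 \<sigma> y s" and "t1 \<le> s"
proof -
  have dist: "dist x0 y \<le> \<sigma> - d / 2"
    using dist_triangle[of x0 y x] d(2) y by (simp add: parabolic_depth_def)
  have "d\<^sup>2 \<le> t - t1"
    using d by (simp add: parabolic_depth_def real_le_rsqrt sqrt_ge_absD)
  moreover have "2 * (d / 2)\<^sup>2 \<le> d\<^sup>2" by (simp add: power_divide)
  ultimately have *: "(d / 2)\<^sup>2 \<le> s - t1" using s by linarith
  then have "d / 2 \<le> sqrt (s - t1)" by (rule real_le_rsqrt)
  then show "d / 2 \<le> parabolic_depth x0 t1 \<sigma> y s" using dist by (simp add: parabolic_depth_def)
  show "t1 \<le> s" using * zero_le_power2[of "d / 2"] by linarith
qed

lemma parabolic_point_picking: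
  fixes v :: "'a::{metric_space, heine_borel} \<Rightarrow> real \<Rightarrow> real" and N :: nat
  assumes \<sigma>: "0 \<le> \<sigma>"
    and cont: "continuous_on (cball x0 \<sigma> \<times> {t0 - \<sigma>\<^sup>2..t0}) (\<lambda>p. v (fst p) (snd p))"
    and nonneg: "\<And>x t. x \<in> cball x0 \<sigma> \<Longrightarrow> t \<in> {t0 - \<sigma>\<^sup>2..t0} \<Longrightarrow> 0 \<le> v x t"
  obtains x t d where "0 \<le> d" "dist x0 x \<le> \<sigma> - d" "t0 - \<sigma>\<^sup>2 + d\<^sup>2 \<le> t" "t \<le> t0"
    "v x0 t0 * \<sigma> ^ N \<le> v x t * d ^ N"
    "\<And>y s. 0 < d \<Longrightarrow> dist x y \<le> d / 2 \<Longrightarrow> t - (d / 2)\<^sup>2 \<le> s \<Longrightarrow> s \<le> t \<Longrightarrow> v y s \<le> 2 ^ N * v x t"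
proof -
  define Q where "Q = cball x0 \<sigma> \<times> {t0 - \<sigma>\<^sup>2..t0}"
  let ?D = "parabolic_depth x0 (t0 - \<sigma>\<^sup>2) \<sigma>"
  have contD: "continuous_on Q (\<lambda>p. v (fst p) (snd p) * ?D (fst p) (snd p) ^ N)"
    unfolding parabolic_depth_def using cont by (intro continuous_intros) (auto simp: Q_def)
  have "compact Q" unfolding Q_def by (intro compact_Times) auto
  moreover have center: "(x0, t0) \<in> Q" using \<sigma> by (simp add: Q_def)
  ultimately obtain z where z: "z \<in> Q"
    "\<And>p. p \<in> Q \<Longrightarrow> v (fst p) (snd p) * ?D (fst p) (snd p) ^ N \<le> v (fst z) (snd z) * ?D (fst z) (snd z) ^ N"
    using continuous_attains_sup[OF _ _ contD] by blast
  define x t d where "x = fst z" and "t = snd z" and "d = ?D x t"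
  have xt: "x \<in> cball x0 \<sigma>" "t0 - \<sigma>\<^sup>2 \<le> t" "t \<le> t0" using z(1) by (auto simp: Q_def x_def t_def)
  then have d: "0 \<le> d" "d \<le> \<sigma> - dist x0 x" "d \<le> sqrt (t - (t0 - \<sigma>\<^sup>2))"
    by (auto simp: d_def parabolic_depth_def)
  show thesis
  proof (rule that[OF d(1)])
    show "dist x0 x \<le> \<sigma> - d" using d(2) by simp
    have "d\<^sup>2 \<le> (sqrt (t - (t0 - \<sigma>\<^sup>2)))\<^sup>2" using d by (intro power_mono) auto
    then show "t0 - \<sigma>\<^sup>2 + d\<^sup>2 \<le> t" using xt by simp
    show "v x0 t0 * \<sigma> ^ N \<le> v x t * d ^ N"
      using z(2)[OF center] \<sigma> by (simp add: x_def t_def d_def parabolic_depth_def)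
    fix y s assume "0 < d" and y: "dist x y \<le> d / 2" and s: "t - (d / 2)\<^sup>2 \<le> s" "s \<le> t"
    note near = parabolic_depth_nearby[OF d(1) eq_refl[OF d_def] y s(1)]
    have Q: "(y, s) \<in> Q" using near s xt \<open>0 < d\<close> by (auto simp: Q_def parabolic_depth_def)
    have "v y s * (d / 2) ^ N \<le> v y s * ?D y s ^ N"
      using Q near(1) nonneg \<open>0 < d\<close> by (intro mult_left_mono power_mono) (auto simp: Q_def)
    also have "\<dots> \<le> v x t * d ^ N" using z(2)[OF Q] by (simp add: x_def t_def d_def)
    finally show "v y s \<le> 2 ^ N * v x t" using \<open>0 < d\<close> by (simp add: power_divide field_simps)
  qed (rule xt(3))
qed

lemma critical_scaling:
  fixes B C H n :: real
  assumes "0 < n" "0 \<le> B" "0 < C" "0 < H"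
  obtains \<kappa> \<epsilon> where "0 < \<kappa>" "\<kappa> \<le> 1 / 2" "0 < \<epsilon>" "\<And>M. 0 < M \<Longrightarrow>
    C * (B * M powr ((n + 2) / n) * (\<kappa> * M powr (- 1 / n))\<^sup>2 + H * (\<kappa> * M powr (- 1 / n)) powr (- n) * \<epsilon>) \<le> M / 2"
proof -
  define \<kappa> where "\<kappa> = 1 / (4 * (C * B) + 2)"
  have CB: "0 \<le> C * B" using assms by simp
  have \<kappa>: "0 < \<kappa>" "\<kappa> \<le> 1 / 2" "C * B * \<kappa> \<le> 1 / 4"
    using CB unfolding \<kappa>_def by (auto simp: field_simps)
  have "C * B * \<kappa> * \<kappa> \<le> 1 / 4 * 1" using \<kappa> CB by (intro mult_mono) auto
  then have near: "C * B * \<kappa>\<^sup>2 \<le> 1 / 4" by (simp add: power2_eq_square mult.assoc)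
  define \<epsilon> where "\<epsilon> = \<kappa> powr n / (4 * C * H)"
  have far: "C * (H * \<kappa> powr (- n) * \<epsilon>) = 1 / 4"
    using \<kappa> assms by (simp add: \<epsilon>_def powr_minus field_simps)
  have "C * (B * M powr ((n + 2) / n) * (\<kappa> * M powr (- 1 / n))\<^sup>2 + H * (\<kappa> * M powr (- 1 / n)) powr (- n) * \<epsilon>) \<le> M / 2"
    if M: "0 < M" for M
  proof -
    have "(M powr (- 1 / n))\<^sup>2 = M powr (- 2 / n)"
      using M by (simp add: power2_eq_square powr_add[symmetric])
    moreover have "M powr ((n + 2) / n) * M powr (- 2 / n) = M"
      using M assms(1) by (simp add: powr_add[symmetric] add_divide_distrib)
    ultimately have "B * M powr ((n + 2) / n) * (\<kappa> * M powr (- 1 / n))\<^sup>2 = B * \<kappa>\<^sup>2 * M"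
      by (simp add: power_mult_distrib mult_ac)
    moreover have "(\<kappa> * M powr (- 1 / n)) powr (- n) = \<kappa> powr (- n) * M"
      using \<kappa>(1) M assms(1) by (simp add: powr_mult powr_powr)
    ultimately have "C * (B * M powr ((n + 2) / n) * (\<kappa> * M powr (- 1 / n))\<^sup>2 + H * (\<kappa> * M powr (- 1 / n)) powr (- n) * \<epsilon>)
        = C * B * \<kappa>\<^sup>2 * M + C * (H * \<kappa> powr (- n) * \<epsilon>) * M"
      by (simp only:) (simp add: distrib_left mult_ac)
    also have "\<dots> \<le> 1 / 4 * M + 1 / 4 * M"
      using near far M by (intro add_mono mult_right_mono) auto
    finally show ?thesis by simp
  qed
  moreover have "0 < \<epsilon>" using \<kappa> assms by (simp add: \<epsilon>_def)
  ultimately show thesis using \<kappa>(1,2) that by blast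
qed

text \<open>The exponent \<open>(n + 2) / n\<close> is scale invariant: at the scale \<open>\<kappa> * M powr (- 1 / n)\<close> both the source near
  \<open>(x, t)\<close> and a small mass far from it contribute a multiple of \<open>M\<close>, and both factors can be made small.\<close>

lemma critical_heat_potential_le_half:
  assumes B: "0 \<le> B" and C: "0 < C"
  obtains \<epsilon> where "0 < \<epsilon>" "\<And>h (x::'a::euclidean_space) t M d. h \<in> borel_measurable borel \<Longrightarrow> 0 < M \<Longrightarrow> 0 < d \<Longrightarrow> 1 \<le> M * d ^ DIM('a) \<Longrightarrow>
    (\<And>y s. dist x y \<le> d / 2 \<Longrightarrow> t - (d / 2)\<^sup>2 \<le> s \<Longrightarrow> s < t \<Longrightarrow> h (y, s) \<le> ennreal (B * M powr ((real DIM('a) + 2) / real DIM('a)))) \<Longrightarrow>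
    (\<integral>\<^sup>+p. h p \<partial>lborel) \<le> ennreal \<epsilon> \<Longrightarrow>
    ennreal C * heat_potential (density lborel h) x t \<le> ennreal (M / 2)"
proof -
  let ?n = "real DIM('a)"
  obtain H where H: "0 < H" "\<And>h (x::'a) t \<delta> B \<epsilon>. h \<in> borel_measurable borel \<Longrightarrow> 0 < \<delta> \<Longrightarrow> 0 \<le> B \<Longrightarrow> 0 \<le> \<epsilon> \<Longrightarrow>
    (\<And>y s. norm (x - y) < \<delta> \<Longrightarrow> s < t \<Longrightarrow> t - s < \<delta>\<^sup>2 \<Longrightarrow> h (y, s) \<le> ennreal B) \<Longrightarrow>
    (\<integral>\<^sup>+p. h p \<partial>lborel) \<le> ennreal \<epsilon> \<Longrightarrow>
    heat_potential (density lborel h) x t \<le> ennreal (B * \<delta>\<^sup>2 + H * \<delta> powr (- ?n) * \<epsilon>)"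
    by (rule heat_potential_near_far) blast
  obtain \<kappa> \<epsilon> where \<kappa>: "0 < \<kappa>" "\<kappa> \<le> 1 / 2" and \<epsilon>: "0 < \<epsilon>" and scaling: "\<And>M. 0 < M \<Longrightarrow>
    C * (B * M powr ((?n + 2) / ?n) * (\<kappa> * M powr (- 1 / ?n))\<^sup>2 + H * (\<kappa> * M powr (- 1 / ?n)) powr (- ?n) * \<epsilon>) \<le> M / 2"
    by (rule critical_scaling[OF _ B C H(1), of ?n]) auto
  show thesis
  proof (rule that[OF \<epsilon>])
    fix h and x :: 'a and t M d :: real
    assume h: "h \<in> borel_measurable borel" and M: "0 < M" and d: "0 < d" and large: "1 \<le> M * d ^ DIM('a)"
      and near: "\<And>y s. dist x y \<le> d / 2 \<Longrightarrow> t - (d / 2)\<^sup>2 \<le> s \<Longrightarrow> s < t \<Longrightarrow> h (y, s) \<le> ennreal (B * M powr ((?n + 2) / ?n))"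
      and mass: "(\<integral>\<^sup>+p. h p \<partial>lborel) \<le> ennreal \<epsilon>"
    define \<delta> where "\<delta> = \<kappa> * M powr (- 1 / ?n)"
    have \<delta>: "0 < \<delta>" using \<kappa> M by (simp add: \<delta>_def)
    have "(1 / M) powr (1 / ?n) \<le> (d ^ DIM('a)) powr (1 / ?n)"
      using large M by (intro powr_mono2) (auto simp: field_simps)
    then have "M powr (- 1 / ?n) \<le> d"
      using d M by (simp add: powr_realpow[symmetric] powr_powr powr_divide powr_minus_divide)
    then have "\<delta> \<le> 1 / 2 * d" unfolding \<delta>_def using \<kappa> by (intro mult_mono) auto
    then have half: "\<delta> \<le> d / 2" by simp
    then have "\<delta>\<^sup>2 \<le> (d / 2)\<^sup>2" using \<delta> by (intro power_mono) auto
    then have "heat_potential (density lborel h) x t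
        \<le> ennreal (B * M powr ((?n + 2) / ?n) * \<delta>\<^sup>2 + H * \<delta> powr (- ?n) * \<epsilon>)"
      using half B \<epsilon> by (intro H(2) h \<delta> mass near) (auto simp: dist_norm)
    then have "ennreal C * heat_potential (density lborel h) x t
        \<le> ennreal (C * (B * M powr ((?n + 2) / ?n) * \<delta>\<^sup>2 + H * \<delta> powr (- ?n) * \<epsilon>))"
      using C by (simp add: ennreal_mult' mult_left_mono)
    also have "\<dots> \<le> ennreal (M / 2)" unfolding \<delta>_def by (intro ennreal_leI scaling M)
    finally show "ennreal C * heat_potential (density lborel h) x t \<le> ennreal (M / 2)" .
  qed
qed

lemma critical_power_le_of_doubling:
  fixes v M :: real
  assumes "1 \<le> M" "0 \<le> v" "v \<le> 2 ^ N * M" "0 < N"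
  shows "1 + v powr ((real N + 2) / real N) \<le> (1 + 2 powr (real N + 2)) * M powr ((real N + 2) / real N)"
proof -
  have "v powr ((real N + 2) / real N) \<le> (2 ^ N * M) powr ((real N + 2) / real N)"
    using assms by (intro powr_mono2) auto
  also have "\<dots> = 2 powr (real N + 2) * M powr ((real N + 2) / real N)"
    using assms by (simp add: powr_mult powr_realpow[symmetric] powr_powr)
  finally show ?thesis
    using ge_one_powr_ge_zero[of M "(real N + 2) / real N"] assms(1) by (simp add: distrib_right)
qed

lemma mult_power_le_after_absorption:
  fixes C M t d :: real and V :: ennreal
  assumes "0 < C" "0 < t" "0 \<le> d" "d\<^sup>2 \<le> t" "0 \<le> M"
    and M: "ennreal M \<le> ennreal (C * t powr (- real N / 2)) + V" and V: "V \<le> ennreal (M / 2)"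
  shows "M * d ^ N \<le> 2 * C"
proof -
  have "ennreal M \<le> ennreal (C * t powr (- real N / 2)) + ennreal (M / 2)"
    using M V by (meson add_left_mono order_trans)
  also have "\<dots> = ennreal (C * t powr (- real N / 2) + M / 2)" using assms by simp
  finally have "M \<le> C * t powr (- real N / 2) + M / 2"
    using assms by (subst (asm) ennreal_le_iff) auto
  then have M: "M \<le> 2 * C * t powr (- real N / 2)" by simp
  have "d ^ N \<le> t powr (real N / 2)"
  proof -
    have "d ^ N \<le> sqrt t ^ N" using assms(3,4) by (intro power_mono real_le_rsqrt) auto
    also have "\<dots> = t powr (real N / 2)"
      using assms(2) by (simp add: powr_half_sqrt[symmetric] powr_realpow[symmetric] powr_powr)
    finally show ?thesis .
  qed
  then have "M * d ^ N \<le> (2 * C * t powr (- real N / 2)) * t powr (real N / 2)"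
    using M assms by (intro mult_mono) auto
  also have "\<dots> = 2 * C" using assms(2) by (simp add: powr_minus)
  finally show ?thesis .
qed

context heat_supersolution
begin

lemma heat_potential_half_time_trace_le:
  assumes t: "0 < t" "t < T" and A: "emeasure (trace_measure \<rho> (t / 2)) UNIV \<le> ennreal A"
  shows "heat_potential (trace_measure \<rho> (t / 2)) x t \<le> ennreal (t powr (- real DIM('a) / 2)) * ennreal A"
proof -
  let ?w = "t powr (- real DIM('a) / 2)"
  have "heat_kernel (x - y) (t - t / 2) \<le> ?w" for y
  proof -
    have "heat_kernel (x - y) (t - t / 2) \<le> (4 * pi * (t - t / 2)) powr (- real DIM('a) / 2)"
      by (rule heat_kernel_le_time) (use t in simp)
    also have "\<dots> \<le> ?w" using t pi_gt3 by (intro powr_mono2') (auto simp: field_simps)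
    finally show ?thesis .
  qed
  then have "AE p in trace_measure \<rho> (t / 2). ennreal (heat_kernel (x - fst p) (t - snd p)) \<le> ennreal ?w"
    using AE_trace_measure_time[of "t / 2" \<rho>] t by (auto elim!: eventually_mono intro: ennreal_leI)
  then have "heat_potential (trace_measure \<rho> (t / 2)) x t \<le> (\<integral>\<^sup>+p. ennreal ?w \<partial>trace_measure \<rho> (t / 2))"
    unfolding heat_potential_def by (rule nn_integral_mono_AE)
  also have "\<dots> \<le> ennreal ?w * ennreal A" using A by (simp add: mult_left_mono)
  finally show ?thesis .
qed

lemma le_decay_plus_source_potential:
  assumes r: "0 \<le> r" "r < \<rho>" "\<rho> < R" and T': "0 < T'" "T' < T"
  obtains C where "0 < C" "\<And>x t. norm x \<le> r \<Longrightarrow> 0 < t \<Longrightarrow> t \<le> T' \<Longrightarrow>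
    ennreal (u x t) \<le> ennreal (C * t powr (- real DIM('a) / 2)) + ennreal C * heat_potential (source_measure \<rho> T') x t"
proof -
  let ?n = "real DIM('a)"
  obtain A where A: "0 < A" "masses_le \<rho> T' A"
    by (rule mass_bounds[of \<rho> T']) (use r T' in auto)
  obtain C where C: "0 < C" "\<And>x \<tau> t. norm x \<le> r \<Longrightarrow> 0 < \<tau> \<Longrightarrow> \<tau> < t \<Longrightarrow> t \<le> T' \<Longrightarrow>
    ennreal (u x t) \<le> ennreal C * (1 + heat_potential (trace_measure \<rho> \<tau>) x t + heat_potential (source_measure \<rho> T') x t)"
    by (rule representation_bound[OF r T']) blast
  define D where "D = 1 + T' powr (?n / 2) + A"
  have D: "1 \<le> D" using A(1) by (simp add: D_def)
  have "ennreal (u x t) \<le> ennreal (C * D * t powr (- ?n / 2)) + ennreal (C * D) * heat_potential (source_measure \<rho> T') x t"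
    if x: "norm x \<le> r" and t: "0 < t" "t \<le> T'" for x t
  proof -
    let ?V = "heat_potential (source_measure \<rho> T') x t" and ?w = "t powr (- ?n / 2)"
    have trace: "heat_potential (trace_measure \<rho> (t / 2)) x t \<le> ennreal (A * ?w)"
      using heat_potential_half_time_trace_le[OF _ _ masses_leD(1)[OF A(2), of "t / 2"], of x] t T' A(1)
      by (simp add: ennreal_mult' mult.commute)
    have "1 \<le> T' powr (?n / 2) * ?w"
      using t by (simp add: powr_minus_divide powr_mono2)
    then have one: "1 \<le> ennreal (T' powr (?n / 2) * ?w)" by simp
    have "ennreal (u x t) \<le> ennreal C * (1 + heat_potential (trace_measure \<rho> (t / 2)) x t + ?V)"
      using C(2)[OF x, of "t / 2" t] t by simp
    also have "\<dots> \<le> ennreal C * (ennreal (T' powr (?n / 2) * ?w) + ennreal (A * ?w) + ?V)"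
      by (intro mult_left_mono add_mono one trace) auto
    also have "\<dots> = ennreal (C * ((T' powr (?n / 2) + A) * ?w)) + ennreal C * ?V"
      using A(1) C(1) by (simp add: distrib_left distrib_right ennreal_mult')
    also have "\<dots> \<le> ennreal (C * D * ?w) + ennreal (C * D) * ?V"
    proof (intro add_mono ennreal_leI mult_right_mono)
      show "C * ((T' powr (?n / 2) + A) * ?w) \<le> C * D * ?w"
        unfolding mult.assoc using C(1) by (intro mult_left_mono mult_right_mono) (auto simp: D_def)
      show "C \<le> C * D" using C(1) D by simp
    qed auto
    finally show ?thesis .
  qed
  moreover have "0 < C * D" using C(1) D by simp
  ultimately show thesis using that by blast
qed

lemma heat_potential_source_measure_mono_time:
  assumes "t \<le> T''" "T'' \<le> T'" "T' \<le> T"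
  shows "heat_potential (source_measure \<rho> T') x t = heat_potential (source_measure \<rho> T'') x t"
  unfolding source_measure_def
  by (rule heat_potential_density_cong)
    (use assms borel_measurable_source_density in \<open>auto simp: source_density_def indicator_def\<close>)

lemma small_initial_source:
  assumes r: "0 \<le> r" "r < R" and T': "0 < T'" "T' < T" and \<epsilon>: "0 < \<epsilon>" "0 < S"
  obtains T'' where "0 < T''" "T'' \<le> T'" "T'' \<le> S" "(\<integral>\<^sup>+p. source_density r T'' p \<partial>lborel) \<le> ennreal \<epsilon>"
proof -
  obtain A where A: "masses_le r T' A"
    by (rule mass_bounds[OF r T']) blast
  obtain \<tau> where \<tau>: "0 < \<tau>" "emeasure (source_measure r T') {p. snd p < \<tau>} < ennreal \<epsilon>"
  proof (rule emeasure_sublevel_small[of snd "source_measure r T'" "ennreal \<epsilon>"])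
    show "snd \<in> borel_measurable (source_measure r T')"
      by (subst measurable_cong_sets[OF sets_source_measure refl]) (simp add: borel_prod[symmetric])
    show "AE p in source_measure r T'. 0 < snd p"
      using AE_source_measure_time[of T' r] T' by auto
    show "emeasure (source_measure r T') (space (source_measure r T')) < \<infinity>"
      using masses_leD(2)[OF A] by (auto intro: order.strict_trans1)
  qed (use \<epsilon> in auto)
  define T'' where "T'' = min \<tau> (min T' S)"
  have T'': "0 < T''" "T'' \<le> T'" "T'' \<le> S" "T'' \<le> \<tau>" using \<tau> T' \<epsilon> by (auto simp: T''_def)
  have "{p::'a \<times> real. snd p < \<tau>} \<in> sets borel" by (intro borel_open open_Collect_less continuous_intros)
  then have "(\<integral>\<^sup>+p\<in>{p. snd p < \<tau>}. source_density r T' p \<partial>lborel) = emeasure (source_measure r T') {p. snd p < \<tau>}"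
    unfolding source_measure_def using borel_measurable_source_density[of T' r] T' by (subst emeasure_density) auto
  moreover have "(\<integral>\<^sup>+p. source_density r T'' p \<partial>lborel) \<le> (\<integral>\<^sup>+p\<in>{p. snd p < \<tau>}. source_density r T' p \<partial>lborel)"
    using T'' by (intro nn_integral_mono) (auto simp: source_density_def indicator_def)
  ultimately show thesis using \<tau>(2) T'' that by (auto intro: order_trans less_imp_le)
qed

definition doubling_point :: "real \<Rightarrow> real \<Rightarrow> 'a \<Rightarrow> real \<Rightarrow> real \<Rightarrow> bool" where
  "doubling_point r \<tau> x t d \<longleftrightarrow> 0 < d \<and> 1 \<le> u x t \<and> 1 \<le> u x t * d ^ DIM('a) \<and>
    (\<forall>y s. dist x y \<le> d / 2 \<longrightarrow> t - (d / 2)\<^sup>2 \<le> s \<longrightarrow> s < t \<longrightarrow>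
      norm y \<le> r \<and> 0 < s \<and> s < \<tau> \<and> u y s \<le> 2 ^ DIM('a) * u x t)"

lemma weighted_value_bounded:
  fixes V :: "'a \<Rightarrow> real \<Rightarrow> ennreal"
  assumes C: "0 < C" and repr: "\<And>x t. norm x \<le> r' \<Longrightarrow> 0 < t \<Longrightarrow> t \<le> T'' \<Longrightarrow>
      ennreal (u x t) \<le> ennreal (C * t powr (- real DIM('a) / 2)) + V x t"
    and half: "\<And>x t d. doubling_point r' T'' x t d \<Longrightarrow> V x t \<le> ennreal (u x t / 2)"
    and T'': "T'' \<le> T" and \<sigma>: "0 \<le> \<sigma>" "\<sigma> \<le> 1" "\<sigma>\<^sup>2 < t0" and x0: "norm x0 + \<sigma> \<le> r'" and t0: "t0 < T''"
  shows "u x0 t0 * \<sigma> ^ DIM('a) \<le> 1 + 2 * C"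
proof -
  obtain x t d where d: "0 \<le> d" "dist x0 x \<le> \<sigma> - d" "t0 - \<sigma>\<^sup>2 + d\<^sup>2 \<le> t" "t \<le> t0"
    and max: "u x0 t0 * \<sigma> ^ DIM('a) \<le> u x t * d ^ DIM('a)"
    and doubling: "\<And>y s. 0 < d \<Longrightarrow> dist x y \<le> d / 2 \<Longrightarrow> t - (d / 2)\<^sup>2 \<le> s \<Longrightarrow> s \<le> t \<Longrightarrow> u y s \<le> 2 ^ DIM('a) * u x t"
    by (rule parabolic_point_picking[where v=u and ?x0.0=x0 and ?t0.0=t0 and N="DIM('a)", OF \<sigma>(1)
          continuous_on_subset[OF C21_continuous_on(1)[OF reg]] nonneg]) (use t0 T'' \<sigma> in auto)
  have t: "0 < t" "t < T''" "d\<^sup>2 \<le> t" using d(3,4) \<sigma>(3) t0 zero_le_power2[of d] by linarith+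
  have x: "norm x \<le> r' - d"
    using d(2) x0 norm_triangle_ineq2[of x x0] by (simp add: dist_norm norm_minus_commute)
  have M: "0 \<le> u x t" using nonneg[of t x] t T'' by simp
  have "u x t * d ^ DIM('a) \<le> 1 + 2 * C"
  proof (cases "u x t * d ^ DIM('a) \<le> 1")
    case False
    then have dpos: "0 < d" using d(1) by (cases "d = 0") (auto simp: power_0_left)
    have "d \<le> 1" using d(2) \<sigma>(2) zero_le_dist[of x0 x] by linarith
    then have M1: "1 \<le> u x t" using False M mult_left_mono[OF power_le_one[OF d(1)], of "u x t" "DIM('a)"] by simp
    have "doubling_point r' T'' x t d"
      unfolding doubling_point_def
    proof (intro conjI allI impI)
      fix y s assume y: "dist x y \<le> d / 2" and s: "t - (d / 2)\<^sup>2 \<le> s" "s < t"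
      have "norm y \<le> r'" using y x dpos norm_triangle_ineq2[of y x] by (simp add: dist_norm norm_minus_commute)
      moreover have "(d / 2)\<^sup>2 \<le> d\<^sup>2" using dpos by (intro power_mono) auto
      then have "0 < s" using s(1) d(3) \<sigma>(3) by linarith
      ultimately show "norm y \<le> r'" "0 < s" "s < T''" "u y s \<le> 2 ^ DIM('a) * u x t"
        using doubling[OF dpos y s(1)] s(2) t(2) by simp_all
    qed (use False M1 dpos in simp_all)
    then have "V x t \<le> ennreal (u x t / 2)" by (rule half)
    moreover have "ennreal (u x t) \<le> ennreal (C * t powr (- real DIM('a) / 2)) + V x t"
      using x d(1) t by (intro repr) auto
    ultimately have "u x t * d ^ DIM('a) \<le> 2 * C"
      using mult_power_le_after_absorption[OF C t(1) d(1) t(3) M] by blast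
    then show ?thesis by simp
  qed (use C in simp)
  then show ?thesis using max by linarith
qed

lemma critical_source_potential_le_half:
  assumes L: "0 \<le> L" and C: "0 < C" and r: "0 \<le> \<rho>" "\<rho> < R" and T': "0 < T'" "T' < T" "0 < S"
    and src: "\<And>x t. norm x \<le> r' \<Longrightarrow> 0 < t \<Longrightarrow> t < T' \<Longrightarrow>
      heat_op u x t \<le> L * (1 + u x t powr ((real DIM('a) + 2) / real DIM('a)))"
  obtains T'' where "0 < T''" "T'' \<le> T'" "T'' \<le> S" "\<And>x t d. doubling_point r' T'' x t d \<Longrightarrow>
    ennreal C * heat_potential (source_measure \<rho> T'') x t \<le> ennreal (u x t / 2)"
proof -
  let ?n = "real DIM('a)"
  define B where "B = L * (1 + 2 powr (?n + 2))"
  have B: "0 \<le> B" using L by (simp add: B_def)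
  obtain \<epsilon> where \<epsilon>: "0 < \<epsilon>" and half: "\<And>h (x::'a) t M d. h \<in> borel_measurable borel \<Longrightarrow> 0 < M \<Longrightarrow> 0 < d \<Longrightarrow> 1 \<le> M * d ^ DIM('a) \<Longrightarrow>
    (\<And>y s. dist x y \<le> d / 2 \<Longrightarrow> t - (d / 2)\<^sup>2 \<le> s \<Longrightarrow> s < t \<Longrightarrow> h (y, s) \<le> ennreal (B * M powr ((?n + 2) / ?n))) \<Longrightarrow>
    (\<integral>\<^sup>+p. h p \<partial>lborel) \<le> ennreal \<epsilon> \<Longrightarrow>
    ennreal C * heat_potential (density lborel h) x t \<le> ennreal (M / 2)"
    by (rule critical_heat_potential_le_half[OF B C]) blast
  obtain T'' where T'': "0 < T''" "T'' \<le> T'" "T'' \<le> S"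
    and mass: "(\<integral>\<^sup>+p. source_density \<rho> T'' p \<partial>lborel) \<le> ennreal \<epsilon>"
    by (rule small_initial_source[OF r T'(1,2) \<epsilon> T'(3)])
  show thesis
  proof (rule that[OF T''])
    fix x t d
    assume "doubling_point r' T'' x t d"
    then have M: "1 \<le> u x t" and d: "0 < d" "1 \<le> u x t * d ^ DIM('a)"
      and near: "\<And>y s. dist x y \<le> d / 2 \<Longrightarrow> t - (d / 2)\<^sup>2 \<le> s \<Longrightarrow> s < t \<Longrightarrow>
        norm y \<le> r' \<and> 0 < s \<and> s < T'' \<and> u y s \<le> 2 ^ DIM('a) * u x t"
      by (auto simp: doubling_point_def)
    show "ennreal C * heat_potential (source_measure \<rho> T'') x t \<le> ennreal (u x t / 2)"
      unfolding source_measure_def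
    proof (rule half[OF borel_measurable_source_density _ d])
      fix y s assume ys: "dist x y \<le> d / 2" "t - (d / 2)\<^sup>2 \<le> s" "s < t"
      have "heat_op u y s \<le> L * (1 + u y s powr ((?n + 2) / ?n))"
        using near[OF ys] T'' by (intro src) auto
      also have "\<dots> \<le> L * ((1 + 2 powr (?n + 2)) * u x t powr ((?n + 2) / ?n))"
        using near[OF ys] nonneg[of s y] M T' T'' L by (intro mult_left_mono critical_power_le_of_doubling) auto
      finally have "heat_op u y s \<le> B * u x t powr ((?n + 2) / ?n)" by (simp add: B_def mult.assoc)
      then show "source_density \<rho> T'' (y, s) \<le> ennreal (B * u x t powr ((?n + 2) / ?n))"
        by (auto simp: source_density_def indicator_def intro: ennreal_leI)
    qed (use M T' T'' mass in auto)
  qed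
qed

lemma critical_source_growth:
  assumes L: "0 \<le> L" and r: "0 \<le> r" "r < r'" "r' < R" and T': "0 < T'" "T' < T"
    and src: "\<And>x t. norm x \<le> r' \<Longrightarrow> 0 < t \<Longrightarrow> t < T' \<Longrightarrow>
      heat_op u x t \<le> L * (1 + u x t powr ((real DIM('a) + 2) / real DIM('a)))"
  obtains K T'' where "0 < T''" "T'' < T" "\<And>x t. norm x \<le> r \<Longrightarrow> 0 < t \<Longrightarrow> t < T'' \<Longrightarrow> u x t \<le> K * t powr (- real DIM('a) / 2)"
proof -
  let ?n = "real DIM('a)"
  obtain \<rho> where \<rho>: "r' < \<rho>" "\<rho> < R" using dense[OF r(3)] by blast
  obtain C where C: "0 < C" "\<And>x t. norm x \<le> r' \<Longrightarrow> 0 < t \<Longrightarrow> t \<le> T' \<Longrightarrow>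
    ennreal (u x t) \<le> ennreal (C * t powr (- ?n / 2)) + ennreal C * heat_potential (source_measure \<rho> T') x t"
    by (rule le_decay_plus_source_potential[OF _ \<rho> T']) (use r in auto)
  define S where "S = min 1 ((2 * (r' - r))\<^sup>2)"
  obtain T'' where T'': "0 < T''" "T'' \<le> T'" "T'' \<le> S"
    and half: "\<And>x t d. doubling_point r' T'' x t d \<Longrightarrow>
      ennreal C * heat_potential (source_measure \<rho> T'') x t \<le> ennreal (u x t / 2)"
    by (rule critical_source_potential_le_half[OF L C(1) _ \<rho>(2) T' _ src, of S]) (use r \<rho> in \<open>auto simp: S_def\<close>)
  have repr: "ennreal (u x t) \<le> ennreal (C * t powr (- ?n / 2)) + ennreal C * heat_potential (source_measure \<rho> T'') x t"
    if "norm x \<le> r'" "0 < t" "t \<le> T''" for x t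
    using C(2)[OF that(1,2)] heat_potential_source_measure_mono_time[OF that(3) T''(2)] that(3) T' T''(2) by simp
  have "u x t \<le> (1 + 2 * C) * 2 ^ DIM('a) * t powr (- ?n / 2)" if x: "norm x \<le> r" and t: "0 < t" "t < T''" for x t
  proof -
    have "sqrt t \<le> 2" "sqrt t \<le> 2 * (r' - r)" using t T''(3) r by (auto simp: S_def intro: real_le_lsqrt)
    then have "sqrt t / 2 \<le> 1" "norm x + sqrt t / 2 \<le> r'" using x by (simp_all add: algebra_simps)
    then have "u x t * (sqrt t / 2) ^ DIM('a) \<le> 1 + 2 * C"
      using t T' T'' by (intro weighted_value_bounded[OF C(1) repr half]) (auto simp: power_divide)
    moreover have "(sqrt t / 2) ^ DIM('a) = t powr (?n / 2) / 2 ^ DIM('a)"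
      using t(1) by (simp add: power_divide powr_half_sqrt[symmetric] powr_realpow[symmetric] powr_powr)
    ultimately show ?thesis using t(1) by (simp add: powr_minus field_simps)
  qed
  then show thesis using T' T'' by (intro that[of T'' "(1 + 2 * C) * 2 ^ DIM('a)"]) auto
qed

end

lemma le_critical_power_if_le_nnpow:
  assumes "0 \<le> C" "0 \<le> v" "0 \<le> \<sigma>" "\<sigma> \<le> q" and f_le: "ennreal f \<le> ennreal C * ennreal (nnpow v \<sigma>)"
  shows "f \<le> C * (1 + v powr q)"
proof -
  have "ennreal f \<le> ennreal (C * nnpow v \<sigma>)" using f_le assms(1) by (simp add: ennreal_mult')
  then have "f \<le> C * nnpow v \<sigma>"
    using assms(1) by (subst (asm) ennreal_le_iff) (auto simp: nnpow_def)
  also have "\<dots> \<le> C * (1 + v powr q)"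
    using powr_le_one_add_powr[OF assms(2-4)] assms(1) by (intro mult_left_mono) (auto simp: nnpow_def)
  finally show ?thesis .
qed

lemma bigo_SUP_at_right_0:
  fixes f :: "'b \<Rightarrow> real \<Rightarrow> real"
  assumes "A \<noteq> {}" "0 < T" and nonneg: "\<And>x t. x \<in> A \<Longrightarrow> 0 < t \<Longrightarrow> t < T \<Longrightarrow> 0 \<le> f x t"
    and f_le: "\<And>x t. x \<in> A \<Longrightarrow> 0 < t \<Longrightarrow> t < T \<Longrightarrow> f x t \<le> K * g t"
  shows "(\<lambda>t. SUP x\<in>A. f x t) \<in> O[at_right 0](g)"
proof (rule bigoI[where c="\<bar>K\<bar>"])
  have "norm (SUP x\<in>A. f x t) \<le> \<bar>K\<bar> * norm (g t)" if t: "0 < t" "t < T" for t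
  proof -
    obtain a where a: "a \<in> A" using assms(1) by blast
    have "bdd_above ((\<lambda>x. f x t) ` A)" using f_le[OF _ t] by (intro bdd_aboveI2) auto
    then have "0 \<le> (SUP x\<in>A. f x t)" using nonneg[OF a t] a by (rule order_trans[OF _ cSUP_upper, rotated 2])
    moreover have "(SUP x\<in>A. f x t) \<le> K * g t" using assms(1) f_le[OF _ t] by (rule cSUP_least)
    ultimately show ?thesis using abs_ge_self[of "K * g t"] by (simp add: abs_mult)
  qed
  then show "\<forall>\<^sub>F t in at_right 0. norm (SUP x\<in>A. f x t) \<le> \<bar>K\<bar> * norm (g t)"
    unfolding eventually_at_right_field using assms(2) by auto
qed

theorem theorem3p1:
  fixes u :: "'a::euclidean_space \<Rightarrow> real \<Rightarrow> real"
    and \<alpha> lam \<sigma> :: real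
  assumes alpha: "0 < \<alpha>" "\<alpha> < real DIM('a) + 2"
    and hlam: "0 < lam" "lam < (real DIM('a) + 2 - \<alpha>) / real DIM('a)"
    and sig: "0 \<le> \<sigma>" "\<sigma> \<le> (real DIM('a) + 2) / real DIM('a)"
    and nonneg: "\<And>x t. 0 < t \<Longrightarrow> t < 16 \<Longrightarrow> 0 \<le> u x t"
    and reg: "C21 u (UNIV \<times> {0<..<16})"
    and Llam: "set_integrable lborel (UNIV \<times> {0<..<16}) (\<lambda>p. u (fst p) (snd p) powr lam)"
    and lower: "\<And>x t. x \<in> ball 0 4 \<Longrightarrow> 0 < t \<Longrightarrow> t < 16 \<Longrightarrow> 0 \<le> dt u x t - lap u x t"
    and upper: "\<And>x t. x \<in> ball 0 4 \<Longrightarrow> 0 < t \<Longrightarrow> t < 16 \<Longrightarrow>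
       ennreal (dt u x t - lap u x t) \<le>
         (\<integral>\<^sup>+ p \<in> UNIV \<times> {0<..<16}.
             ennreal (heat_kernel (x - fst p) (t - snd p) powr (\<alpha> / real DIM('a))
                      * u (fst p) (snd p) powr lam) \<partial>lborel)
         * ennreal (nnpow (u x t) \<sigma>)"
  shows "(\<lambda>t. SUP x\<in>cball 0 1. u x t) \<in> O[at_right 0](\<lambda>t. t powr (- real DIM('a) / 2))"
proof -
  interpret heat_supersolution u 4 16
    by unfold_locales (use nonneg reg lower in \<open>auto simp: heat_op_def\<close>)
  obtain C where C: "0 \<le> C" "\<And>x t. norm x \<le> 2 \<Longrightarrow> t < 1 \<Longrightarrow> nonlocal_factor (\<alpha> / real DIM('a)) lam x t \<le> ennreal C"
    by (rule nonlocal_factor_bounded[OF alpha(1) hlam Llam, of 2 1]) auto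
  have src: "heat_op u x t \<le> C * (1 + u x t powr ((real DIM('a) + 2) / real DIM('a)))"
    if "norm x \<le> 2" "0 < t" "t < 1" for x t
  proof (rule le_critical_power_if_le_nnpow[OF C(1) _ sig])
    show "0 \<le> u x t" using that by (intro nonneg) auto
    show "ennreal (heat_op u x t) \<le> ennreal C * ennreal (nnpow (u x t) \<sigma>)"
      using upper[of x t, folded nonlocal_factor_def heat_op_def] mult_right_mono[OF C(2)] that by (fastforce intro: order_trans)
  qed
  obtain K T where T: "0 < T" "T < 16"
    and K: "\<And>x t. norm x \<le> 1 \<Longrightarrow> 0 < t \<Longrightarrow> t < T \<Longrightarrow> u x t \<le> K * t powr (- real DIM('a) / 2)"
    by (rule critical_source_growth[OF C(1) _ _ _ _ _ src, of 1]) auto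
  show ?thesis
    by (rule bigo_SUP_at_right_0[where T=T and K=K]) (use T K nonneg in auto)
qed

end
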